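(* Let $X$ be a complex manifold, $D\subset X$ a simple normal crossings divisor, $f:(X,D)\to(X,D)$ a strict logarithmic self-map, and $(E,\Phi)$ an $f$-linearised holomorphic vector bundle. Let $p\in D$ be a normally non-resonant isolated fixed point of $f$. Then $$\operatorname{LT}_p(f,E,\Phi)=\operatorname{Res}_p^{S_p}\left[\frac{\tau_{\Phi|S_p}\,\det(1-\mathrm d_Nf)^{-1}\,\Omega_{S_p}}{h_1,\ldots,h_m}\right].$$
   Context: Strict: $f^{-1}\mathcal I_{D_i}\cdot\mathcal O_X=\mathcal I_{D_i}$ for each irreducible component $D_i$ of $D$. At $p$, lying on exactly $k$ branches of $D$, take adapted coordinates $(z_1,\ldots,z_k,w_1,\ldots,w_m)$ centred at $p$, $D=\{z_1\cdots z_k=0\}$, $f^*z_i=z_ia_i(z,w)$ with $a_i$ units, $f^*w_\alpha=F_\alpha(z,w)$; $n=k+m$. $S_p=\{z_1=\cdots=z_k=0\}$, $h_\alpha(w)=w_\alpha-F_\alpha(0,w)$, $\Omega_{S_p}=\mathrm dw_1\wedge\cdots\wedge \mathrm dw_m$, $\det(1-\mathrm d_Nf)=\prod_{i=1}^k(1-a_i(0,w))$; $p$ is normally non-resonant if this is non-zero at $p$. The local Lefschetz term is the Grothendieck residue $$\operatorname{LT}_p(f,E,\Phi)=\operatorname{Res}_p\left[\frac{\tau_{\Phi,p}\,\mathrm dx_1\wedge\cdots\wedge \mathrm dx_n}{x_1-f_1,\ldots,x_n-f_n}\right],$$ for local coordinates $x$ centred at $p$, $f_i=f^*x_i$, where $\Phi:f^*E\to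 E$ is the bundle morphism and $\tau_{\Phi,p}\in A_{f,p}=\mathcal O_{X,p}/(x_1-f_1,\ldots,x_n-f_n)$ is the class of the trace of its matrix in a local frame of $E$. In the normally non-resonant case $A_{f,p}$ is canonically identified with $\mathcal O_{S_p,p}/(h_1,\ldots,h_m)$ and $\tau_{\Phi|S_p}$ is the image of $\tau_{\Phi,p}$. $\operatorname{Res}^{S_p}_p$ is the Grothendieck residue on $S_p$. *)

theory Defs
  imports "HOL-Analysis.Analysis"
begin

section \<open>Holomorphic functions of several variables\<close>

text \<open>Meant for open sets: Frechet differentiable with complex linear derivative.\<close>

definition cn_holomorphic_on :: "(complex^'n::finite \<Rightarrow> complex) \<Rightarrow> (complex^'n) set \<Rightarrow> bool" where
  "cn_holomorphic_on u V \<longleftrightarrow>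
     (\<forall>z\<in>V. \<exists>L. (u has_derivative L) (at z) \<and> (\<forall>k v. L (k *s v) = k * L v))"


section \<open>Grothendieck residues at the origin\<close>

text \<open>
  To treat all dimensions (including 0) at once, \<open>\<complex>\<^sup>J\<close> for a set \<open>J\<close> of coordinates is realised as
  the coordinate subspace of \<open>\<complex>\<^sup>n\<close> on which the coordinates outside \<open>J\<close> vanish; its holomorphic
  germs at 0 are the restrictions of holomorphic germs of \<open>\<complex>\<^sup>n\<close>. Full space is \<open>J = UNIV\<close>.
\<close>

definition coord_space :: "'n set \<Rightarrow> (complex^'n) set" where
  "coord_space J = {z. \<forall>i. i \<notin> J \<longrightarrow> z $ i = 0}"

definition multi_indices :: "'n set \<Rightarrow> ('n \<Rightarrow> nat) set" where
  "multi_indices J = {\<alpha>. \<forall>i. i \<notin> J \<longrightarrow> \<alpha> i = 0}"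

text \<open>Coefficient of \<open>z\<^sup>\<alpha>\<close> in the power series at 0 of the restriction of \<open>u\<close> to \<open>\<complex>\<^sup>J\<close>.\<close>

definition taylor_coeff :: "'n set \<Rightarrow> (complex^'n \<Rightarrow> complex) \<Rightarrow> ('n \<Rightarrow> nat) \<Rightarrow> complex" where
  "taylor_coeff J u \<alpha> = (THE c. \<exists>r>0. \<exists>C.
     (\<forall>z \<in> ball 0 r \<inter> coord_space J.
        ((\<lambda>\<beta>. C \<beta> * (\<Prod>i\<in>UNIV. z $ i ^ \<beta> i)) has_sum u z) (multi_indices J)) \<and>
     c = C \<alpha>)"

text \<open>The \<open>J \<times> J\<close> minor, padded with the identity.\<close>

definition minor_det :: "'n::finite set \<Rightarrow> ('n \<Rightarrow> 'n \<Rightarrow> complex) \<Rightarrow> complex" where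
  "minor_det J b =
     det (\<chi> i j. if i \<in> J \<and> j \<in> J then b i j else if i = j then 1 else 0)"

text \<open>
  \<open>grothendieck_residue J u g\<close> is the residue symbol at the origin of \<open>\<complex>\<^sup>J\<close> with numerator
  \<open>u \<And>\<^bsub>j \<in> J\<^esub> dz\<^sub>j\<close> and denominators \<open>(g\<^sub>j)\<^bsub>j \<in> J\<^esub>\<close>, for germs \<open>g\<^sub>j\<close> whose only common zero
  is 0. By the Nullstellensatz one can write \<open>z\<^sub>i ^ (\<alpha>\<^sub>i + 1) = \<Sum>\<^sub>j b\<^sub>i\<^sub>j g\<^sub>j\<close> with holomorphic
  germs \<open>b\<^sub>i\<^sub>j\<close>, and the transformation law gives
  \<open>Res [u dz / g] = Res [u det b dz / (z\<^sub>i ^ (\<alpha>\<^sub>i + 1))]\<close>, which is the coefficient of \<open>z\<^sup>\<alpha>\<close> in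
  \<open>u det b\<close>; this does not depend on the choice of \<open>\<alpha>\<close> and \<open>b\<close>. The normalisation is that of
  \<open>(2 \<pi> i)\<^sup>-\<^sup>n \<integral> u dz / (g\<^sub>1 \<dots> g\<^sub>n)\<close> over \<open>|g\<^sub>j| = \<epsilon>\<^sub>j\<close>. The form and the denominators are
  listed in the same order of \<open>J\<close>, and the symbol does not depend on that order. For \<open>J = {}\<close>
  it is \<open>u 0\<close>.
\<close>

definition grothendieck_residue ::
    "'n::finite set \<Rightarrow> (complex^'n \<Rightarrow> complex) \<Rightarrow> ('n \<Rightarrow> complex^'n \<Rightarrow> complex) \<Rightarrow> complex" where
  "grothendieck_residue J u g = (THE c. \<exists>r>0. \<exists>\<alpha> \<in> multi_indices J. \<exists>b.
     (\<forall>i\<in>J. \<forall>j\<in>J. cn_holomorphic_on (b i j) (ball 0 r)) \<and>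
     (\<forall>z \<in> ball 0 r \<inter> coord_space J. \<forall>i\<in>J. z $ i ^ Suc (\<alpha> i) = (\<Sum>j\<in>J. b i j z * g j z)) \<and>
     c = taylor_coeff J (\<lambda>z. u z * minor_det J (\<lambda>i j. b i j z)) \<alpha>)"


section \<open>Complex manifolds\<close>

type_synonym ('a, 'n) chart = "'a set \<times> ('a \<Rightarrow> complex^'n)"

definition chart_inv :: "('a, 'n::finite) chart \<Rightarrow> complex^'n \<Rightarrow> 'a" where
  "chart_inv c = inv_into (fst c) (snd c)"

definition is_chart :: "('a::topological_space, 'n::finite) chart \<Rightarrow> bool" where
  "is_chart c \<longleftrightarrow> open (fst c) \<and> open (snd c ` fst c) \<and>
     homeomorphism (fst c) (snd c ` fst c) (snd c) (chart_inv c)"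

definition chart_compatible :: "('a, 'n::finite) chart \<Rightarrow> ('a, 'n) chart \<Rightarrow> bool" where
  "chart_compatible c d \<longleftrightarrow>
     (\<forall>i. cn_holomorphic_on (\<lambda>z. snd d (chart_inv c z) $ i) (snd c ` (fst c \<inter> fst d))) \<and>
     (\<forall>i. cn_holomorphic_on (\<lambda>z. snd c (chart_inv d z) $ i) (snd d ` (fst c \<inter> fst d)))"

text \<open>The manifold is the whole (Hausdorff) space \<open>'a\<close>, with atlas \<open>A\<close>.\<close>

definition complex_manifold :: "('a::t2_space, 'n::finite) chart set \<Rightarrow> bool" where
  "complex_manifold A \<longleftrightarrow>
     (\<forall>c\<in>A. is_chart c) \<and> (\<forall>c\<in>A. \<forall>d\<in>A. chart_compatible c d) \<and> (\<Union>c\<in>A. fst c) = UNIV"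

definition local_coordinates ::
    "('a::t2_space, 'n::finite) chart set \<Rightarrow> 'a \<Rightarrow> ('a, 'n) chart \<Rightarrow> bool" where
  "local_coordinates A p c \<longleftrightarrow>
     is_chart c \<and> (\<forall>d\<in>A. chart_compatible c d) \<and> p \<in> fst c \<and> snd c p = 0"

definition mfd_holomorphic_on ::
    "('a, 'n::finite) chart set \<Rightarrow> ('a \<Rightarrow> complex) \<Rightarrow> 'a set \<Rightarrow> bool" where
  "mfd_holomorphic_on A u W \<longleftrightarrow>
     (\<forall>c\<in>A. cn_holomorphic_on (\<lambda>z. u (chart_inv c z)) (snd c ` (fst c \<inter> W)))"

definition holomorphic_self_map ::
    "('a::t2_space, 'n::finite) chart set \<Rightarrow> ('a \<Rightarrow> 'a) \<Rightarrow> bool" where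
  "holomorphic_self_map A f \<longleftrightarrow> continuous_on UNIV f \<and>
     (\<forall>c\<in>A. \<forall>d\<in>A. \<forall>i.
        cn_holomorphic_on (\<lambda>z. snd d (f (chart_inv c z)) $ i) (snd c ` (fst c \<inter> f -` fst d)))"

definition coord_rep :: "('a, 'n::finite) chart \<Rightarrow> ('a \<Rightarrow> 'a) \<Rightarrow> complex^'n \<Rightarrow> complex^'n" where
  "coord_rep c f z = snd c (f (chart_inv c z))"


section \<open>Simple normal crossings divisors and strict logarithmic maps\<close>

text \<open>
  A (reduced) simple normal crossings divisor is given by the set \<open>\<D>\<close> of its irreducible
  components; the divisor is \<open>\<Union>\<D>\<close>. Near each point the components are distinct coordinate
  hyperplanes, so that each of them is a closed submanifold (and the family is locally finite);
  irreducibility of a smooth component is connectedness.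
\<close>

definition snc_divisor :: "('a::t2_space, 'n::finite) chart set \<Rightarrow> 'a set set \<Rightarrow> bool" where
  "snc_divisor A \<D> \<longleftrightarrow>
     (\<forall>C\<in>\<D>. C \<noteq> {} \<and> connected C) \<and>
     (\<forall>q. \<exists>c idx. local_coordinates A q c \<and>
        inj_on idx {C \<in> \<D>. C \<inter> fst c \<noteq> {}} \<and>
        (\<forall>C\<in>\<D>. C \<inter> fst c \<noteq> {} \<longrightarrow> C \<inter> fst c = {y \<in> fst c. snd c y $ idx C = 0}))"

text \<open>Germs at a point are represented by functions, equality of germs being eventual equality.\<close>

definition hol_germs :: "('a::t2_space, 'n::finite) chart set \<Rightarrow> 'a \<Rightarrow> ('a \<Rightarrow> complex) set" where
  "hol_germs A q = {u. \<exists>W. open W \<and> q \<in> W \<and> mfd_holomorphic_on A u W}"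

text \<open>Stalks at \<open>q\<close> of the ideal sheaf \<open>\<I>\<^sub>C\<close> and of \<open>f\<^sup>-\<^sup>1 \<I>\<^sub>C \<cdot> \<O>\<^sub>X\<close>.\<close>

definition ideal_stalk ::
    "('a::t2_space, 'n::finite) chart set \<Rightarrow> 'a set \<Rightarrow> 'a \<Rightarrow> ('a \<Rightarrow> complex) set" where
  "ideal_stalk A C q =
     {u \<in> hol_germs A q. eventually (\<lambda>y. y \<in> C \<longrightarrow> u y = 0) (nhds q)}"

definition inverse_image_ideal_stalk ::
    "('a::t2_space, 'n::finite) chart set \<Rightarrow> ('a \<Rightarrow> 'a) \<Rightarrow> 'a set \<Rightarrow> 'a \<Rightarrow> ('a \<Rightarrow> complex) set" where
  "inverse_image_ideal_stalk A f C q =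
     {u \<in> hol_germs A q. \<exists>(N::nat) b v.
        (\<forall>k<N. b k \<in> hol_germs A q \<and> v k \<in> ideal_stalk A C (f q)) \<and>
        eventually (\<lambda>y. u y = (\<Sum>k<N. b k y * v k (f y))) (nhds q)}"

definition strict_log_self_map ::
    "('a::t2_space, 'n::finite) chart set \<Rightarrow> 'a set set \<Rightarrow> ('a \<Rightarrow> 'a) \<Rightarrow> bool" where
  "strict_log_self_map A \<D> f \<longleftrightarrow>
     holomorphic_self_map A f \<and> f -` \<Union>\<D> \<subseteq> \<Union>\<D> \<and>
     (\<forall>C\<in>\<D>. \<forall>q. inverse_image_ideal_stalk A f C q = ideal_stalk A C q)"

text \<open>
  Coordinates centred at \<open>p\<close> adapted to the divisor: \<open>I\<close> is the set of indices of the normal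
  coordinates \<open>z\<^sub>i\<close>, and the coordinates with index in \<open>- I\<close> are the \<open>w\<^sub>\<alpha>\<close>. Thus
  \<open>S\<^sub>p = {z\<^sub>i = 0, i \<in> I}\<close> corresponds to \<open>coord_space (- I)\<close>.
\<close>

definition adapted_coordinates ::
    "('a::t2_space, 'n::finite) chart set \<Rightarrow> 'a set set \<Rightarrow> 'a \<Rightarrow> ('a, 'n) chart \<Rightarrow> 'n set \<Rightarrow> bool" where
  "adapted_coordinates A \<D> p c I \<longleftrightarrow>
     local_coordinates A p c \<and>
     card I = card {C \<in> \<D>. p \<in> C} \<and>
     \<Union>\<D> \<inter> fst c = {q \<in> fst c. (\<Prod>i\<in>I. snd c q $ i) = 0}"

text \<open>The units \<open>a\<^sub>i\<close> with \<open>f\<^sup>* z\<^sub>i = z\<^sub>i a\<^sub>i\<close>, \<open>i \<in> I\<close>; for strict \<open>f\<close> they exist, uniquely as germs.\<close>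

definition normal_units ::
    "('a, 'n::finite) chart \<Rightarrow> 'n set \<Rightarrow> ('a \<Rightarrow> 'a) \<Rightarrow> ('n \<Rightarrow> complex^'n \<Rightarrow> complex) \<Rightarrow> bool" where
  "normal_units c I f a \<longleftrightarrow> (\<exists>V. open V \<and> 0 \<in> V \<and>
     (\<forall>i\<in>I. cn_holomorphic_on (a i) V \<and>
        (\<forall>z\<in>V. a i z \<noteq> 0 \<and> coord_rep c f z $ i = z $ i * a i z)))"

text \<open>\<open>det (1 - d\<^sub>N f)\<close>, a function on \<open>S\<^sub>p\<close>, so to be used at points of \<open>coord_space (- I)\<close>.\<close>

definition det_normal ::
    "'n set \<Rightarrow> ('n \<Rightarrow> complex^'n \<Rightarrow> complex) \<Rightarrow> complex^'n \<Rightarrow> complex" where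
  "det_normal I a w = (\<Prod>i\<in>I. 1 - a i w)"

definition normally_nonresonant :: "'n set \<Rightarrow> ('n \<Rightarrow> complex^'n \<Rightarrow> complex) \<Rightarrow> bool" where
  "normally_nonresonant I a \<longleftrightarrow> det_normal I a 0 \<noteq> 0"


section \<open>Linearised holomorphic vector bundles\<close>

text \<open>
  A local trivialisation over \<open>tdom T\<close> of rank \<open>trank T\<close>; \<open>\<complex>\<^sup>r\<close> consists of the functions
  \<open>nat \<Rightarrow> complex\<close> vanishing from \<open>r\<close> on.
\<close>

record ('a, 'e) triv =
  tdom :: "'a set"
  trank :: nat
  tcoord :: "'e \<Rightarrow> nat \<Rightarrow> complex"

record ('a, 'e) vbundle =
  proj :: "'e \<Rightarrow> 'a"
  vadd :: "'e \<Rightarrow> 'e \<Rightarrow> 'e"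
  vscale :: "complex \<Rightarrow> 'e \<Rightarrow> 'e"
  trivs :: "('a, 'e) triv set"

definition fibre :: "('a, 'e) vbundle \<Rightarrow> 'a \<Rightarrow> 'e set" where
  "fibre E q = {v. proj E v = q}"

definition is_triv :: "('a::topological_space, 'e) vbundle \<Rightarrow> ('a, 'e) triv \<Rightarrow> bool" where
  "is_triv E T \<longleftrightarrow> open (tdom T) \<and>
     (\<forall>q\<in>tdom T.
        bij_betw (tcoord T) (fibre E q) {x. \<forall>i\<ge>trank T. x i = 0} \<and>
        (\<forall>u\<in>fibre E q. \<forall>v\<in>fibre E q. vadd E u v \<in> fibre E q \<and>
           tcoord T (vadd E u v) = (\<lambda>i. tcoord T u i + tcoord T v i)) \<and>
        (\<forall>k. \<forall>u\<in>fibre E q. vscale E k u \<in> fibre E q \<and>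
           tcoord T (vscale E k u) = (\<lambda>i. k * tcoord T u i)))"

text \<open>The \<open>j\<close>-th section, \<open>j < trank T\<close>, of the local frame corresponding to \<open>T\<close>.\<close>

definition frame :: "('a, 'e) vbundle \<Rightarrow> ('a, 'e) triv \<Rightarrow> nat \<Rightarrow> 'a \<Rightarrow> 'e" where
  "frame E T j q = inv_into (fibre E q) (tcoord T) (\<lambda>i. if i = j then 1 else 0)"

definition triv_compatible ::
    "('a, 'n::finite) chart set \<Rightarrow> ('a, 'e) vbundle \<Rightarrow> ('a, 'e) triv \<Rightarrow> ('a, 'e) triv \<Rightarrow> bool" where
  "triv_compatible A E S T \<longleftrightarrow>
     (\<forall>i<trank S. \<forall>j<trank T.
        mfd_holomorphic_on A (\<lambda>q. tcoord S (frame E T j q) i) (tdom S \<inter> tdom T) \<and>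
        mfd_holomorphic_on A (\<lambda>q. tcoord T (frame E S i q) j) (tdom S \<inter> tdom T))"

text \<open>
  The complex manifold structure of the total space is the one determined by the trivialisations,
  and the vector space axioms in the fibres follow from the fibrewise linearity of these.
\<close>

definition holomorphic_vector_bundle ::
    "('a::t2_space, 'n::finite) chart set \<Rightarrow> ('a, 'e) vbundle \<Rightarrow> bool" where
  "holomorphic_vector_bundle A E \<longleftrightarrow>
     (\<forall>T\<in>trivs E. is_triv E T) \<and>
     (\<forall>S\<in>trivs E. \<forall>T\<in>trivs E. triv_compatible A E S T) \<and>
     (\<Union>T\<in>trivs E. tdom T) = UNIV"

definition local_frame_at ::
    "('a::t2_space, 'n::finite) chart set \<Rightarrow> ('a, 'e) vbundle \<Rightarrow> 'a \<Rightarrow> ('a, 'e) triv \<Rightarrow> bool" where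
  "local_frame_at A E p T \<longleftrightarrow>
     is_triv E T \<and> (\<forall>S\<in>trivs E. triv_compatible A E S T) \<and> p \<in> tdom T"

text \<open>A bundle morphism \<open>\<Phi> : f\<^sup>* E \<rightarrow> E\<close> is a family of linear maps \<open>\<Phi> q : E\<^bsub>f q\<^esub> \<rightarrow> E\<^sub>q\<close>.\<close>

definition linearisation ::
    "('a::t2_space, 'n::finite) chart set \<Rightarrow> ('a \<Rightarrow> 'a) \<Rightarrow> ('a, 'e) vbundle \<Rightarrow> ('a \<Rightarrow> 'e \<Rightarrow> 'e) \<Rightarrow> bool" where
  "linearisation A f E \<Phi> \<longleftrightarrow>
     (\<forall>q. \<forall>u\<in>fibre E (f q). \<Phi> q u \<in> fibre E q \<and>
        (\<forall>v\<in>fibre E (f q). \<Phi> q (vadd E u v) = vadd E (\<Phi> q u) (\<Phi> q v)) \<and>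
        (\<forall>k. \<Phi> q (vscale E k u) = vscale E k (\<Phi> q u))) \<and>
     (\<forall>S\<in>trivs E. \<forall>T\<in>trivs E. \<forall>i<trank S. \<forall>j<trank T.
        mfd_holomorphic_on A (\<lambda>q. tcoord S (\<Phi> q (frame E T j (f q))) i) (tdom S \<inter> f -` tdom T))"

text \<open>Trace of the matrix of \<open>\<Phi>\<close> in a local frame; its class in \<open>A\<^bsub>f,p\<^esub>\<close> is \<open>\<tau>\<^bsub>\<Phi>,p\<^esub>\<close>.\<close>

definition frame_trace ::
    "('a \<Rightarrow> 'a) \<Rightarrow> ('a, 'e) vbundle \<Rightarrow> ('a \<Rightarrow> 'e \<Rightarrow> 'e) \<Rightarrow> ('a, 'e) triv \<Rightarrow> 'a \<Rightarrow> complex" where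
  "frame_trace f E \<Phi> T q = (\<Sum>i<trank T. tcoord T (\<Phi> q (frame E T i (f q))) i)"


section \<open>Local Lefschetz terms\<close>

text \<open>
  The local Lefschetz term at the centre of the coordinates \<open>x\<close>, computed in these coordinates
  and in the local frame \<open>T\<close>; its value does not depend on the choice of \<open>x\<close> and \<open>T\<close>.
\<close>

definition lefschetz_term ::
    "('a \<Rightarrow> 'a) \<Rightarrow> ('a, 'e) vbundle \<Rightarrow> ('a \<Rightarrow> 'e \<Rightarrow> 'e) \<Rightarrow>
     ('a, 'n::finite) chart \<Rightarrow> ('a, 'e) triv \<Rightarrow> complex" where
  "lefschetz_term f E \<Phi> x T =
     grothendieck_residue UNIV
       (\<lambda>z. frame_trace f E \<Phi> T (chart_inv x z))
       (\<lambda>i z. z $ i - coord_rep x f z $ i)"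

end

theory Submission
  imports Defs "HOL-Complex_Analysis.Cauchy_Integral_Formula"
begin

text \<open>
  The residue is the coefficient of \<open>z\<^sup>\<alpha>\<close> in \<open>u det b\<close> for any expression \<open>z\<^sub>i ^ (\<alpha>\<^sub>i + 1) = \<Sum>\<^sub>j b\<^sub>i\<^sub>j g\<^sub>j\<close>.
  By Cramer's rule it does not depend on that expression, and it only depends on \<open>u\<close> modulo the
  \<open>g\<^sub>j\<close>. Adjoining variables \<open>y\<close> to \<open>z\<close> together with the equations \<open>y = \<phi> z\<close> of a graph does not
  change it. For a change of coordinates \<open>\<phi> = \<psi>\<^sup>-\<^sup>1\<close> the systems \<open>(z - f z, y - \<phi> z)\<close> and
  \<open>(z - \<psi> y, y - f y)\<close> in the variables \<open>(z, y)\<close> are related by a matrix whose determinant is 1 modulo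
  the system, so the transformation law yields the independence of the coordinates.
  In adapted coordinates \<open>z\<^sub>i - f\<^sub>i = (1 - a\<^sub>i) z\<^sub>i\<close> with \<open>1 - a\<^sub>i\<close> invertible, so that \<open>x - f\<close> is related to
  \<open>(z, h)\<close> by a matrix of determinant \<open>\<Prod>(1 - a\<^sub>i)\<^sup>-\<^sup>1\<close>, and \<open>(z, h)\<close> is a graph over \<open>S\<^sub>p\<close>.
  Every step shows that a number is a value of one symbol iff it is a value of the other one. Hence
  the Nullstellensatz, which ensures that values exist, is not needed.
\<close>

section \<open>Holomorphic functions of several variables\<close>

text \<open>The obstacle is that the symbol is defined through Taylor coefficients, which do not
  follow a change of variables, while the transformation law relates two systems in the same
  variables. In the doubled variables both systems extend one of the two symbols to be compared, and
  only the transformation law has to be applied. Modulo the second system the determinant of the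
  connecting matrix is the Jacobian determinant of \<phi> at \<psi> y times that of \<psi> at y,
  hence 1 by the chain rule. The connecting matrices come from Hadamard's lemma: u(p) - u(q) is a
  combination of the p_i - q_i with holomorphic coefficients that are the partial derivatives of u
  where p = q. This requires the partial derivatives to be holomorphic, which Cauchy's formula in
  one variable provides. Extension by a graph carries values in one direction only. For the
  converse, a representation of the extended system is restricted to the graph. This gives some
  value of the smaller symbol, and its extension has to be the given value because values are
  unique.\<close>

definition pd :: "'n \<Rightarrow> (complex^'n::finite \<Rightarrow> complex) \<Rightarrow> complex^'n \<Rightarrow> complex" where
  "pd i u z = frechet_derivative u (at z) (axis i 1)"

lemma cn_holomorphic_onI:
  fixes u :: "complex^'n::finite \<Rightarrow> complex"
  assumes "\<And>z. z \<in> V \<Longrightarrow> (u has_derivative (\<lambda>v. \<Sum>i\<in>UNIV. v $ i * d i z)) (at z)"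
  shows "cn_holomorphic_on u V"
  unfolding cn_holomorphic_on_def
proof (intro ballI exI conjI allI)
  fix z k and v :: "complex^'n" assume "z \<in> V"
  then show "(u has_derivative (\<lambda>v. \<Sum>i\<in>UNIV. v $ i * d i z)) (at z)" by (rule assms)
  show "(\<Sum>i\<in>UNIV. (k *s v) $ i * d i z) = k * (\<Sum>i\<in>UNIV. v $ i * d i z)"
    by (simp add: sum_distrib_left mult.assoc)
qed

lemma has_derivative_clinear_expand:
  fixes L :: "complex^'n::finite \<Rightarrow> complex"
  assumes "(u has_derivative L) F" and "\<And>k v. L (k *s v) = k * L v"
  shows "L v = (\<Sum>i\<in>UNIV. v $ i * L (axis i 1))"
proof -
  have lin: "linear L" using assms(1) has_derivative_linear by blast
  have "L v = L (\<Sum>i\<in>UNIV. (v $ i) *s axis i 1)" by (simp add: basis_expansion)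
  also have "\<dots> = (\<Sum>i\<in>UNIV. L ((v $ i) *s axis i 1))" by (simp add: linear_sum[OF lin])
  finally show ?thesis by (simp add: assms(2))
qed

lemma pd_eqI:
  assumes "(u has_derivative L) (at z)"
  shows "pd i u z = L (axis i 1)"
  using frechet_derivative_at[OF assms] by (simp add: pd_def)

lemma has_derivative_pd:
  assumes "cn_holomorphic_on u V" and "z \<in> V"
  shows "(u has_derivative (\<lambda>v. \<Sum>i\<in>UNIV. v $ i * pd i u z)) (at z)"
proof -
  obtain L where L: "(u has_derivative L) (at z)" "\<And>k v. L (k *s v) = k * L v"
    using assms unfolding cn_holomorphic_on_def by blast
  have "L = (\<lambda>v. \<Sum>i\<in>UNIV. v $ i * pd i u z)"
    unfolding pd_eqI[OF L(1)] by (rule ext) (rule has_derivative_clinear_expand[OF L])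
  with L(1) show ?thesis by simp
qed

lemma cn_holomorphic_on_imp_continuous_on:
  "cn_holomorphic_on u V \<Longrightarrow> continuous_on V u"
  by (rule continuous_at_imp_continuous_on) (blast intro: has_derivative_continuous has_derivative_pd)

lemma cn_holomorphic_on_subset:
  "cn_holomorphic_on u V \<Longrightarrow> W \<subseteq> V \<Longrightarrow> cn_holomorphic_on u W"
  unfolding cn_holomorphic_on_def by blast

lemma cn_holomorphic_on_cong_open:
  assumes "cn_holomorphic_on u V" "open V" "\<And>z. z \<in> V \<Longrightarrow> v z = u z"
  shows "cn_holomorphic_on v V"
  unfolding cn_holomorphic_on_def
proof
  fix z assume z: "z \<in> V"
  obtain L where L: "(u has_derivative L) (at z)" "\<forall>k v. L (k *s v) = k * L v"
    using assms(1) z unfolding cn_holomorphic_on_def by blast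
  have "(v has_derivative L) (at z)"
    using has_derivative_transform_within_open[OF L(1) assms(2) z] assms(3) by simp
  with L(2) show "\<exists>L. (v has_derivative L) (at z) \<and> (\<forall>k v. L (k *s v) = k * L v)" by blast
qed

lemma cn_holomorphic_on_const [simp]: "cn_holomorphic_on (\<lambda>z. c) V"
  by (rule cn_holomorphic_onI[where d="\<lambda>i z. 0"]) simp

lemma cn_holomorphic_on_nth [simp]:
  fixes V :: "(complex^'b::finite) set"
  shows "cn_holomorphic_on (\<lambda>z. z $ i) V"
  unfolding cn_holomorphic_on_def
proof
  fix z :: "complex^'b" assume "z \<in> V"
  show "\<exists>L. ((\<lambda>z. z $ i) has_derivative L) (at z) \<and> (\<forall>k v. L (k *s v) = k * L v)"
    by (intro exI[of _ "\<lambda>v. v $ i"] conjI bounded_linear_imp_has_derivative bounded_linear_vec_nth) simp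
qed

lemma cn_holomorphic_on_add:
  assumes "cn_holomorphic_on u V" "cn_holomorphic_on v V"
  shows "cn_holomorphic_on (\<lambda>z. u z + v z) V"
  by (rule cn_holomorphic_onI[where d="\<lambda>i z. pd i u z + pd i v z"])
    (use has_derivative_add[OF assms[THEN has_derivative_pd]] in
      \<open>simp add: sum.distrib[symmetric] distrib_left\<close>)

lemma cn_holomorphic_on_mult:
  assumes "cn_holomorphic_on u V" "cn_holomorphic_on v V"
  shows "cn_holomorphic_on (\<lambda>z. u z * v z) V"
proof (rule cn_holomorphic_onI[where d="\<lambda>i z. u z * pd i v z + pd i u z * v z"])
  fix z assume "z \<in> V"
  from has_derivative_mult[OF assms[THEN has_derivative_pd, OF this]]
  show "((\<lambda>z. u z * v z) has_derivative
      (\<lambda>h. \<Sum>i\<in>UNIV. h $ i * (u z * pd i v z + pd i u z * v z))) (at z)"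
    by (rule has_derivative_eq_rhs)
      (simp add: sum.distrib[symmetric] distrib_left sum_distrib_left sum_distrib_right mult_ac)
qed

lemma cn_holomorphic_on_compose_field:
  assumes "cn_holomorphic_on u V"
    and "\<And>z. z \<in> V \<Longrightarrow> (h has_field_derivative h' z) (at (u z))"
  shows "cn_holomorphic_on (\<lambda>z. h (u z)) V"
proof (rule cn_holomorphic_onI[where d="\<lambda>i z. h' z * pd i u z"])
  fix z assume z: "z \<in> V"
  from has_derivative_compose[OF has_derivative_pd[OF assms(1) z]
      assms(2)[OF z, unfolded has_field_derivative_def]]
  show "((\<lambda>z. h (u z)) has_derivative (\<lambda>v. \<Sum>i\<in>UNIV. v $ i * (h' z * pd i u z))) (at z)"
    by (rule has_derivative_eq_rhs) (simp add: sum_distrib_left mult_ac)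
qed

lemma cn_holomorphic_on_inverse:
  assumes "cn_holomorphic_on u V" "\<And>z. z \<in> V \<Longrightarrow> u z \<noteq> 0"
  shows "cn_holomorphic_on (\<lambda>z. inverse (u z)) V"
  by (rule cn_holomorphic_on_compose_field[OF assms(1) DERIV_inverse]) (use assms(2) in auto)

text \<open>The criterion \<open>has_derivative_componentwise_within\<close> tests against the real
  basis, whose vectors are \<open>axis i c\<close> with \<open>c\<close> in the real basis of the
  complex numbers.\<close>

lemma has_derivative_vec_components:
  fixes p :: "'a::real_normed_vector \<Rightarrow> complex^'n::finite"
  assumes "\<And>i. ((\<lambda>w. p w $ i) has_derivative (\<lambda>h. p' h $ i)) (at z)"
  shows "(p has_derivative p') (at z)"
proof -
  have *: "((\<lambda>x. p x \<bullet> b) has_derivative (\<lambda>x. p' x \<bullet> b)) (at z within UNIV)"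
    if "b \<in> Basis" for b
  proof -
    from that obtain i c where b: "b = axis i c" unfolding Basis_vec_def by blast
    have "((\<lambda>x. p x $ i \<bullet> c) has_derivative (\<lambda>x. p' x $ i \<bullet> c)) (at z)"
      by (rule has_derivative_inner_left[OF assms])
    then show ?thesis unfolding b inner_axis .
  qed
  have "\<forall>b\<in>Basis. ((\<lambda>x. p x \<bullet> b) has_derivative (\<lambda>x. p' x \<bullet> b)) (at z)"
    using * by simp
  then show ?thesis
    by (rule has_derivative_componentwise_within[of p p' z UNIV, THEN iffD2])
qed

lemma has_derivative_compose_pd:
  fixes p :: "complex^'m::finite \<Rightarrow> complex^'n::finite"
  assumes u: "cn_holomorphic_on u V" and p: "\<And>i. cn_holomorphic_on (\<lambda>w. p w $ i) W"
    and z: "z \<in> W" "p z \<in> V"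
  shows "((\<lambda>w. u (p w)) has_derivative
    (\<lambda>h. \<Sum>j\<in>UNIV. h $ j * (\<Sum>i\<in>UNIV. pd i u (p z) * pd j (\<lambda>w. p w $ i) z))) (at z)"
proof -
  let ?p' = "\<lambda>h. \<chi> i. \<Sum>j\<in>UNIV. h $ j * pd j (\<lambda>w. p w $ i) z"
  have "(p has_derivative ?p') (at z)"
    by (rule has_derivative_vec_components) (use has_derivative_pd[OF p z(1)] in simp)
  from has_derivative_compose[OF this has_derivative_pd[OF u z(2)]]
  have "((\<lambda>w. u (p w)) has_derivative (\<lambda>h. \<Sum>i\<in>UNIV. ?p' h $ i * pd i u (p z))) (at z)" .
  moreover have "(\<Sum>i\<in>UNIV. ?p' h $ i * pd i u (p z)) =
      (\<Sum>j\<in>UNIV. h $ j * (\<Sum>i\<in>UNIV. pd i u (p z) * pd j (\<lambda>w. p w $ i) z))" for h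
    by (simp add: sum_distrib_left sum_distrib_right mult_ac) (rule sum.swap)
  ultimately show ?thesis by simp
qed

lemma cn_holomorphic_on_compose:
  fixes p :: "complex^'m::finite \<Rightarrow> complex^'n::finite"
  assumes "cn_holomorphic_on u V" and "\<And>i. cn_holomorphic_on (\<lambda>w. p w $ i) W"
    and "\<And>w. w \<in> W \<Longrightarrow> p w \<in> V"
  shows "cn_holomorphic_on (\<lambda>w. u (p w)) W"
  by (rule cn_holomorphic_onI) (rule has_derivative_compose_pd[OF assms(1,2)], use assms(3) in auto)

section \<open>Slices in the direction of one coordinate\<close>

definition upd :: "complex^'n \<Rightarrow> 'n \<Rightarrow> complex \<Rightarrow> complex^'n" where
  "upd z i c = (\<chi> j. if j = i then c else z $ j)"

lemma upd_nth [simp]: "upd z i c $ j = (if j = i then c else z $ j)"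
  by (simp add: upd_def)

lemma upd_self [simp]: "upd z i (z $ i) = z"
  by (simp add: vec_eq_iff)

lemma dist_upd:
  fixes z :: "complex^'n::finite"
  shows "dist (upd z i c) z = dist c (z $ i)"
proof -
  have "upd z i c - z = axis i (c - z $ i)" by (simp add: vec_eq_iff axis_def)
  then show ?thesis by (simp add: dist_norm norm_eq_sqrt_inner[of "axis i _"] inner_axis_axis
      flip: norm_eq_sqrt_inner)
qed

lemma has_derivative_upd:
  fixes z :: "complex^'n::finite"
  shows "(upd z i has_derivative (\<lambda>h. axis i h)) (at c)"
proof (rule has_derivative_vec_components)
  fix j show "((\<lambda>w. upd z i w $ j) has_derivative (\<lambda>h. axis i h $ j)) (at c)"
    by (cases "j = i") (auto simp: axis_def)
qed

lemma continuous_on_upd [continuous_intros]: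
  assumes "continuous_on S f" "continuous_on S g"
  shows "continuous_on S (\<lambda>x. upd (f x) i (g x))"
  unfolding upd_def
proof (rule continuous_on_vec_lambda)
  fix j show "continuous_on S (\<lambda>x. if j = i then g x else f x $ j)"
    using assms by (cases "j = i") (auto intro!: continuous_intros)
qed

lemma has_field_derivative_upd:
  assumes "cn_holomorphic_on u V" "upd z i c \<in> V"
  shows "((\<lambda>\<zeta>. u (upd z i \<zeta>)) has_field_derivative pd i u (upd z i c)) (at c)"
proof -
  from has_derivative_compose[OF has_derivative_upd has_derivative_pd[OF assms]]
  show ?thesis unfolding has_field_derivative_def
    by (rule has_derivative_eq_rhs)
      (auto simp: axis_def fun_eq_iff if_distrib[of "\<lambda>x. x * _"] mult.commute cong: if_cong)
qed

section \<open>Integrals with holomorphic parameters and Cauchy's formula for partial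
  derivatives\<close>

lemma cn_holomorphic_on_integral:
  fixes k :: "complex^'n::finite \<Rightarrow> real \<Rightarrow> complex"
  assumes U: "open U" "convex U"
    and der: "\<And>z t. z \<in> U \<Longrightarrow> t \<in> {0..1} \<Longrightarrow>
      ((\<lambda>z. k z t) has_derivative (\<lambda>v. \<Sum>i\<in>UNIV. v $ i * k' i z t)) (at z)"
    and cont: "\<And>z. z \<in> U \<Longrightarrow> continuous_on {0..1} (k z)"
    and cont': "\<And>i. continuous_on (U \<times> {0..1}) (\<lambda>(z, t). k' i z t)"
  shows "cn_holomorphic_on (\<lambda>z. integral {0..1} (k z)) U"
  unfolding cn_holomorphic_on_def
proof
  fix z assume z: "z \<in> U"
  \<comment> \<open>\<open>leibniz_rule\<close> wants the derivative as a continuous family of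
    bounded linear operators. In finite dimension this continuity can be tested on single vectors.
    The integral of complex linear operators is again complex linear.\<close>
  define fx where "fx z t = Blinfun (\<lambda>v. \<Sum>i\<in>UNIV. v $ i * k' i z t)" for z t
  have fx: "blinfun_apply (fx z t) = (\<lambda>v. \<Sum>i\<in>UNIV. v $ i * k' i z t)"
    if "z \<in> U" "t \<in> {0..1}" for z t
    unfolding fx_def
    by (rule bounded_linear_Blinfun_apply has_derivative_bounded_linear der that)+
  have contv: "continuous_on (U \<times> {0..1}) (\<lambda>x. fx (fst x) (snd x) v)" for v
  proof -
    have "continuous_on (U \<times> {0..1}) (\<lambda>x. \<Sum>i\<in>UNIV. v $ i * k' i (fst x) (snd x))"
      using cont' by (intro continuous_intros) (simp add: case_prod_unfold)
    then show ?thesis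
      by (rule continuous_on_eq) (auto simp: fx)
  qed
  have contfx: "continuous_on (U \<times> cbox 0 1) (\<lambda>(z, t). fx z t)"
    unfolding case_prod_unfold box_real using contv
    by (intro continuous_on_blinfun_componentwise) auto
  have "((\<lambda>z. integral (cbox 0 1) (k z)) has_derivative integral (cbox 0 1) (fx z)) (at z within U)"
  proof (rule leibniz_rule[OF _ _ contfx z U(2)])
    fix z t assume "z \<in> U" "t \<in> cbox (0::real) 1"
    then show "((\<lambda>z. k z t) has_derivative blinfun_apply (fx z t)) (at z within U)"
      using der by (simp add: fx has_derivative_at_withinI)
  next
    fix z assume "z \<in> U"
    then show "k z integrable_on cbox 0 1"
      using cont by (simp add: integrable_continuous_real)
  qed
  then have L: "((\<lambda>z. integral {0..1} (k z)) has_derivative integral {0..1} (fx z)) (at z)"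
    using z U(1) at_within_open by (metis box_real(2))
  have contz: "continuous_on {0..1} (fx z)"
    using z by (intro continuous_on_blinfun_componentwise)
      (rule continuous_on_compose2[OF contv, where f="\<lambda>t. (z, t)", simplified], auto intro!: continuous_intros)
  have app: "integral {0..1} (fx z) v = integral {0..1} (\<lambda>t. \<Sum>i\<in>UNIV. v $ i * k' i z t)" for v
  proof -
    have "integral {0..1} (fx z) v = integral {0..1} (\<lambda>t. fx z t v)"
      by (rule blinfun_apply_integral) (rule integrable_continuous_real[OF contz])
    also have "\<dots> = integral {0..1} (\<lambda>t. \<Sum>i\<in>UNIV. v $ i * k' i z t)"
      by (rule Henstock_Kurzweil_Integration.integral_cong) (simp add: fx z)
    finally show ?thesis .
  qed
  have "integral {0..1} (fx z) (c *s v) = c * integral {0..1} (fx z) v" for c v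
  proof -
    have "(\<Sum>i\<in>UNIV. (c *s v) $ i * k' i z t) = c * (\<Sum>i\<in>UNIV. v $ i * k' i z t)" for t
      by (simp add: sum_distrib_left mult.assoc)
    then show ?thesis unfolding app by simp
  qed
  with L show "\<exists>L. ((\<lambda>z. integral {0..1} (k z)) has_derivative L) (at z) \<and> (\<forall>k v. L (k *s v) = k * L v)"
    by blast
qed

text \<open>The parameter runs over the unit interval, as in \<open>circlepath\<close>.\<close>

definition unit_circle :: "real \<Rightarrow> complex" where
  "unit_circle t = exp (2 * of_real pi * \<i> * of_real t)"

lemma norm_unit_circle [simp]: "norm (unit_circle t) = 1"
  by (simp add: unit_circle_def)

lemma continuous_on_unit_circle [continuous_intros]:
  "continuous_on S f \<Longrightarrow> continuous_on S (\<lambda>x. unit_circle (f x))"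
  unfolding unit_circle_def by (intro continuous_intros)

text \<open>Cauchy's formula for the derivative on the slice through \<open>z\<close> in direction
  \<open>i\<close>. The circle is centred at \<open>z0 $ i\<close> and not at \<open>z $ i\<close>,
  so that one contour serves all \<open>z\<close> in \<open>ball z0 r\<close> and \<open>z\<close>
  occurs in the integrand only. Moving the \<open>i\<close>-th coordinate of \<open>z\<close> to the
  circle costs at most 2r, in addition to the distance below r from \<open>z\<close> to
  \<open>z0\<close>; hence the radius \<open>3 * r\<close>.\<close>

lemma pd_Cauchy:
  fixes u :: "complex^'n::finite \<Rightarrow> complex" and i :: 'n
  assumes u: "cn_holomorphic_on u V" and r: "r > 0" "ball z0 (3 * r) \<subseteq> V" and z: "z \<in> ball z0 r"
  defines "\<gamma> \<equiv> \<lambda>t. z0 $ i + of_real r * unit_circle t"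
  shows "pd i u z =
    integral {0..1} (\<lambda>t. u (upd z i (\<gamma> t)) / (\<gamma> t - z $ i)^2 * (of_real r * unit_circle t))"
    and "\<gamma> t \<noteq> z $ i" and "upd z i (\<gamma> t) \<in> V"
proof -
  have zi: "dist (z $ i) (z0 $ i) < r"
    using dist_vec_nth_le[of z i z0] z by (simp add: dist_commute)
  have *: "upd z i \<zeta> \<in> V" if "\<zeta> \<in> cball (z0 $ i) r" for \<zeta>
  proof -
    have "dist (upd z i \<zeta>) z0 \<le> dist (upd z i \<zeta>) z + dist z z0" by (rule dist_triangle)
    also have "\<dots> = dist \<zeta> (z $ i) + dist z z0" by (simp add: dist_upd)
    also have "\<dots> \<le> dist \<zeta> (z0 $ i) + dist (z $ i) (z0 $ i) + dist z z0"
      using dist_triangle2[of \<zeta> "z $ i" "z0 $ i"] by simp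
    also have "\<dots> < 3 * r" using that zi z by (simp add: dist_commute)
    finally show ?thesis using r(2) by (auto simp: dist_commute)
  qed
  have \<gamma>: "\<gamma> t \<in> sphere (z0 $ i) r" for t
    using r by (simp add: \<gamma>_def dist_norm norm_mult)
  show "\<gamma> t \<noteq> z $ i" using \<gamma>[of t] zi by (auto simp: dist_commute)
  show "upd z i (\<gamma> t) \<in> V" using * \<gamma>[of t] by simp
  let ?f = "\<lambda>\<zeta>. u (upd z i \<zeta>)"
  have df: "(?f has_field_derivative pd i u (upd z i \<zeta>)) (at \<zeta>)" if "\<zeta> \<in> cball (z0 $ i) r" for \<zeta>
    by (rule has_field_derivative_upd[OF u *[OF that]])
  have "continuous_on (cball (z0 $ i) r) ?f"
    by (rule continuous_at_imp_continuous_on) (blast intro: DERIV_isCont df)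
  moreover have "?f holomorphic_on ball (z0 $ i) r"
    unfolding holomorphic_on_open[OF open_ball] using df ball_subset_cball by blast
  moreover have "z $ i \<in> ball (z0 $ i) r" using zi by (simp add: dist_commute)
  ultimately have "(?f has_field_derivative (1 / (2 * of_real pi * \<i>) *
      contour_integral (circlepath (z0 $ i) r) (\<lambda>\<zeta>. ?f \<zeta> / (\<zeta> - z $ i)^2))) (at (z $ i))"
    by (rule Cauchy_derivative_integral_circlepath)
  moreover have "(?f has_field_derivative pd i u z) (at (z $ i))"
    using df[of "z $ i"] zi by (simp add: dist_commute)
  ultimately have "pd i u z = 1 / (2 * of_real pi * \<i>) *
      contour_integral (circlepath (z0 $ i) r) (\<lambda>\<zeta>. ?f \<zeta> / (\<zeta> - z $ i)^2)"
    by (rule DERIV_unique[symmetric])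
  also have "\<dots> = 1 / (2 * of_real pi * \<i>) * integral {0..1} (\<lambda>t. 2 * of_real pi * \<i> *
      (u (upd z i (\<gamma> t)) / (\<gamma> t - z $ i)^2 * (of_real r * unit_circle t)))"
    unfolding contour_integral_integral vector_derivative_circlepath
    by (intro arg_cong[where f="\<lambda>x. _ * x"] Henstock_Kurzweil_Integration.integral_cong)
      (simp add: circlepath \<gamma>_def unit_circle_def)
  also have "\<dots> = integral {0..1} (\<lambda>t. u (upd z i (\<gamma> t)) / (\<gamma> t - z $ i)^2 * (of_real r * unit_circle t))"
    unfolding Henstock_Kurzweil_Integration.integral_mult_right by simp
  finally show "pd i u z = integral {0..1} (\<lambda>t. u (upd z i (\<gamma> t)) / (\<gamma> t - z $ i)^2 * (of_real r * unit_circle t))" .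
qed

lemma has_derivative_upd1:
  fixes u :: "complex^'n::finite \<Rightarrow> complex"
  assumes "cn_holomorphic_on u V" "upd z i c \<in> V"
  shows "((\<lambda>z. u (upd z i c)) has_derivative
    (\<lambda>v. \<Sum>j\<in>UNIV. v $ j * (if j = i then 0 else pd j u (upd z i c)))) (at z)"
proof -
  have "((\<lambda>z. upd z i c) has_derivative (\<lambda>v. upd v i 0)) (at z)"
  proof (rule has_derivative_vec_components)
    fix j show "((\<lambda>z. upd z i c $ j) has_derivative (\<lambda>v. upd v i 0 $ j)) (at z)"
      by (cases "j = i") (auto intro: bounded_linear_imp_has_derivative bounded_linear_vec_nth)
  qed
  from has_derivative_compose[OF this has_derivative_pd[OF assms]]
  show ?thesis
    by (rule has_derivative_eq_rhs) (auto simp: fun_eq_iff intro!: sum.cong)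
qed

text \<open>Continuity has to precede holomorphy: differentiating Cauchy's integral under the
  integral sign presupposes that the derivative of the integrand is continuous, and this derivative
  contains the partial derivatives of \<open>u\<close>.\<close>

lemma continuous_on_pd:
  fixes u :: "complex^'n::finite \<Rightarrow> complex"
  assumes u: "cn_holomorphic_on u V" and V: "open V"
  shows "continuous_on V (pd i u)"
proof (rule continuous_at_imp_continuous_on, rule ballI)
  fix z0 assume "z0 \<in> V"
  then obtain e where e: "e > 0" "ball z0 e \<subseteq> V" using V open_contains_ball by blast
  define r where "r = e / 3"
  have r: "r > 0" "ball z0 (3 * r) \<subseteq> V" using e by (auto simp: r_def)
  note C = pd_Cauchy[OF u r]
  have "continuous_on (ball z0 r) (\<lambda>z. integral (cbox 0 1)
    (\<lambda>t. u (upd z i (z0 $ i + of_real r * unit_circle t)) /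
      (z0 $ i + of_real r * unit_circle t - z $ i)^2 * (of_real r * unit_circle t)))"
    using C(2,3) unfolding box_real
    by (intro integral_continuous_on_param[where a="0::real" and b=1, unfolded box_real])
      (auto simp: case_prod_unfold intro!: continuous_intros
        continuous_on_compose2[OF cn_holomorphic_on_imp_continuous_on[OF u]])
  then have "continuous_on (ball z0 r) (pd i u)"
    by (rule continuous_on_eq) (use C(1) in simp)
  then show "isCont (pd i u) z0"
    using r(1) by (simp add: continuous_on_eq_continuous_at)
qed

lemma DERIV_inverse_square_diff:
  fixes c x :: complex
  assumes "c \<noteq> x"
  shows "((\<lambda>x. inverse ((c - x)^2)) has_field_derivative 2 * inverse ((c - x)^3)) (at x)"
proof -
  have *: "- (inverse (d^2) * (2 * d * (0 - 1)) * inverse (d^2)) = 2 * inverse (d^3)"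
    if "d \<noteq> 0" for d :: complex
    using that by (simp add: field_simps power2_eq_square power3_eq_cube)
  have "((\<lambda>x. inverse ((c - x)^2)) has_field_derivative
      - (inverse ((c - x)^2) * (2 * (c - x) * (0 - 1)) * inverse ((c - x)^2))) (at x)"
    using assms by (auto intro!: derivative_eq_intros)
  then show ?thesis using *[of "c - x"] assms by (metis right_minus_eq)
qed

text \<open>Cauchy's integral is differentiated under the integral sign. The variable
  \<open>z $ i\<close> occurs only in the kernel, since \<open>upd\<close> overwrites it inside
  \<open>u\<close>, and the other variables occur only inside \<open>u\<close>. This gives the two
  cases of \<open>?k'\<close>.\<close>

lemma cn_holomorphic_on_pd:
  fixes u :: "complex^'n::finite \<Rightarrow> complex"
  assumes u: "cn_holomorphic_on u V" and V: "open V"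
  shows "cn_holomorphic_on (pd i u) V"
proof -
  have "\<exists>L. (pd i u has_derivative L) (at z0) \<and> (\<forall>k v. L (k *s v) = k * L v)" if z0: "z0 \<in> V" for z0
  proof -
    obtain e where e: "e > 0" "ball z0 e \<subseteq> V" using z0 V open_contains_ball by blast
    define r where "r = e / 3"
    have r: "r > 0" "ball z0 (3 * r) \<subseteq> V" using e by (auto simp: r_def)
    note C = pd_Cauchy[OF u r]
    define \<gamma> where "\<gamma> t = z0 $ i + of_real r * unit_circle t" for t
    have \<gamma>: "\<gamma> t \<noteq> z $ i" "upd z i (\<gamma> t) \<in> V" if "z \<in> ball z0 r" for z t
      using C(2,3)[OF that] by (auto simp: \<gamma>_def)
    let ?k = "\<lambda>z t. u (upd z i (\<gamma> t)) * inverse ((\<gamma> t - z $ i)^2) * (of_real r * unit_circle t)"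
    let ?k' = "\<lambda>j z t. if j = i
      then 2 * u (upd z i (\<gamma> t)) * inverse ((\<gamma> t - z $ i)^3) * (of_real r * unit_circle t)
      else pd j u (upd z i (\<gamma> t)) * inverse ((\<gamma> t - z $ i)^2) * (of_real r * unit_circle t)"
    have "cn_holomorphic_on (\<lambda>z. integral {0..1} (?k z)) (ball z0 r)"
    proof (rule cn_holomorphic_on_integral[where k'="?k'"])
      fix z t assume z: "z \<in> ball z0 r"
      have "((\<lambda>x. inverse ((\<gamma> t - x)^2)) has_field_derivative 2 * inverse ((\<gamma> t - z $ i)^3)) (at (z $ i))"
        by (rule DERIV_inverse_square_diff[OF \<gamma>(1)[OF z]])
      then have "((\<lambda>x. inverse ((\<gamma> t - x)^2)) has_derivative (\<lambda>h. 2 * inverse ((\<gamma> t - z $ i)^3) * h)) (at (z $ i))"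
        unfolding has_field_derivative_def .
      from has_derivative_compose[OF bounded_linear_imp_has_derivative[OF bounded_linear_vec_nth] this]
      have "((\<lambda>z. inverse ((\<gamma> t - z $ i)^2)) has_derivative
        (\<lambda>v. 2 * inverse ((\<gamma> t - z $ i)^3) * v $ i)) (at z)" .
      from has_derivative_mult_left[OF has_derivative_mult[OF has_derivative_upd1[OF u \<gamma>(2)[OF z]] this]]
      show "((\<lambda>z. ?k z t) has_derivative (\<lambda>v. \<Sum>j\<in>UNIV. v $ j * ?k' j z t)) (at z)"
      proof (rule has_derivative_eq_rhs, intro ext)
        fix v :: "complex^'n"
        have "(\<Sum>j\<in>UNIV. v $ j * ?k' j z t) =
          (\<Sum>j\<in>UNIV. (if j = i then v $ i * ?k' i z t else 0) + v $ j * (if j = i then 0 else ?k' j z t))"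
          by (rule sum.cong) auto
        also have "\<dots> = v $ i * ?k' i z t + (\<Sum>j\<in>UNIV. v $ j * (if j = i then 0 else ?k' j z t))"
          by (simp add: sum.distrib)
        also have "(\<Sum>j\<in>UNIV. v $ j * (if j = i then 0 else ?k' j z t)) =
          (\<Sum>j\<in>UNIV. v $ j * (if j = i then 0 else pd j u (upd z i (\<gamma> t)))) *
            (inverse ((\<gamma> t - z $ i)^2) * (of_real r * unit_circle t))"
          unfolding sum_distrib_right by (rule sum.cong) auto
        finally show "(u (upd z i (\<gamma> t)) * (2 * inverse ((\<gamma> t - z $ i)^3) * v $ i) +
            (\<Sum>j\<in>UNIV. v $ j * (if j = i then 0 else pd j u (upd z i (\<gamma> t)))) *
              inverse ((\<gamma> t - z $ i)^2)) * (of_real r * unit_circle t) =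
            (\<Sum>j\<in>UNIV. v $ j * ?k' j z t)"
          by (simp add: algebra_simps)
      qed
    next
      fix z assume "z \<in> ball z0 r"
      then show "continuous_on {0..1} (?k z)" using \<gamma> unfolding \<gamma>_def
        by (auto intro!: continuous_intros
            continuous_on_compose2[OF cn_holomorphic_on_imp_continuous_on[OF u]])
    next
      fix j show "continuous_on (ball z0 r \<times> {0..1}) (\<lambda>(z, t). ?k' j z t)"
        using \<gamma> unfolding \<gamma>_def
        by (cases "j = i") (auto simp: case_prod_unfold intro!: continuous_intros
            continuous_on_compose2[OF cn_holomorphic_on_imp_continuous_on[OF u]]
            continuous_on_compose2[OF continuous_on_pd[OF u V]])
    qed auto
    moreover have "pd i u z = integral {0..1} (?k z)" if "z \<in> ball z0 r" for z
      using C(1)[OF that] by (simp add: \<gamma>_def divide_inverse)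
    ultimately have "cn_holomorphic_on (pd i u) (ball z0 r)"
      by (rule cn_holomorphic_on_cong_open[OF _ open_ball])
    then show ?thesis using r(1) by (simp add: cn_holomorphic_on_def)
  qed
  then show ?thesis by (simp add: cn_holomorphic_on_def)
qed

section \<open>Pairs of points as vectors over a sum of index types, and Hadamard's lemma on a
  ball\<close>

definition lpart :: "complex^('n::finite + 'm::finite) \<Rightarrow> complex^'n" where
  "lpart w = (\<chi> i. w $ Inl i)"

definition rpart :: "complex^('n::finite + 'm::finite) \<Rightarrow> complex^'m" where
  "rpart w = (\<chi> i. w $ Inr i)"

lemma lpart_nth [simp]: "lpart w $ i = w $ Inl i" and rpart_nth [simp]: "rpart w $ j = w $ Inr j"
  by (simp_all add: lpart_def rpart_def)

lemma lpart_0 [simp]: "lpart 0 = 0" and rpart_0 [simp]: "rpart 0 = 0"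
  by (simp_all add: vec_eq_iff)

lemma sum_UNIV_sum:
  fixes g :: "'n::finite + 'm::finite \<Rightarrow> 'a::comm_monoid_add"
  shows "(\<Sum>k\<in>UNIV. g k) = (\<Sum>i\<in>UNIV. g (Inl i)) + (\<Sum>j\<in>UNIV. g (Inr j))"
  using sum.Plus[of "UNIV :: 'n set" "UNIV :: 'm set" g] by (simp add: comp_def)

lemma norm_lpart_le: "norm (lpart (w :: complex^('n::finite + 'm::finite))) \<le> norm w"
  and norm_rpart_le: "norm (rpart w) \<le> norm w"
  by (simp_all add: norm_vec_def L2_set_def sum_UNIV_sum sum_nonneg)

text \<open>\<open>e i w\<close> is the mean of the \<open>i\<close>-th partial derivative over the
  segment from \<open>rpart w\<close> to \<open>lpart w\<close>, which stays in the ball by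
  convexity. Over the diagonal the segment is constant, whence the last claim. Treating the two end
  points as one variable \<open>w\<close> makes the coefficients holomorphic in both points
  jointly.\<close>

lemma Hadamard_ball:
  fixes u :: "complex^'n::finite \<Rightarrow> complex"
  assumes u: "cn_holomorphic_on u (ball 0 r)"
  obtains e :: "'n \<Rightarrow> complex^('n + 'n) \<Rightarrow> complex" where
    "\<And>i. cn_holomorphic_on (e i) (ball 0 r)"
    "\<And>w. w \<in> ball 0 r \<Longrightarrow> u (lpart w) - u (rpart w) = (\<Sum>i\<in>UNIV. e i w * (w $ Inl i - w $ Inr i))"
    "\<And>i w. lpart w = rpart w \<Longrightarrow> e i w = pd i u (lpart w)"
proof -
  define seg :: "complex^('n + 'n) \<Rightarrow> real \<Rightarrow> complex^'n"
    where "seg w t = (\<chi> i. w $ Inr i + of_real t * (w $ Inl i - w $ Inr i))" for w t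
  have seg_nth [simp]: "seg w t $ i = w $ Inr i + of_real t * (w $ Inl i - w $ Inr i)" for w t i
    by (simp add: seg_def)
  have seg: "seg w t \<in> ball 0 r" if w: "w \<in> ball 0 r" and t: "t \<in> {0..1}" for w t
  proof -
    have "seg w t = (1 - t) *\<^sub>R rpart w + t *\<^sub>R lpart w"
      by (simp add: vec_eq_iff) (simp add: scaleR_conv_of_real algebra_simps)
    moreover have "lpart w \<in> ball 0 r" "rpart w \<in> ball 0 r"
      using w norm_lpart_le[of w] norm_rpart_le[of w] by auto
    ultimately show ?thesis
      using convexD[OF convex_ball, of "rpart w" 0 r "lpart w" "1 - t" t] t by auto
  qed
  have cseg: "continuous_on S (\<lambda>x. seg (f x) (g x))"
    if "continuous_on S f" "continuous_on S g" for S and f :: "'b::topological_space \<Rightarrow> _" and g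
    unfolding seg_def using that by (intro continuous_intros continuous_on_vec_lambda)
  define e where "e i w = integral {0..1} (\<lambda>t. pd i u (seg w t))" for i w
  have hol: "cn_holomorphic_on (e i) (ball 0 r)" for i
    unfolding e_def
  proof (rule cn_holomorphic_on_integral[where k'="\<lambda>k w t.
      case k of Inl j \<Rightarrow> of_real t * pd j (pd i u) (seg w t)
        | Inr j \<Rightarrow> (1 - of_real t) * pd j (pd i u) (seg w t)"])
    fix w :: "complex^('n + 'n)" and t :: real
    assume w: "w \<in> ball 0 r" and t: "t \<in> {0..1}"
    have nth: "((\<lambda>w. w $ k) has_derivative (\<lambda>h. h $ k)) (at w)" for k
      by (rule bounded_linear_imp_has_derivative[OF bounded_linear_vec_nth])
    have "((\<lambda>w. seg w t) has_derivative (\<lambda>h. seg h t)) (at w)"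
      unfolding seg_nth
      by (rule has_derivative_vec_components, unfold seg_nth)
        (intro has_derivative_add has_derivative_mult_right has_derivative_diff nth)
    from has_derivative_compose[OF this has_derivative_pd[OF cn_holomorphic_on_pd[OF u open_ball] seg[OF w t]]]
    show "((\<lambda>w. pd i u (seg w t)) has_derivative (\<lambda>v. \<Sum>k\<in>UNIV. v $ k *
        (case k of Inl j \<Rightarrow> of_real t * pd j (pd i u) (seg w t)
         | Inr j \<Rightarrow> (1 - of_real t) * pd j (pd i u) (seg w t)))) (at w)"
      by (rule has_derivative_eq_rhs)
        (simp add: fun_eq_iff sum_UNIV_sum sum.distrib[symmetric] algebra_simps)
  next
    fix w :: "complex^('n + 'n)" assume "w \<in> ball 0 r"
    then show "continuous_on {0..1} (\<lambda>t. pd i u (seg w t))"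
      using seg by (intro continuous_on_compose2[OF continuous_on_pd[OF u open_ball]] cseg continuous_intros)
        auto
  next
    fix k :: "'n + 'n"
    show "continuous_on (ball 0 r \<times> {0..1}) (\<lambda>(w, t). case k of
        Inl j \<Rightarrow> of_real t * pd j (pd i u) (seg w t)
      | Inr j \<Rightarrow> (1 - of_real t) * pd j (pd i u) (seg w t))"
      using seg unfolding case_prod_unfold
      by (cases k) (auto intro!: continuous_intros cseg
          continuous_on_compose2[OF continuous_on_pd[OF cn_holomorphic_on_pd[OF u open_ball] open_ball]])
  qed auto
  moreover have "u (lpart w) - u (rpart w) = (\<Sum>i\<in>UNIV. e i w * (w $ Inl i - w $ Inr i))"
    if w: "w \<in> ball 0 r" for w
  proof -
    have "((\<lambda>t. \<Sum>i\<in>UNIV. (w $ Inl i - w $ Inr i) * pd i u (seg w t)) has_integral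
        u (seg w 1) - u (seg w 0)) {0..1}"
    proof (rule fundamental_theorem_of_calculus)
      fix t :: real assume t: "t \<in> {0..1}"
      have "((\<lambda>t. seg w t) has_derivative (\<lambda>h. h *\<^sub>R (lpart w - rpart w))) (at t within {0..1})"
      proof (rule has_derivative_at_withinI, rule has_derivative_vec_components)
        fix i show "((\<lambda>t. seg w t $ i) has_derivative (\<lambda>h. (h *\<^sub>R (lpart w - rpart w)) $ i)) (at t)"
          by (auto intro!: derivative_eq_intros simp: scaleR_conv_of_real[where 'a=complex])
      qed
      from has_derivative_compose[OF this has_derivative_pd[OF u seg[OF w t]]]
      show "((\<lambda>t. u (seg w t)) has_vector_derivative
          (\<Sum>i\<in>UNIV. (w $ Inl i - w $ Inr i) * pd i u (seg w t))) (at t within {0..1})"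
        unfolding has_vector_derivative_def
        by (rule has_derivative_eq_rhs) (simp add: fun_eq_iff scaleR_sum_right)
    qed simp
    moreover have "seg w 1 = lpart w" "seg w 0 = rpart w" by (simp_all add: vec_eq_iff)
    ultimately have *: "u (lpart w) - u (rpart w) =
        integral {0..1} (\<lambda>t. \<Sum>i\<in>UNIV. (w $ Inl i - w $ Inr i) * pd i u (seg w t))"
      by (simp add: integral_unique)
    have "(\<lambda>t. pd i u (seg w t)) integrable_on {0..1}" for i
      using seg w by (intro integrable_continuous_real continuous_on_compose2[OF continuous_on_pd[OF u open_ball]]
          cseg continuous_intros) auto
    then have "integral {0..1} (\<lambda>t. \<Sum>i\<in>UNIV. (w $ Inl i - w $ Inr i) * pd i u (seg w t)) =
        (\<Sum>i\<in>UNIV. integral {0..1} (\<lambda>t. (w $ Inl i - w $ Inr i) * pd i u (seg w t)))"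
      by (intro integral_sum integrable_on_mult_right) auto
    with * show ?thesis by (simp add: e_def mult.commute)
  qed
  moreover have "e i w = pd i u (lpart w)" if "lpart w = rpart w" for i w
  proof -
    have "seg w t = lpart w" for t
      using that by (simp add: vec_eq_iff)
    then show ?thesis by (simp add: e_def)
  qed
  ultimately show ?thesis by (rule that)
qed

section \<open>Power series\<close>

abbreviation cmonom :: "complex^'n::finite \<Rightarrow> ('n \<Rightarrow> nat) \<Rightarrow> complex" where
  "cmonom z \<beta> \<equiv> \<Prod>i\<in>UNIV. z $ i ^ \<beta> i"

text \<open>Series in several variables are handled as iterated series: induction on the set of
  variables splits off the exponent \<open>k\<close> of one new variable \<open>i\<close> at a
  time.\<close>

lemma bij_betw_multi_indices_insert:
  assumes "i \<notin> K"
  shows "bij_betw (\<lambda>(k, \<beta>). \<beta>(i := k)) (UNIV \<times> multi_indices K) (multi_indices (insert i K))"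
  by (rule bij_betw_byWitness[where f'="\<lambda>\<beta>. (\<beta> i, \<beta>(i := 0))"])
    (use assms in \<open>auto simp: multi_indices_def fun_eq_iff\<close>)

lemma prod_fun_upd:
  fixes h :: "'n::finite \<Rightarrow> 'c \<Rightarrow> 'b::comm_monoid_mult"
  assumes "h i (\<beta> i) = 1"
  shows "(\<Prod>j\<in>UNIV. h j ((\<beta>(i := k)) j)) = h i k * (\<Prod>j\<in>UNIV. h j (\<beta> j))"
proof -
  have "(\<Prod>j\<in>UNIV. h j ((\<beta>(i := k)) j)) = h i k * (\<Prod>j\<in>UNIV - {i}. h j (\<beta> j))"
    by (subst prod.remove[of UNIV i]) (auto intro!: arg_cong2[where f="(*)"] prod.cong)
  also have "(\<Prod>j\<in>UNIV - {i}. h j (\<beta> j)) = (\<Prod>j\<in>UNIV. h j (\<beta> j))"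
    by (subst prod.remove[of UNIV i]) (auto simp: assms)
  finally show ?thesis .
qed

lemma multi_indices_empty [simp]: "multi_indices {} = {\<lambda>_. 0}"
  by (auto simp: multi_indices_def)

text \<open>A product of geometric series, one for each variable; the terms are nonnegative, so
  iterated summability suffices.\<close>

lemma summable_on_multi_indices_geometric:
  fixes x :: "'n::finite \<Rightarrow> real"
  assumes x: "\<And>i. 0 \<le> x i" "\<And>i. x i < 1"
  shows "(\<lambda>\<beta>. \<Prod>i\<in>UNIV. x i ^ \<beta> i) summable_on multi_indices K"
  using finite[of K]
proof (induction K rule: finite_induct)
  case empty
  show ?case by simp
next
  case (insert i K)
  then obtain S where S: "((\<lambda>\<beta>. \<Prod>i\<in>UNIV. x i ^ \<beta> i) has_sum S) (multi_indices K)"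
    by (auto simp: summable_on_def)
  have "(\<lambda>(k, \<beta>). x i ^ k * (\<Prod>i\<in>UNIV. x i ^ \<beta> i)) summable_on (UNIV \<times> multi_indices K)"
  proof (rule summable_on_SigmaI)
    show "((\<lambda>\<beta>. case (k, \<beta>) of (k, \<beta>) \<Rightarrow> x i ^ k * (\<Prod>i\<in>UNIV. x i ^ \<beta> i)) has_sum x i ^ k * S) (multi_indices K)" for k
      using has_sum_cmult_right[OF S] by simp
    have "summable (\<lambda>k. norm (x i ^ k * S))"
      using x(1)[of i] x(2)[of i] by (simp add: abs_mult power_abs summable_mult2 summable_geometric)
    then show "(\<lambda>k. x i ^ k * S) summable_on UNIV"
      by (rule norm_summable_imp_summable_on)
  qed (use x in \<open>auto intro!: mult_nonneg_nonneg prod_nonneg\<close>)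
  also have "?this \<longleftrightarrow> (\<lambda>x'. (\<lambda>\<beta>. \<Prod>i\<in>UNIV. x i ^ \<beta> i) ((\<lambda>(k, \<beta>). \<beta>(i := k)) x'))
      summable_on (UNIV \<times> multi_indices K)"
  proof (intro summable_on_cong, clarify)
    fix k \<beta> assume "\<beta> \<in> multi_indices K"
    then have "\<beta> i = 0" using insert.hyps(2) by (auto simp: multi_indices_def)
    then show "x i ^ k * (\<Prod>j\<in>UNIV. x j ^ \<beta> j) = (\<Prod>j\<in>UNIV. x j ^ (\<beta>(i := k)) j)"
      by (intro prod_fun_upd[where h="\<lambda>j k. x j ^ k", symmetric]) simp
  qed
  finally show ?case
    by (subst (asm) summable_on_reindex_bij_betw[OF bij_betw_multi_indices_insert[OF insert.hyps(2)]])
qed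

text \<open>Unlike a ball, a polydisc is stable under replacing one coordinate by any value of
  modulus below its radius, which is what an induction on the variables needs.\<close>

definition polydisc :: "real \<Rightarrow> (complex^'n::finite) set" where
  "polydisc R = {z. \<forall>i. norm (z $ i) < R}"

lemma open_polydisc [simp]: "open (polydisc R)"
proof -
  have "polydisc R = (\<Inter>i\<in>UNIV. {z. norm (z $ i) < R})" by (auto simp: polydisc_def)
  also have "open \<dots>"
    by (intro open_INT ballI open_Collect_less continuous_intros) auto
  finally show ?thesis .
qed

lemma upd_polydisc: "z \<in> polydisc R \<Longrightarrow> norm c < R \<Longrightarrow> upd z i c \<in> polydisc R"
  by (simp add: polydisc_def)

lemma cn_holomorphic_on_funpow_pd:
  "cn_holomorphic_on u V \<Longrightarrow> open V \<Longrightarrow> cn_holomorphic_on ((pd i ^^ k) u) V"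
  by (induction k) (auto intro: cn_holomorphic_on_pd)

lemma cn_holomorphic_on_upd_compose:
  fixes u :: "complex^'n::finite \<Rightarrow> complex"
  assumes "cn_holomorphic_on u V" "\<And>z. z \<in> W \<Longrightarrow> upd z i c \<in> V"
  shows "cn_holomorphic_on (\<lambda>z. u (upd z i c)) W"
proof (rule cn_holomorphic_on_compose[OF assms(1) _ assms(2)])
  fix j show "cn_holomorphic_on (\<lambda>z. upd z i c $ j) W"
    by (cases "j = i") auto
qed

text \<open>The coefficients \<open>t k\<close> of the expansion in the variable \<open>i\<close>
  are written with iterated partial derivatives at \<open>upd z i 0\<close>. In this form they are
  holomorphic functions of the remaining variables, and by Cauchy's inequality they are bounded on
  the whole polydisc, so that they can be expanded in turn.\<close>

lemma one_variable_Taylor: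
  fixes u :: "complex^'n::finite \<Rightarrow> complex" and i :: 'n
  assumes u: "cn_holomorphic_on u (polydisc R)" and M: "\<And>z. z \<in> polydisc R \<Longrightarrow> norm (u z) \<le> M"
    and \<rho>: "0 < \<rho>" "\<rho> < R" and z: "z \<in> polydisc R"
  defines "t \<equiv> \<lambda>k. (pd i ^^ k) u (upd z i 0) / fact k"
  shows "norm (t k) \<le> M / \<rho> ^ k"
    and "norm (z $ i) < \<rho> \<Longrightarrow> ((\<lambda>k. z $ i ^ k * t k) has_sum u z) UNIV"
proof -
  let ?f = "\<lambda>\<zeta>. u (upd z i \<zeta>)"
  have up: "upd z i \<zeta> \<in> polydisc R" if "\<zeta> \<in> ball 0 R" for \<zeta>
    using upd_polydisc[OF z] that by simp
  have pw: "(deriv ^^ k) ?f \<zeta> = (pd i ^^ k) u (upd z i \<zeta>)" if "\<zeta> \<in> ball 0 R" for k \<zeta>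
    using that
  proof (induction k arbitrary: \<zeta>)
    case (Suc k)
    have "((\<lambda>\<zeta>. (pd i ^^ k) u (upd z i \<zeta>)) has_field_derivative pd i ((pd i ^^ k) u) (upd z i \<zeta>)) (at \<zeta>)"
      by (rule has_field_derivative_upd[OF cn_holomorphic_on_funpow_pd[OF u]]) (use up Suc.prems in auto)
    then have "((deriv ^^ k) ?f has_field_derivative pd i ((pd i ^^ k) u) (upd z i \<zeta>)) (at \<zeta>)"
      by (rule has_field_derivative_transform_within_open[OF _ open_ball Suc.prems]) (simp add: Suc.IH)
    then show ?case by (simp add: DERIV_imp_deriv)
  qed simp
  have df: "(?f has_field_derivative pd i u (upd z i \<zeta>)) (at \<zeta>)" if "\<zeta> \<in> ball 0 R" for \<zeta>
    by (rule has_field_derivative_upd[OF u up[OF that]])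
  then have hol: "?f holomorphic_on ball 0 R"
    unfolding holomorphic_on_open[OF open_ball] by blast
  have t: "t k = (deriv ^^ k) ?f 0 / fact k" for k
    using pw[of 0 k] \<rho> by (simp add: t_def)
  show bnd: "norm (t k) \<le> M / \<rho> ^ k" for k
  proof -
    have "norm ((deriv ^^ k) ?f 0) \<le> fact k * M / \<rho> ^ k"
    proof (rule Cauchy_inequality)
      show "?f holomorphic_on ball 0 \<rho>" "continuous_on (cball 0 \<rho>) ?f"
        using \<rho> by (auto intro!: holomorphic_on_imp_continuous_on holomorphic_on_subset[OF hol])
      show "norm (?f \<zeta>) \<le> M" if "norm (0 - \<zeta>) = \<rho>" for \<zeta>
        using that \<rho> by (intro M up) auto
    qed (rule \<rho>)
    then show ?thesis by (simp add: t norm_divide field_simps)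
  qed
  show "((\<lambda>k. z $ i ^ k * t k) has_sum u z) UNIV" if "norm (z $ i) < \<rho>"
  proof (rule norm_summable_imp_has_sum)
    have "z $ i \<in> ball 0 R" using that \<rho> by simp
    from holomorphic_power_series[OF hol this]
    show "(\<lambda>k. z $ i ^ k * t k) sums u z" by (simp add: t mult.commute)
    show "summable (\<lambda>k. norm (z $ i ^ k * t k))"
    proof (rule summable_comparison_test')
      show "summable (\<lambda>k. M * (norm (z $ i) / \<rho>) ^ k)"
        using that \<rho> by (intro summable_mult summable_geometric) simp
      show "norm (norm (z $ i ^ k * t k)) \<le> M * (norm (z $ i) / \<rho>) ^ k" for k
        using mult_left_mono[OF bnd[of k], of "norm (z $ i) ^ k"]
        by (simp add: norm_mult norm_power power_divide mult.commute)
    qed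
  qed
qed

text \<open>Each coefficient of the expansion in the new variable is expanded in the old ones. The
  bound on the coefficients \<open>C\<close> accompanies the induction because it dominates the
  resulting double series by a geometric one with ratios \<open>norm (z $ j) / \<rho>\<close> below
  1. The double series is thus absolutely summable and may be read as a single family over
  multi-indices. The function and its bound vary in the induction: \<open>t k\<close> is bounded by
  \<open>M / \<rho> ^ k\<close>.\<close>

lemma Taylor_polydisc:
  fixes u :: "complex^'n::finite \<Rightarrow> complex"
  assumes \<rho>: "0 < \<rho>" "\<rho> < R"
    and u: "cn_holomorphic_on u (polydisc R)" and M: "\<And>z. z \<in> polydisc R \<Longrightarrow> norm (u z) \<le> M"
  shows "\<exists>C. (\<forall>\<beta>\<in>multi_indices K. norm (C \<beta>) * (\<Prod>i\<in>UNIV. \<rho> ^ \<beta> i) \<le> M) \<and>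
    (\<forall>z\<in>polydisc \<rho> \<inter> coord_space K. ((\<lambda>\<beta>. C \<beta> * cmonom z \<beta>) has_sum u z) (multi_indices K))"
  using finite[of K] u M
proof (induction K arbitrary: u M rule: finite_induct)
  case empty
  have "coord_space {} = {0 :: complex^'n}" by (auto simp: coord_space_def vec_eq_iff)
  moreover have "(0 :: complex^'n) \<in> polydisc R" using \<rho> by (simp add: polydisc_def)
  ultimately show ?case
    using empty by (intro exI[of _ "\<lambda>_. u 0"]) (auto intro!: has_sum_finiteI)
next
  case (insert i K)
  define t where "t k z = (pd i ^^ k) u (upd z i 0) / fact k" for k z
  have hol: "cn_holomorphic_on (t k) (polydisc R)" for k
    unfolding t_def divide_inverse using \<rho>
    by (intro cn_holomorphic_on_mult cn_holomorphic_on_upd_compose[OF cn_holomorphic_on_funpow_pd[OF insert.prems(1)]])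
      (auto intro: upd_polydisc)
  have bt: "norm (t k z) \<le> M / \<rho> ^ k" if "z \<in> polydisc R" for k z
    unfolding t_def by (rule one_variable_Taylor(1)[OF insert.prems(1,2) \<rho> that])
  let ?P = "\<lambda>k C. (\<forall>\<beta>\<in>multi_indices K. norm (C \<beta>) * (\<Prod>i\<in>UNIV. \<rho> ^ \<beta> i) \<le> M / \<rho> ^ k) \<and>
    (\<forall>z\<in>polydisc \<rho> \<inter> coord_space K. ((\<lambda>\<beta>. C \<beta> * cmonom z \<beta>) has_sum t k z) (multi_indices K))"
  have "\<forall>k. \<exists>C. ?P k C"
    by (rule allI, rule insert.IH[OF hol bt])
  then have "\<exists>C. \<forall>k. ?P k (C k)" by (rule choice)
  then obtain C where "\<forall>k. ?P k (C k)" ..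
  then have C: "\<And>k \<beta>. \<beta> \<in> multi_indices K \<Longrightarrow> norm (C k \<beta>) * (\<Prod>i\<in>UNIV. \<rho> ^ \<beta> i) \<le> M / \<rho> ^ k"
    and sum: "\<And>k z. z \<in> polydisc \<rho> \<Longrightarrow> z \<in> coord_space K \<Longrightarrow>
      ((\<lambda>\<beta>. C k \<beta> * cmonom z \<beta>) has_sum t k z) (multi_indices K)"
    by simp_all
  define D where "D \<beta> = C (\<beta> i) (\<beta>(i := 0))" for \<beta>
  have D: "D (\<beta>(i := k)) = C k \<beta>" if "\<beta> \<in> multi_indices K" for \<beta> k
  proof -
    have "\<beta>(i := 0) = \<beta>" using that insert.hyps(2) by (auto simp: multi_indices_def)
    then show ?thesis by (simp add: D_def)
  qed
  have bnd: "norm (D \<beta>) * (\<Prod>i\<in>UNIV. \<rho> ^ \<beta> i) \<le> M" if "\<beta> \<in> multi_indices (insert i K)" for \<beta>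
  proof -
    have "\<beta>(i := 0) \<in> multi_indices K" using that by (auto simp: multi_indices_def)
    note C[OF this, of "\<beta> i"]
    then have "\<rho> ^ \<beta> i * (norm (D \<beta>) * (\<Prod>j\<in>UNIV. \<rho> ^ (\<beta>(i := 0)) j)) \<le> M"
      using \<rho> by (simp add: D_def field_simps)
    moreover have "(\<Prod>j\<in>UNIV. \<rho> ^ \<beta> j) = \<rho> ^ \<beta> i * (\<Prod>j\<in>UNIV. \<rho> ^ (\<beta>(i := 0)) j)"
      using prod_fun_upd[where h="\<lambda>j k. \<rho> ^ k" and \<beta>="\<beta>(i := 0)" and i=i and k="\<beta> i"]
      unfolding fun_upd_upd fun_upd_triv by simp
    ultimately show ?thesis by (simp add: mult_ac)
  qed
  have "((\<lambda>\<beta>. D \<beta> * cmonom z \<beta>) has_sum u z) (multi_indices (insert i K))"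
    if z: "z \<in> polydisc \<rho>" "z \<in> coord_space (insert i K)" for z
  proof -
    let ?z0 = "upd z i 0" and ?g = "\<lambda>(k, \<beta>). \<beta>(i := k)"
    have z0: "?z0 \<in> polydisc \<rho>" "?z0 \<in> coord_space K"
      using z \<rho> insert.hyps(2) by (auto simp: coord_space_def polydisc_def)
    have mon: "cmonom z (\<beta>(i := k)) = z $ i ^ k * cmonom ?z0 \<beta>" if "\<beta> \<in> multi_indices K" for \<beta> k
    proof -
      have "\<beta> i = 0" using that insert.hyps(2) by (auto simp: multi_indices_def)
      then have "cmonom z (\<beta>(i := k)) = z $ i ^ k * cmonom z \<beta>"
        by (intro prod_fun_upd[where h="\<lambda>j k. z $ j ^ k"]) simp
      also have "cmonom z \<beta> = cmonom ?z0 \<beta>"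
        using \<open>\<beta> i = 0\<close> by (intro prod.cong) auto
      finally show ?thesis .
    qed
    have "(\<lambda>\<beta>. norm (D \<beta> * cmonom z \<beta>)) summable_on multi_indices (insert i K)"
    proof (rule Infinite_Sum.abs_summable_on_comparison_test')
      show "(\<lambda>\<beta>. M * (\<Prod>j\<in>UNIV. (norm (z $ j) / \<rho>) ^ \<beta> j)) summable_on multi_indices (insert i K)"
        using z(1) \<rho> by (intro summable_on_cmult_right summable_on_multi_indices_geometric)
          (auto simp: polydisc_def)
      fix \<beta> assume \<beta>: "\<beta> \<in> multi_indices (insert i K)"
      have "(\<Prod>j\<in>UNIV. (norm (z $ j) / \<rho>) ^ \<beta> j) = norm (cmonom z \<beta>) / (\<Prod>j\<in>UNIV. \<rho> ^ \<beta> j)"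
        by (simp add: power_divide prod_dividef prod_norm[symmetric] norm_power)
      moreover have "0 < (\<Prod>j\<in>UNIV. \<rho> ^ \<beta> j)" using \<rho> by (simp add: prod_pos)
      ultimately show "norm (D \<beta> * cmonom z \<beta>) \<le> M * (\<Prod>j\<in>UNIV. (norm (z $ j) / \<rho>) ^ \<beta> j)"
        using mult_right_mono[OF bnd[OF \<beta>], of "norm (cmonom z \<beta>)"]
        by (simp add: norm_mult field_simps)
    qed
    then have "(\<lambda>\<beta>. D \<beta> * cmonom z \<beta>) summable_on multi_indices (insert i K)"
      by (rule abs_summable_summable)
    then have summ: "(\<lambda>x. D (?g x) * cmonom z (?g x)) summable_on (UNIV \<times> multi_indices K)"
      by (subst summable_on_reindex_bij_betw[OF bij_betw_multi_indices_insert[OF insert.hyps(2)]])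
    have "((\<lambda>x. D (?g x) * cmonom z (?g x)) has_sum u z) (UNIV \<times> multi_indices K)"
    proof (rule has_sum_SigmaI[OF _ _ summ])
      fix k
      have "((\<lambda>\<beta>. z $ i ^ k * (C k \<beta> * cmonom ?z0 \<beta>)) has_sum z $ i ^ k * t k ?z0) (multi_indices K)"
        by (intro has_sum_cmult_right sum z0)
      also have "?this \<longleftrightarrow> ((\<lambda>\<beta>. D (?g (k, \<beta>)) * cmonom z (?g (k, \<beta>))) has_sum z $ i ^ k * t k ?z0) (multi_indices K)"
        unfolding prod.case by (intro has_sum_cong) (simp only: D mon mult_ac)
      finally show "((\<lambda>\<beta>. D (?g (k, \<beta>)) * cmonom z (?g (k, \<beta>))) has_sum z $ i ^ k * t k ?z0) (multi_indices K)" .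
    next
      have "upd ?z0 i 0 = ?z0" by (simp add: vec_eq_iff)
      moreover have "z \<in> polydisc R" "norm (z $ i) < \<rho>" using z \<rho> by (auto simp: polydisc_def intro: less_trans)
      ultimately show "((\<lambda>k. z $ i ^ k * t k ?z0) has_sum u z) UNIV"
        using one_variable_Taylor(2)[OF insert.prems(1,2) \<rho>] by (simp add: t_def)
    qed
    then show ?thesis
      by (subst (asm) has_sum_reindex_bij_betw[OF bij_betw_multi_indices_insert[OF insert.hyps(2)]])
  qed
  with bnd show ?case by (intro exI[of _ D]) auto
qed

lemma Taylor_exists:
  fixes u :: "complex^'n::finite \<Rightarrow> complex"
  assumes u: "cn_holomorphic_on u V" and V: "open V" "0 \<in> V"
  obtains r C where "r > 0"
    "\<And>z. z \<in> ball 0 r \<Longrightarrow> z \<in> coord_space K \<Longrightarrow> ((\<lambda>\<beta>. C \<beta> * cmonom z \<beta>) has_sum u z) (multi_indices K)"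
proof -
  obtain e where e: "e > 0" "cball 0 e \<subseteq> V" using V open_contains_cball by blast
  \<comment> \<open>The norm of a vector is at most the sum of the norms of its
    \<open>CARD('n)\<close> coordinates, so that \<open>polydisc R\<close> lies in
    \<open>cball 0 e\<close>.\<close>
  define R where "R = e / real CARD('n)"
  have R: "R > 0" using e by (simp add: R_def)
  have sub: "polydisc R \<subseteq> cball (0 :: complex^'n) e"
  proof
    fix z :: "complex^'n" assume z: "z \<in> polydisc R"
    have "norm z \<le> (\<Sum>i\<in>UNIV. norm (z $ i))" unfolding norm_vec_def by (rule L2_set_le_sum) simp
    also have "\<dots> \<le> (\<Sum>i\<in>(UNIV::'n set). R)" using z by (intro sum_mono) (simp add: polydisc_def less_imp_le)
    finally show "z \<in> cball 0 e" by (simp add: R_def)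
  qed
  have "compact (u ` cball 0 e)"
    using cn_holomorphic_on_imp_continuous_on[OF u] e(2)
    by (intro compact_continuous_image) (auto intro: continuous_on_subset)
  then obtain M where M: "\<And>z. z \<in> cball 0 e \<Longrightarrow> norm (u z) \<le> M"
    by (meson bounded_iff compact_imp_bounded imageI)
  have "\<exists>C. (\<forall>\<beta>\<in>multi_indices K. norm (C \<beta>) * (\<Prod>i\<in>UNIV. (R / 2) ^ \<beta> i) \<le> M) \<and>
    (\<forall>z\<in>polydisc (R / 2) \<inter> coord_space K. ((\<lambda>\<beta>. C \<beta> * cmonom z \<beta>) has_sum u z) (multi_indices K))"
    using R M sub e(2)
    by (intro Taylor_polydisc[where R=R] cn_holomorphic_on_subset[OF u]) auto
  then obtain C where C: "\<And>z. z \<in> polydisc (R / 2) \<inter> coord_space K \<Longrightarrow>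
      ((\<lambda>\<beta>. C \<beta> * cmonom z \<beta>) has_sum u z) (multi_indices K)" by blast
  have "ball 0 (R / 2) \<subseteq> (polydisc (R / 2) :: (complex^'n) set)"
  proof
    fix z :: "complex^'n" assume "z \<in> ball 0 (R / 2)"
    then have "norm (z $ i) < R / 2" for i
      using Finite_Cartesian_Product.norm_nth_le[of z i] by simp
    then show "z \<in> polydisc (R / 2)" by (simp add: polydisc_def)
  qed
  with C R show ?thesis by (intro that[of "R / 2" C]) auto
qed

text \<open>With the other variables fixed, the series is a power series in the new variable that
  vanishes identically, so each of its coefficients is 0. These coefficients are power series in the
  remaining variables, to which the induction hypothesis applies.\<close>

lemma power_series_zero_unique:
  fixes C :: "('n::finite \<Rightarrow> nat) \<Rightarrow> complex"
  assumes "r > 0"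
    and "\<And>z. z \<in> ball 0 r \<Longrightarrow> z \<in> coord_space K \<Longrightarrow> ((\<lambda>\<beta>. C \<beta> * cmonom z \<beta>) has_sum 0) (multi_indices K)"
    and "\<beta> \<in> multi_indices K"
  shows "C \<beta> = 0"
  using finite[of K] assms
proof (induction K arbitrary: C r \<beta> rule: finite_induct)
  case empty
  have "((\<lambda>\<beta>. C \<beta> * cmonom 0 \<beta>) has_sum 0) (multi_indices {})"
    using empty by (intro empty.prems(2)) (auto simp: coord_space_def)
  then show ?case using empty by (auto simp: has_sum_finite_iff)
next
  case (insert i K)
  let ?g = "\<lambda>(k, \<beta>). \<beta>(i := k)"
  \<comment> \<open>Half the radius for \<open>z\<close> and half for the new variable keep the
    combined point in \<open>ball 0 r\<close>.\<close>
  have zero: "((\<lambda>\<beta>. C (\<beta>(i := k)) * cmonom z \<beta>) has_sum 0) (multi_indices K)"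
    if z: "z \<in> ball 0 (r / 2)" "z \<in> coord_space K" for z k
  proof -
    have zi: "z $ i = 0" using z(2) insert.hyps(2) by (simp add: coord_space_def)
    have full: "((\<lambda>(k, \<beta>). \<zeta> ^ k * (C (\<beta>(i := k)) * cmonom z \<beta>)) has_sum 0) (UNIV \<times> multi_indices K)"
      if \<zeta>: "norm \<zeta> < r / 2" for \<zeta>
    proof -
      have "dist (upd z i \<zeta>) 0 \<le> dist (upd z i \<zeta>) z + dist z 0" by (rule dist_triangle)
      also have "\<dots> < r" using \<zeta> z(1) by (simp add: dist_upd zi)
      finally have "upd z i \<zeta> \<in> ball 0 r" by (simp add: dist_commute)
      moreover have "upd z i \<zeta> \<in> coord_space (insert i K)" using z(2) by (simp add: coord_space_def)
      ultimately have "((\<lambda>\<beta>. C \<beta> * cmonom (upd z i \<zeta>) \<beta>) has_sum 0) (multi_indices (insert i K))"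
        by (rule insert.prems(2))
      then have "((\<lambda>x. C (?g x) * cmonom (upd z i \<zeta>) (?g x)) has_sum 0) (UNIV \<times> multi_indices K)"
        by (subst has_sum_reindex_bij_betw[OF bij_betw_multi_indices_insert[OF insert.hyps(2)]])
      also have "?this \<longleftrightarrow> ?thesis"
      proof (intro has_sum_cong, clarify)
        fix k \<beta> assume "\<beta> \<in> multi_indices K"
        then have "\<beta> i = 0" using insert.hyps(2) by (auto simp: multi_indices_def)
        then have "cmonom (upd z i \<zeta>) (\<beta>(i := k)) = \<zeta> ^ k * cmonom (upd z i \<zeta>) \<beta>"
          by (subst prod_fun_upd[where h="\<lambda>j k. upd z i \<zeta> $ j ^ k"]) simp_all
        also have "cmonom (upd z i \<zeta>) \<beta> = cmonom z \<beta>"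
          using \<open>\<beta> i = 0\<close> by (intro prod.cong) auto
        finally show "C (\<beta>(i := k)) * cmonom (upd z i \<zeta>) (\<beta>(i := k)) = \<zeta> ^ k * (C (\<beta>(i := k)) * cmonom z \<beta>)"
          by (simp only: mult_ac)
      qed
      finally show ?thesis .
    qed
    \<comment> \<open>Any nonzero value in the range will do: the inner series is summable after
      multiplication by \<open>\<zeta>0 ^ k\<close>, and this factor can be cancelled.\<close>
    define \<zeta>0 :: complex where "\<zeta>0 = of_real (r / 4)"
    have \<zeta>0: "norm \<zeta>0 < r / 2" "\<zeta>0 \<noteq> 0" using insert.prems(1) by (auto simp: \<zeta>0_def)
    have summ: "(\<lambda>\<beta>. C (\<beta>(i := k)) * cmonom z \<beta>) summable_on multi_indices K" for k
    proof -
      have "(\<lambda>\<beta>. \<zeta>0 ^ k * (C (\<beta>(i := k)) * cmonom z \<beta>)) summable_on multi_indices K"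
        using summable_on_SigmaD1[of "\<lambda>k \<beta>. \<zeta>0 ^ k * (C (\<beta>(i := k)) * cmonom z \<beta>)" UNIV "\<lambda>_. multi_indices K" k]
          full[OF \<zeta>0(1)] by (auto simp: summable_on_def)
      from summable_on_cmult_right[OF this, of "inverse (\<zeta>0 ^ k)"] show ?thesis
        using \<zeta>0(2) by (simp add: mult.assoc[symmetric])
    qed
    define a where "a k = infsum (\<lambda>\<beta>. C (\<beta>(i := k)) * cmonom z \<beta>) (multi_indices K)" for k
    have a: "((\<lambda>\<beta>. C (\<beta>(i := k)) * cmonom z \<beta>) has_sum a k) (multi_indices K)" for k
      unfolding a_def using summ by simp
    have ps: "(\<lambda>k. a k * \<zeta> ^ k) sums 0" if "norm \<zeta> < r / 2" for \<zeta>
    proof -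
      have "((\<lambda>k. \<zeta> ^ k * a k) has_sum 0) UNIV"
        by (rule has_sum_SigmaD[OF full[OF that]]) (use has_sum_cmult_right[OF a] in simp)
      then show ?thesis by (simp add: has_sum_imp_sums mult.commute)
    qed
    have "a k = 0"
    proof (rule ccontr)
      assume ak: "a k \<noteq> 0"
      \<comment> \<open>The theorem on isolated zeros is about a coefficient of positive index, so
        the constant term is treated by evaluation at 0.\<close>
      have "a 0 = 0" using sums_unique2[OF ps[of 0] powser_sums_zero[of a]] insert.prems(1) by simp
      with ak have "k > 0" by (cases k) auto
      show False
      proof (rule powser_0_nonzero[of "r / 2" 0 a "\<lambda>_. 0" k])
        fix s :: real assume "0 < s" and "\<And>z::complex. z \<in> cball 0 s - {0} \<Longrightarrow> (0::complex) \<noteq> 0"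
        from this(2)[of "of_real s"] \<open>0 < s\<close> show False by simp
      qed (use ps insert.prems(1) ak \<open>k > 0\<close> in auto)
    qed
    with a[of k] show ?thesis by simp
  qed
  have \<beta>: "\<beta>(i := 0) \<in> multi_indices K" using insert.prems(3) by (auto simp: multi_indices_def)
  have "C ((\<beta>(i := 0))(i := \<beta> i)) = 0"
    by (rule insert.IH[of "r / 2" "\<lambda>\<gamma>. C (\<gamma>(i := \<beta> i))", OF _ zero \<beta>]) (use insert.prems(1) in simp)
  then show ?case unfolding fun_upd_upd fun_upd_triv .
qed

section \<open>Germs at the origin\<close>

definition hol0 :: "(complex^'n::finite \<Rightarrow> complex) \<Rightarrow> bool" where
  "hol0 u \<longleftrightarrow> (\<exists>V. open V \<and> 0 \<in> V \<and> cn_holomorphic_on u V)"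

lemma hol0_const [simp, intro]: "hol0 (\<lambda>z. c)"
  unfolding hol0_def by (rule exI[of _ UNIV]) simp

lemma hol0_nth [simp, intro]: "hol0 (\<lambda>z. z $ i)"
  unfolding hol0_def by (rule exI[of _ UNIV]) simp

lemma hol0_2:
  assumes "hol0 u" "hol0 v"
  obtains V where "open V" "0 \<in> V" "cn_holomorphic_on u V" "cn_holomorphic_on v V"
proof -
  obtain V W where "open V" "0 \<in> V" "cn_holomorphic_on u V" "open W" "0 \<in> W" "cn_holomorphic_on v W"
    using assms unfolding hol0_def by blast
  then show ?thesis
    by (intro that[of "V \<inter> W"] open_Int IntI cn_holomorphic_on_subset[of u V "V \<inter> W"]
        cn_holomorphic_on_subset[of v W "V \<inter> W"]) simp_all
qed

lemma hol0_add [intro]: "hol0 u \<Longrightarrow> hol0 v \<Longrightarrow> hol0 (\<lambda>z. u z + v z)"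
  by (erule (1) hol0_2) (use cn_holomorphic_on_add hol0_def in blast)

lemma hol0_mult [intro]: "hol0 u \<Longrightarrow> hol0 v \<Longrightarrow> hol0 (\<lambda>z. u z * v z)"
  by (erule (1) hol0_2) (use cn_holomorphic_on_mult hol0_def in blast)

lemma hol0_minus [intro]: "hol0 u \<Longrightarrow> hol0 (\<lambda>z. - u z)"
  using hol0_mult[of "\<lambda>z. - 1" u] by simp

lemma hol0_diff [intro]: "hol0 u \<Longrightarrow> hol0 v \<Longrightarrow> hol0 (\<lambda>z. u z - v z)"
  using hol0_add[of u "\<lambda>z. - v z"] hol0_minus[of v] by simp

lemma hol0_sum [intro]: "(\<And>i. i \<in> S \<Longrightarrow> hol0 (u i)) \<Longrightarrow> hol0 (\<lambda>z. \<Sum>i\<in>S. u i z)"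
  by (induction S rule: infinite_finite_induct) auto

lemma hol0_prod [intro]: "(\<And>i. i \<in> S \<Longrightarrow> hol0 (u i)) \<Longrightarrow> hol0 (\<lambda>z. \<Prod>i\<in>S. u i z)"
  by (induction S rule: infinite_finite_induct) auto

lemma hol0_power [intro]: "hol0 u \<Longrightarrow> hol0 (\<lambda>z. u z ^ k)"
  by (induction k) auto

lemma hol0_det [intro]:
  fixes b :: "'m::finite \<Rightarrow> 'm \<Rightarrow> complex^'n::finite \<Rightarrow> complex"
  assumes "\<And>i j. hol0 (b i j)"
  shows "hol0 (\<lambda>z. det (\<chi> i j. b i j z))"
  unfolding det_def vec_lambda_beta
  by (intro hol0_sum hol0_mult hol0_prod hol0_const assms)

lemma hol0_inverse [intro]:
  assumes "hol0 u" "u 0 \<noteq> 0"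
  shows "hol0 (\<lambda>z. inverse (u z))"
proof -
  obtain V where V: "open V" "0 \<in> V" "cn_holomorphic_on u V" using assms(1) unfolding hol0_def by blast
  let ?W = "V \<inter> u -` (- {0})"
  have "open ?W"
    by (rule continuous_open_preimage[OF cn_holomorphic_on_imp_continuous_on[OF V(3)] V(1)]) auto
  moreover have "cn_holomorphic_on (\<lambda>z. inverse (u z)) ?W"
    by (rule cn_holomorphic_on_inverse[OF cn_holomorphic_on_subset[OF V(3)]]) auto
  ultimately show ?thesis using assms(2) V(2) unfolding hol0_def by blast
qed

lemma hol0_cong:
  assumes "hol0 u" "eventually (\<lambda>z. v z = u z) (nhds 0)"
  shows "hol0 v"
proof -
  obtain V where V: "open V" "0 \<in> V" "cn_holomorphic_on u V" using assms(1) unfolding hol0_def by blast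
  obtain W where W: "open W" "0 \<in> W" "\<And>z. z \<in> W \<Longrightarrow> v z = u z" using assms(2) unfolding eventually_nhds by blast
  have "cn_holomorphic_on v (V \<inter> W)"
    by (rule cn_holomorphic_on_cong_open[OF cn_holomorphic_on_subset[OF V(3)]]) (use V W in auto)
  with V W show ?thesis unfolding hol0_def by blast
qed

lemma hol0_isCont: "hol0 u \<Longrightarrow> isCont u 0"
  unfolding hol0_def
  by (meson cn_holomorphic_on_imp_continuous_on continuous_on_eq_continuous_at)

definition hol_map0 :: "(complex^'m::finite \<Rightarrow> complex^'n::finite) \<Rightarrow> bool" where
  "hol_map0 p \<longleftrightarrow> (\<forall>i. hol0 (\<lambda>w. p w $ i)) \<and> p 0 = 0"

lemma hol_map0_nth [intro]: "hol_map0 p \<Longrightarrow> hol0 (\<lambda>w. p w $ i)"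
  by (simp add: hol_map0_def)

lemma hol_map0_common:
  assumes "hol_map0 p"
  obtains W where "open W" "0 \<in> W" "\<And>i. cn_holomorphic_on (\<lambda>w. p w $ i) W"
proof -
  have "\<forall>i. \<exists>V. open V \<and> 0 \<in> V \<and> cn_holomorphic_on (\<lambda>w. p w $ i) V"
    using assms by (simp add: hol_map0_def hol0_def)
  then obtain V where V: "\<And>i. open (V i)" "\<And>i. 0 \<in> V i" "\<And>i. cn_holomorphic_on (\<lambda>w. p w $ i) (V i)"
    by metis
  show ?thesis
    by (rule that[of "\<Inter>i. V i"]) (use V in \<open>auto intro: cn_holomorphic_on_subset[OF V(3)]\<close>)
qed

lemma hol_map0_isCont:
  assumes "hol_map0 p"
  shows "isCont p 0"
  unfolding isCont_def
proof (rule vec_tendstoI)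
  fix i show "((\<lambda>w. p w $ i) \<longlongrightarrow> p 0 $ i) (at 0)"
    using hol0_isCont[OF hol_map0_nth[OF assms]] unfolding isCont_def .
qed

lemma hol_map0_eventually:
  assumes "hol_map0 p" "eventually P (nhds 0)"
  shows "eventually (\<lambda>w. P (p w)) (nhds 0)"
proof (rule eventually_compose_filterlim[OF assms(2)])
  have "(p \<longlongrightarrow> p 0) (at 0)" using hol_map0_isCont[OF assms(1)] by (simp add: isCont_def)
  then show "filterlim p (nhds 0) (nhds 0)"
    using assms(1) by (simp add: tendsto_at_iff_tendsto_nhds hol_map0_def)
qed

lemma hol0_compose [intro]:
  assumes u: "hol0 u" and p: "hol_map0 p"
  shows "hol0 (\<lambda>w. u (p w))"
proof -
  obtain V where V: "open V" "0 \<in> V" "cn_holomorphic_on u V" using u unfolding hol0_def by blast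
  obtain W where W: "open W" "0 \<in> W" "\<And>i. cn_holomorphic_on (\<lambda>w. p w $ i) W"
    using hol_map0_common[OF p] by blast
  have "eventually (\<lambda>z. z \<in> V) (nhds 0)" using V(1,2) by (rule eventually_nhds_in_open)
  then have "eventually (\<lambda>w. p w \<in> V) (nhds 0)" by (rule hol_map0_eventually[OF p])
  then obtain W' where W': "open W'" "0 \<in> W'" "\<And>w. w \<in> W' \<Longrightarrow> p w \<in> V"
    unfolding eventually_nhds by blast
  have "cn_holomorphic_on (\<lambda>w. u (p w)) (W \<inter> W')"
    by (rule cn_holomorphic_on_compose[OF V(3)]) (use W(3) W' in \<open>auto intro: cn_holomorphic_on_subset[OF W(3)]\<close>)
  with W W' show ?thesis unfolding hol0_def by blast
qed

lemma hol_map0_compose [intro]: "hol_map0 p \<Longrightarrow> hol_map0 q \<Longrightarrow> hol_map0 (\<lambda>w. p (q w))"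
  unfolding hol_map0_def[of "\<lambda>w. p (q w)"]
  using hol0_compose[of "\<lambda>w. p w $ _" q] by (auto simp: hol_map0_def)

lemma hol_map0_lpart [simp, intro]: "hol_map0 lpart" and hol_map0_rpart [simp, intro]: "hol_map0 rpart"
  by (auto simp: hol_map0_def)

lemma eventually_nhds_shrink:
  fixes Q :: "complex^'n::finite \<Rightarrow> bool"
  shows "(\<exists>r>0. \<forall>z\<in>ball 0 r. Q z) \<longleftrightarrow> eventually Q (nhds 0)"
  unfolding eventually_nhds_metric by (simp add: dist_commute Ball_def)

section \<open>Taylor coefficients\<close>

text \<open>Uniqueness of power series resolves the definite description in
  \<open>taylor_coeff\<close>. The rules for Taylor coefficients then follow by exhibiting a
  convergent series.\<close>

lemma taylor_coeffI:
  assumes ev: "eventually (\<lambda>z. z \<in> coord_space J \<longrightarrow>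
      ((\<lambda>\<beta>. C \<beta> * cmonom z \<beta>) has_sum u z) (multi_indices J)) (nhds 0)"
    and \<alpha>: "\<alpha> \<in> multi_indices J"
  shows "taylor_coeff J u \<alpha> = C \<alpha>"
  unfolding taylor_coeff_def
proof (rule the_equality)
  from ev obtain r where r: "r > 0" "\<And>z. z \<in> ball 0 r \<Longrightarrow> z \<in> coord_space J \<Longrightarrow>
      ((\<lambda>\<beta>. C \<beta> * cmonom z \<beta>) has_sum u z) (multi_indices J)"
    unfolding eventually_nhds_shrink[symmetric] by blast
  show "\<exists>r>0. \<exists>C'. (\<forall>z\<in>ball 0 r \<inter> coord_space J.
      ((\<lambda>\<beta>. C' \<beta> * cmonom z \<beta>) has_sum u z) (multi_indices J)) \<and> C \<alpha> = C' \<alpha>"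
    using r by (intro exI[of _ r] conjI exI[of _ C]) auto
  fix c assume "\<exists>r>0. \<exists>C'. (\<forall>z\<in>ball 0 r \<inter> coord_space J.
      ((\<lambda>\<beta>. C' \<beta> * cmonom z \<beta>) has_sum u z) (multi_indices J)) \<and> c = C' \<alpha>"
  then obtain r' C' where r': "r' > 0" "c = C' \<alpha>" "\<And>z. z \<in> ball 0 r' \<Longrightarrow> z \<in> coord_space J \<Longrightarrow>
      ((\<lambda>\<beta>. C' \<beta> * cmonom z \<beta>) has_sum u z) (multi_indices J)" by blast
  have "C' \<alpha> - C \<alpha> = 0"
  proof (rule power_series_zero_unique[OF _ _ \<alpha>])
    show "0 < min r r'" using r r' by simp
    fix z assume z: "z \<in> ball 0 (min r r')" "z \<in> coord_space J"
    have "((\<lambda>\<beta>. C' \<beta> * cmonom z \<beta> + - (C \<beta> * cmonom z \<beta>)) has_sum u z + - u z) (multi_indices J)"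
      using z by (intro has_sum_add has_sum_uminusI r r') auto
    then show "((\<lambda>\<beta>. (C' \<beta> - C \<beta>) * cmonom z \<beta>) has_sum 0) (multi_indices J)"
      by (simp add: left_diff_distrib)
  qed
  with r' show "c = C \<alpha>" by simp
qed

lemma taylor_coeff_has_sum:
  assumes "hol0 u"
  shows "eventually (\<lambda>z. z \<in> coord_space J \<longrightarrow>
    ((\<lambda>\<beta>. taylor_coeff J u \<beta> * cmonom z \<beta>) has_sum u z) (multi_indices J)) (nhds 0)"
proof -
  obtain V where V: "cn_holomorphic_on u V" "open V" "0 \<in> V" using assms unfolding hol0_def by blast
  from Taylor_exists[OF V, of J] obtain r C where "r > 0"
    "\<And>z. z \<in> ball 0 r \<Longrightarrow> z \<in> coord_space J \<Longrightarrow> ((\<lambda>\<beta>. C \<beta> * cmonom z \<beta>) has_sum u z) (multi_indices J)"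
    by blast
  then have ev: "eventually (\<lambda>z. z \<in> coord_space J \<longrightarrow>
      ((\<lambda>\<beta>. C \<beta> * cmonom z \<beta>) has_sum u z) (multi_indices J)) (nhds 0)"
    unfolding eventually_nhds_shrink[symmetric] by blast
  show ?thesis using ev
    by (rule eventually_mono) (auto simp: taylor_coeffI[OF ev] cong: has_sum_cong)
qed

lemma taylor_coeff_cong:
  assumes "hol0 u" "\<alpha> \<in> multi_indices J"
    and "eventually (\<lambda>z. z \<in> coord_space J \<longrightarrow> v z = u z) (nhds 0)"
  shows "taylor_coeff J v \<alpha> = taylor_coeff J u \<alpha>"
  by (rule taylor_coeffI[OF _ assms(2)], use taylor_coeff_has_sum[OF assms(1), of J] assms(3) in eventually_elim) auto

lemma taylor_coeff_add:
  assumes "hol0 u" "hol0 v" "\<alpha> \<in> multi_indices J"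
  shows "taylor_coeff J (\<lambda>z. u z + v z) \<alpha> = taylor_coeff J u \<alpha> + taylor_coeff J v \<alpha>"
proof (rule taylor_coeffI[where C="\<lambda>\<alpha>. taylor_coeff J u \<alpha> + taylor_coeff J v \<alpha>", OF _ assms(3)])
  show "eventually (\<lambda>z. z \<in> coord_space J \<longrightarrow>
      ((\<lambda>\<beta>. (taylor_coeff J u \<beta> + taylor_coeff J v \<beta>) * cmonom z \<beta>) has_sum u z + v z) (multi_indices J)) (nhds 0)"
    using taylor_coeff_has_sum[OF assms(1), of J] taylor_coeff_has_sum[OF assms(2), of J]
    by eventually_elim (auto simp: distrib_right intro: has_sum_add)
qed

lemma taylor_coeff_zero: "\<alpha> \<in> multi_indices J \<Longrightarrow> taylor_coeff J (\<lambda>z. 0) \<alpha> = 0"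
  by (rule taylor_coeffI[where C="\<lambda>_. 0"]) auto

lemma taylor_coeff_sum:
  assumes "\<And>i. i \<in> S \<Longrightarrow> hol0 (u i)" "\<alpha> \<in> multi_indices J"
  shows "taylor_coeff J (\<lambda>z. \<Sum>i\<in>S. u i z) \<alpha> = (\<Sum>i\<in>S. taylor_coeff J (u i) \<alpha>)"
  using assms(1)
  by (induction S rule: infinite_finite_induct)
    (auto simp: taylor_coeff_zero[OF assms(2)] taylor_coeff_add[OF _ _ assms(2)] hol0_sum)

lemma cmonom_shift: "cmonom z (\<beta>(i := \<beta> i + k)) = z $ i ^ k * cmonom z \<beta>"
proof -
  have "cmonom z (\<beta>(i := \<beta> i + k)) = (\<Prod>j\<in>UNIV. (if j = i then z $ i ^ k else 1) * z $ j ^ \<beta> j)"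
    by (rule prod.cong) (auto simp: power_add)
  then show ?thesis by (simp add: prod.distrib)
qed

lemma taylor_coeff_shift:
  assumes u: "hol0 u" and i: "i \<in> J" and \<alpha>: "\<alpha> \<in> multi_indices J"
  shows "taylor_coeff J (\<lambda>z. z $ i ^ k * u z) \<alpha> = (if k \<le> \<alpha> i then taylor_coeff J u (\<alpha>(i := \<alpha> i - k)) else 0)"
proof (rule taylor_coeffI[where C="\<lambda>\<alpha>. if k \<le> \<alpha> i then taylor_coeff J u (\<alpha>(i := \<alpha> i - k)) else 0", OF _ \<alpha>])
  let ?C = "\<lambda>\<alpha>. if k \<le> \<alpha> i then taylor_coeff J u (\<alpha>(i := \<alpha> i - k)) else 0"
  show "eventually (\<lambda>z. z \<in> coord_space J \<longrightarrow>
      ((\<lambda>\<beta>. ?C \<beta> * cmonom z \<beta>) has_sum z $ i ^ k * u z) (multi_indices J)) (nhds 0)"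
    using taylor_coeff_has_sum[OF u, of J]
  proof (rule eventually_mono, intro impI)
    fix z assume "z \<in> coord_space J \<longrightarrow>
      ((\<lambda>\<beta>. taylor_coeff J u \<beta> * cmonom z \<beta>) has_sum u z) (multi_indices J)" "z \<in> coord_space J"
    then have "((\<lambda>\<beta>. z $ i ^ k * (taylor_coeff J u \<beta> * cmonom z \<beta>)) has_sum z $ i ^ k * u z) (multi_indices J)"
      by (intro has_sum_cmult_right) simp
    also have "?this \<longleftrightarrow> ((\<lambda>\<beta>. ?C \<beta> * cmonom z \<beta>) has_sum z $ i ^ k * u z) {\<beta> \<in> multi_indices J. k \<le> \<beta> i}"
    proof (rule has_sum_reindex_bij_witness[where j="\<lambda>\<beta>. \<beta>(i := \<beta> i + k)" and i="\<lambda>\<beta>. \<beta>(i := \<beta> i - k)"])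
      fix \<beta> show "?C (\<beta>(i := \<beta> i + k)) * cmonom z (\<beta>(i := \<beta> i + k)) =
          z $ i ^ k * (taylor_coeff J u \<beta> * cmonom z \<beta>)"
        unfolding cmonom_shift by simp
    qed (use i in \<open>auto simp: multi_indices_def\<close>)
    also have "\<dots> \<longleftrightarrow> ((\<lambda>\<beta>. ?C \<beta> * cmonom z \<beta>) has_sum z $ i ^ k * u z) (multi_indices J)"
      by (rule has_sum_cong_neutral) auto
    finally show "((\<lambda>\<beta>. ?C \<beta> * cmonom z \<beta>) has_sum z $ i ^ k * u z) (multi_indices J)" .
  qed
qed

lemma hol_map0_upd [simp, intro]: "hol_map0 (\<lambda>z. upd z i 0)"
  unfolding hol_map0_def
proof (intro conjI allI)
  fix j show "hol0 (\<lambda>z. upd z i 0 $ j)" by (cases "j = i") auto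
qed (simp add: vec_eq_iff)

text \<open>Putting 0 for the \<open>i\<close>-th variable kills the terms with
  \<open>\<beta> i > 0\<close> and keeps the others, as 0 ^ 0 = 1. The series so obtained also
  represents \<open>u\<close>, so by uniqueness the killed coefficients are 0.\<close>

lemma taylor_coeff_independent:
  assumes u: "hol0 u" and \<alpha>: "\<alpha> \<in> multi_indices J" "\<alpha> i \<noteq> 0"
    and ind: "eventually (\<lambda>z. u z = u (upd z i 0)) (nhds 0)"
  shows "taylor_coeff J u \<alpha> = 0"
proof -
  let ?C = "\<lambda>\<beta>. if \<beta> i = 0 then taylor_coeff J u \<beta> else 0"
  have "taylor_coeff J u \<alpha> = ?C \<alpha>"
  proof (rule taylor_coeffI[OF _ \<alpha>(1)])
    have "eventually (\<lambda>z. upd z i 0 \<in> coord_space J \<longrightarrow>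
      ((\<lambda>\<beta>. taylor_coeff J u \<beta> * cmonom (upd z i 0) \<beta>) has_sum u (upd z i 0)) (multi_indices J)) (nhds 0)"
      by (rule hol_map0_eventually[OF hol_map0_upd taylor_coeff_has_sum[OF u]])
    then show "eventually (\<lambda>z. z \<in> coord_space J \<longrightarrow>
      ((\<lambda>\<beta>. ?C \<beta> * cmonom z \<beta>) has_sum u z) (multi_indices J)) (nhds 0)"
      using ind
    proof (eventually_elim, intro impI)
      fix z assume sum: "upd z i 0 \<in> coord_space J \<longrightarrow>
          ((\<lambda>\<beta>. taylor_coeff J u \<beta> * cmonom (upd z i 0) \<beta>) has_sum u (upd z i 0)) (multi_indices J)"
        and uz: "u z = u (upd z i 0)" and z: "z \<in> coord_space J"
      have "upd z i 0 \<in> coord_space J" using z by (simp add: coord_space_def)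
      with sum uz have "((\<lambda>\<beta>. taylor_coeff J u \<beta> * cmonom (upd z i 0) \<beta>) has_sum u z) (multi_indices J)"
        by simp
      also have "?this \<longleftrightarrow> ((\<lambda>\<beta>. ?C \<beta> * cmonom z \<beta>) has_sum u z) (multi_indices J)"
      proof (rule has_sum_cong)
        fix \<beta>
        show "taylor_coeff J u \<beta> * cmonom (upd z i 0) \<beta> = ?C \<beta> * cmonom z \<beta>"
        proof (cases "\<beta> i = 0")
          case True
          then have "cmonom (upd z i 0) \<beta> = cmonom z \<beta>" by (intro prod.cong) auto
          with True show ?thesis by simp
        next
          case False
          then have "cmonom (upd z i 0) \<beta> = 0" by (intro prod_zero) (auto intro!: bexI[of _ i])
          with False show ?thesis by simp
        qed
      qed
      finally show "((\<lambda>\<beta>. ?C \<beta> * cmonom z \<beta>) has_sum u z) (multi_indices J)" .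
    qed
  qed
  with \<alpha>(2) show ?thesis by simp
qed

text \<open>The projection onto the coordinate subspace of \<open>J\<close>, whose coordinates are
  found among those of the source by means of \<iota>. With \<open>Inl\<close> and
  \<open>Inr\<close> it gives the two components of a pair, with the identity on \<open>- I\<close>
  the projection onto the stratum S_p.\<close>

definition pull :: "'n set \<Rightarrow> ('n \<Rightarrow> 'm) \<Rightarrow> complex^'m::finite \<Rightarrow> complex^'n::finite" where
  "pull J \<iota> w = (\<chi> i. if i \<in> J then w $ \<iota> i else 0)"

lemma pull_nth [simp]: "pull J \<iota> w $ i = (if i \<in> J then w $ \<iota> i else 0)"
  by (simp add: pull_def)

lemma pull_coord_space [simp]: "pull J \<iota> w \<in> coord_space J"
  by (simp add: coord_space_def)

lemma hol_map0_pull [simp, intro]: "hol_map0 (pull J \<iota>)"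
  unfolding hol_map0_def
proof (intro conjI allI)
  fix i show "hol0 (\<lambda>w. pull J \<iota> w $ i)" by (cases "i \<in> J") auto
qed (simp add: vec_eq_iff)

text \<open>The series of \<open>u\<close> turns into a series in the variables with index in the
  image of \<iota>. It becomes a full power series by giving all other monomials the coefficient 0,
  which is what \<open>?C\<close> does.\<close>

lemma taylor_coeff_pull:
  fixes \<iota> :: "'n::finite \<Rightarrow> 'm::finite"
  assumes u: "hol0 u" and \<iota>: "inj_on \<iota> J" and \<gamma>: "\<gamma> \<in> multi_indices (\<iota> ` J)"
  shows "taylor_coeff UNIV (\<lambda>w. u (pull J \<iota> w)) \<gamma> = taylor_coeff J u (\<lambda>i. if i \<in> J then \<gamma> (\<iota> i) else 0)"
proof -
  let ?p = "\<lambda>\<gamma> i. if i \<in> J then \<gamma> (\<iota> i) else 0"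
  let ?C = "\<lambda>\<gamma>. if \<gamma> \<in> multi_indices (\<iota> ` J) then taylor_coeff J u (?p \<gamma>) else 0"
  have bij: "bij_betw ?p (multi_indices (\<iota> ` J)) (multi_indices J)"
    by (rule bij_betw_byWitness[where f'="\<lambda>\<beta> k. if k \<in> \<iota> ` J then \<beta> (inv_into J \<iota> k) else 0"])
      (use \<iota> in \<open>auto simp: multi_indices_def fun_eq_iff inv_into_f_f\<close>)
  have mon: "cmonom (pull J \<iota> w) (?p \<gamma>) = cmonom w \<gamma>" if "\<gamma> \<in> multi_indices (\<iota> ` J)" for w \<gamma>
  proof -
    have "cmonom (pull J \<iota> w) (?p \<gamma>) = (\<Prod>i\<in>J. w $ \<iota> i ^ \<gamma> (\<iota> i))"
      by (rule prod.mono_neutral_cong_right) auto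
    also have "\<dots> = (\<Prod>k\<in>\<iota> ` J. w $ k ^ \<gamma> k)"
      by (simp add: prod.reindex[OF \<iota>])
    also have "\<dots> = cmonom w \<gamma>"
      by (rule prod.mono_neutral_left) (use that in \<open>auto simp: multi_indices_def\<close>)
    finally show ?thesis .
  qed
  have "taylor_coeff UNIV (\<lambda>w. u (pull J \<iota> w)) \<gamma> = ?C \<gamma>"
  proof (rule taylor_coeffI)
    have "eventually (\<lambda>w. pull J \<iota> w \<in> coord_space J \<longrightarrow> ((\<lambda>\<beta>. taylor_coeff J u \<beta> * cmonom (pull J \<iota> w) \<beta>)
        has_sum u (pull J \<iota> w)) (multi_indices J)) (nhds 0)"
      by (rule hol_map0_eventually[OF hol_map0_pull taylor_coeff_has_sum[OF u]])
    then show "eventually (\<lambda>w. w \<in> coord_space UNIV \<longrightarrow>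
      ((\<lambda>\<beta>. ?C \<beta> * cmonom w \<beta>) has_sum u (pull J \<iota> w)) (multi_indices UNIV)) (nhds 0)"
    proof (eventually_elim, intro impI)
      fix w assume "pull J \<iota> w \<in> coord_space J \<longrightarrow> ((\<lambda>\<beta>. taylor_coeff J u \<beta> * cmonom (pull J \<iota> w) \<beta>)
        has_sum u (pull J \<iota> w)) (multi_indices J)"
      then have "((\<lambda>\<beta>. taylor_coeff J u \<beta> * cmonom (pull J \<iota> w) \<beta>) has_sum u (pull J \<iota> w)) (multi_indices J)"
        by simp
      then have "((\<lambda>\<gamma>. taylor_coeff J u (?p \<gamma>) * cmonom (pull J \<iota> w) (?p \<gamma>)) has_sum u (pull J \<iota> w))
          (multi_indices (\<iota> ` J))"
        by (subst has_sum_reindex_bij_betw[OF bij, where f="\<lambda>\<beta>. taylor_coeff J u \<beta> * cmonom (pull J \<iota> w) \<beta>"])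
      also have "?this \<longleftrightarrow> ((\<lambda>\<beta>. ?C \<beta> * cmonom w \<beta>) has_sum u (pull J \<iota> w)) (multi_indices UNIV)"
      proof (rule has_sum_cong_neutral)
        fix \<gamma> assume "\<gamma> \<in> multi_indices (\<iota> ` J) \<inter> multi_indices UNIV"
        then show "taylor_coeff J u (?p \<gamma>) * cmonom (pull J \<iota> w) (?p \<gamma>) = ?C \<gamma> * cmonom w \<gamma>"
          by (subst mon) auto
      qed (auto simp: multi_indices_def[of UNIV])
      finally show "((\<lambda>\<beta>. ?C \<beta> * cmonom w \<beta>) has_sum u (pull J \<iota> w)) (multi_indices UNIV)" .
    qed
  qed (simp add: multi_indices_def)
  with \<gamma> show ?thesis by simp
qed

section \<open>The residue symbol\<close>

text \<open>The cofactor of the entry \<open>(i, k)\<close>, written with column \<open>k\<close>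
  replaced by a unit vector. This is the shape in which Cramer's rule yields it, and it is
  polynomial in the entries of \<open>A\<close>.\<close>

definition cof :: "'a::comm_ring_1^'n^'n::finite \<Rightarrow> 'n \<Rightarrow> 'n \<Rightarrow> 'a" where
  "cof A i k = det (\<chi> i' j'. if j' = k then (if i' = i then 1 else 0) else A $ i' $ j')"

text \<open>Cramer's rule without division, with the right-hand side expanded in unit
  vectors.\<close>

lemma det_mult_nth:
  fixes A :: "'a::field^'n^'n::finite"
  shows "det A * x $ k = (\<Sum>i\<in>UNIV. (A *v x) $ i * cof A i k)"
proof -
  let ?y = "A *v x"
  \<comment> \<open>The linearity rules for determinants concern rows, so transposition turns the
    replaced column into a row.\<close>
  have *: "det (\<chi> i j. if j = k then v i else A $ i $ j) = det (\<chi> j. if j = k then vec_lambda v else column j A)"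
    for v :: "'n \<Rightarrow> 'a"
    by (subst det_transpose[symmetric], rule arg_cong[where f=det])
      (auto simp: vec_eq_iff transpose_def column_def)
  have "x $ k * det A = det (\<chi> i j. if j = k then ?y $ i else A $ i $ j)"
    by (rule cramer_lemma[symmetric])
  also have "\<dots> = det (\<chi> j. if j = k then (\<Sum>i\<in>UNIV. ?y $ i *s axis i 1) else column j A)"
    unfolding * basis_expansion vec_lambda_eta ..
  also have "\<dots> = (\<Sum>i\<in>UNIV. det (\<chi> j. if j = k then ?y $ i *s axis i 1 else column j A))"
    by (rule det_linear_row_sum) simp
  also have "\<dots> = (\<Sum>i\<in>UNIV. ?y $ i * det (\<chi> j. if j = k then axis i 1 else column j A))"
    by (simp add: det_row_mul)
  also have "\<dots> = (\<Sum>i\<in>UNIV. ?y $ i * cof A i k)"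
    unfolding cof_def * axis_def ..
  finally show ?thesis by (simp add: mult.commute)
qed

lemma hol0_cof [intro]:
  assumes "\<And>i j. hol0 (\<lambda>z. A z $ i $ j)"
  shows "hol0 (\<lambda>z. cof (A z) i k)"
  unfolding cof_def
proof (rule hol0_det)
  fix i' j' show "hol0 (\<lambda>z. if j' = k then if i' = i then 1 else 0 else A z $ i' $ j')"
    using assms by (cases "j' = k") auto
qed

lemma hol0_det_matrix [intro]:
  assumes "\<And>i j. hol0 (\<lambda>z. A z $ i $ j)"
  shows "hol0 (\<lambda>z. det (A z))"
  using hol0_det[of "\<lambda>i j z. A z $ i $ j"] assms by (simp add: vec_lambda_eta)

definition pad :: "'n set \<Rightarrow> ('n \<Rightarrow> 'n \<Rightarrow> complex) \<Rightarrow> complex^'n^'n::finite" where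
  "pad J b = (\<chi> i j. if i \<in> J \<and> j \<in> J then b i j else if i = j then 1 else 0)"

lemma minor_det_eq: "minor_det J b = det (pad J b)"
  by (simp add: minor_det_def pad_def)

lemma pad_nth [simp]: "pad J b $ i $ j = (if i \<in> J \<and> j \<in> J then b i j else if i = j then 1 else 0)"
  by (simp add: pad_def)

lemma pad_self:
  assumes "\<And>i j. i \<notin> J \<or> j \<notin> J \<Longrightarrow> A $ i $ j = (if i = j then 1 else 0)"
  shows "pad J (\<lambda>i j. A $ i $ j) = A"
  using assms by (auto simp: vec_eq_iff)

text \<open>The matrices \<open>B\<close> are those of the transformation law, padded with the identity outside \<open>J\<close>.\<close>

definition monomial_rep ::
    "'n::finite set \<Rightarrow> ('n \<Rightarrow> complex^'n \<Rightarrow> complex) \<Rightarrow> ('n \<Rightarrow> nat) \<Rightarrow> (complex^'n \<Rightarrow> complex^'n^'n) \<Rightarrow> bool" where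
  "monomial_rep J g \<alpha> B \<longleftrightarrow> \<alpha> \<in> multi_indices J \<and> (\<forall>i j. hol0 (\<lambda>z. B z $ i $ j)) \<and>
     (\<forall>z i j. i \<notin> J \<or> j \<notin> J \<longrightarrow> B z $ i $ j = (if i = j then 1 else 0)) \<and>
     eventually (\<lambda>z. z \<in> coord_space J \<longrightarrow>
       (\<forall>i\<in>J. (\<Sum>j\<in>J. B z $ i $ j * g j z) = z $ i ^ Suc (\<alpha> i))) (nhds 0)"

lemma monomial_repD:
  assumes "monomial_rep J g \<alpha> B"
  shows "\<alpha> \<in> multi_indices J" and "hol0 (\<lambda>z. B z $ i $ j)"
    and "i \<notin> J \<or> j \<notin> J \<Longrightarrow> B z $ i $ j = (if i = j then 1 else 0)"
    and "eventually (\<lambda>z. z \<in> coord_space J \<longrightarrow>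
       (\<forall>i\<in>J. (\<Sum>j\<in>J. B z $ i $ j * g j z) = z $ i ^ Suc (\<alpha> i))) (nhds 0)"
  using assms unfolding monomial_rep_def by blast+

definition is_residue ::
    "'n::finite set \<Rightarrow> (complex^'n \<Rightarrow> complex) \<Rightarrow> ('n \<Rightarrow> complex^'n \<Rightarrow> complex) \<Rightarrow> complex \<Rightarrow> bool" where
  "is_residue J u g c \<longleftrightarrow>
     (\<exists>\<alpha> B. monomial_rep J g \<alpha> B \<and> c = taylor_coeff J (\<lambda>z. u z * det (B z)) \<alpha>)"

text \<open>A germ is holomorphic on all sufficiently small balls, so that finitely many germs have
  a radius in common.\<close>

lemma hol0_ball:
  assumes "\<And>i. i \<in> S \<Longrightarrow> hol0 (u i)" "finite S"
  shows "eventually (\<lambda>r. \<forall>i\<in>S. cn_holomorphic_on (u i) (ball 0 r)) (at_right 0)"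
proof (rule eventually_ball_finite[OF assms(2)], rule ballI)
  fix i assume "i \<in> S"
  then obtain V where V: "open V" "0 \<in> V" "cn_holomorphic_on (u i) V"
    using assms(1) unfolding hol0_def by blast
  then obtain e where e: "e > 0" "ball 0 e \<subseteq> V" using open_contains_ball by blast
  show "eventually (\<lambda>r. cn_holomorphic_on (u i) (ball 0 r)) (at_right 0)"
    unfolding eventually_at_right_field
  proof (intro exI[of _ e] conjI allI impI)
    fix r :: real assume "0 < r" "r < e"
    then show "cn_holomorphic_on (u i) (ball 0 r)"
      using e V by (intro cn_holomorphic_on_subset[OF V(3)]) auto
  qed (rule e)
qed

lemma grothendieck_residue_eq: "grothendieck_residue J u g = (THE c. is_residue J u g c)"
  unfolding grothendieck_residue_def
proof (rule arg_cong[where f=The], rule ext, rule iffI)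
  fix c
  assume "\<exists>r>0. \<exists>\<alpha>\<in>multi_indices J. \<exists>b.
     (\<forall>i\<in>J. \<forall>j\<in>J. cn_holomorphic_on (b i j) (ball 0 r)) \<and>
     (\<forall>z \<in> ball 0 r \<inter> coord_space J. \<forall>i\<in>J. z $ i ^ Suc (\<alpha> i) = (\<Sum>j\<in>J. b i j z * g j z)) \<and>
     c = taylor_coeff J (\<lambda>z. u z * minor_det J (\<lambda>i j. b i j z)) \<alpha>"
  then obtain r \<alpha> b where r: "r > 0" and \<alpha>: "\<alpha> \<in> multi_indices J"
    and b: "\<And>i j. i \<in> J \<Longrightarrow> j \<in> J \<Longrightarrow> cn_holomorphic_on (b i j) (ball 0 r)"
    and eq: "\<And>z i. z \<in> ball 0 r \<Longrightarrow> z \<in> coord_space J \<Longrightarrow> i \<in> J \<Longrightarrow>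
      z $ i ^ Suc (\<alpha> i) = (\<Sum>j\<in>J. b i j z * g j z)"
    and c: "c = taylor_coeff J (\<lambda>z. u z * minor_det J (\<lambda>i j. b i j z)) \<alpha>" by blast
  have hb: "hol0 (b i j)" if "i \<in> J" "j \<in> J" for i j
    using b[OF that] r unfolding hol0_def by (intro exI[of _ "ball 0 r"]) auto
  have "monomial_rep J g \<alpha> (\<lambda>z. pad J (\<lambda>i j. b i j z))"
    unfolding monomial_rep_def
  proof (intro conjI allI)
    fix i j show "hol0 (\<lambda>z. pad J (\<lambda>i j. b i j z) $ i $ j)"
      using hb by (cases "i \<in> J \<and> j \<in> J") auto
  next
    show "eventually (\<lambda>z. z \<in> coord_space J \<longrightarrow>
       (\<forall>i\<in>J. (\<Sum>j\<in>J. pad J (\<lambda>i j. b i j z) $ i $ j * g j z) = z $ i ^ Suc (\<alpha> i))) (nhds 0)"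
      unfolding eventually_nhds_shrink[symmetric] using r eq by (intro exI[of _ r]) auto
  qed (use \<alpha> in auto)
  with c show "is_residue J u g c" unfolding is_residue_def minor_det_eq by blast
next
  fix c assume "is_residue J u g c"
  then obtain \<alpha> B where B: "monomial_rep J g \<alpha> B" "c = taylor_coeff J (\<lambda>z. u z * det (B z)) \<alpha>"
    unfolding is_residue_def by blast
  have ev1: "eventually (\<lambda>r. \<forall>(i, j)\<in>UNIV. cn_holomorphic_on (\<lambda>z. B z $ i $ j) (ball 0 r)) (at_right 0)"
    using hol0_ball[of UNIV "\<lambda>(i, j) z. B z $ i $ j"] B(1)
    by (auto simp: monomial_rep_def case_prod_unfold)
  obtain e where e: "e > 0" "\<And>z. z \<in> ball 0 e \<Longrightarrow> z \<in> coord_space J \<Longrightarrow>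
       (\<forall>i\<in>J. (\<Sum>j\<in>J. B z $ i $ j * g j z) = z $ i ^ Suc (\<alpha> i))"
    using B(1) unfolding monomial_rep_def eventually_nhds_shrink[symmetric] by blast
  have "eventually (\<lambda>r. r \<in> {0<..<e}) (at_right 0)"
    using e(1) by (rule eventually_at_right_real)
  with ev1 have "eventually (\<lambda>r. (\<forall>(i, j)\<in>UNIV. cn_holomorphic_on (\<lambda>z. B z $ i $ j) (ball 0 r)) \<and> 0 < r \<and> r < e) (at_right 0)"
    by eventually_elim auto
  then obtain r where r: "0 < r" "r < e" "\<And>i j. cn_holomorphic_on (\<lambda>z. B z $ i $ j) (ball 0 r)"
    using eventually_happens[of _ "at_right (0::real)"] by force
  have "pad J (\<lambda>i j. B z $ i $ j) = B z" for z
    by (rule pad_self) (use B(1) in \<open>simp add: monomial_rep_def\<close>)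
  then have "c = taylor_coeff J (\<lambda>z. u z * minor_det J (\<lambda>i j. B z $ i $ j)) \<alpha>"
    by (simp add: minor_det_eq B(2))
  with r e B(1) show "\<exists>r>0. \<exists>\<alpha>\<in>multi_indices J. \<exists>b.
     (\<forall>i\<in>J. \<forall>j\<in>J. cn_holomorphic_on (b i j) (ball 0 r)) \<and>
     (\<forall>z \<in> ball 0 r \<inter> coord_space J. \<forall>i\<in>J. z $ i ^ Suc (\<alpha> i) = (\<Sum>j\<in>J. b i j z * g j z)) \<and>
     c = taylor_coeff J (\<lambda>z. u z * minor_det J (\<lambda>i j. b i j z)) \<alpha>"
    by (intro exI[of _ r] conjI bexI[of _ \<alpha>] exI[of _ "\<lambda>i j z. B z $ i $ j"])
      (auto simp: monomial_rep_def)
qed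

text \<open>The transformation law: if B expresses the powers by the \<open>g\<close>, then B M
  expresses the same powers by the \<open>g'\<close>, and multiplicativity of the determinant moves
  det M from the matrix into the numerator.\<close>

lemma is_residue_transform:
  assumes M: "\<And>i j. i \<in> J \<Longrightarrow> j \<in> J \<Longrightarrow> hol0 (M i j)"
    and ev: "eventually (\<lambda>z. z \<in> coord_space J \<longrightarrow> (\<forall>i\<in>J. g i z = (\<Sum>j\<in>J. M i j z * g' j z))) (nhds 0)"
    and res: "is_residue J (\<lambda>z. W z * minor_det J (\<lambda>i j. M i j z)) g c"
  shows "is_residue J W g' c"
proof -
  obtain \<alpha> B where B: "monomial_rep J g \<alpha> B"
    and c: "c = taylor_coeff J (\<lambda>z. (W z * minor_det J (\<lambda>i j. M i j z)) * det (B z)) \<alpha>"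
    using res unfolding is_residue_def by blast
  define B' where "B' z = B z ** pad J (\<lambda>i j. M i j z)" for z
  have out: "B z $ i $ j = (if i = j then 1 else 0)" if "i \<notin> J \<or> j \<notin> J" for z i j
    using B that unfolding monomial_rep_def by blast
  have B'J: "B' z $ i $ j = (\<Sum>k\<in>J. B z $ i $ k * M k j z)" if "i \<in> J" "j \<in> J" for z i j
    unfolding B'_def matrix_matrix_mult_def
    using that by (simp, intro sum.mono_neutral_cong_right) (auto simp: out)
  have "monomial_rep J g' \<alpha> B'"
    unfolding monomial_rep_def
  proof (intro conjI allI impI)
    fix i j
    have "hol0 (\<lambda>z. pad J (\<lambda>i j. M i j z) $ i $ j)" for i j
      using M by (cases "i \<in> J \<and> j \<in> J") auto
    then show "hol0 (\<lambda>z. B' z $ i $ j)"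
      unfolding B'_def matrix_matrix_mult_def vec_lambda_beta
      using B unfolding monomial_rep_def by (intro hol0_sum hol0_mult) auto
  next
    fix z i j assume ij: "i \<notin> J \<or> j \<notin> J"
    show "B' z $ i $ j = (if i = j then 1 else 0)"
    proof (cases "i \<in> J")
      case False
      then have "B' z $ i $ j = (\<Sum>k\<in>UNIV. if i = k then pad J (\<lambda>i j. M i j z) $ i $ j else 0)"
        unfolding B'_def matrix_matrix_mult_def vec_lambda_beta by (intro sum.cong) (auto simp: out)
      with False show ?thesis by simp
    next
      case True
      with ij have j: "j \<notin> J" by simp
      then have "B' z $ i $ j = (\<Sum>k\<in>UNIV. if k = j then B z $ i $ j else 0)"
        unfolding B'_def matrix_matrix_mult_def vec_lambda_beta by (intro sum.cong) auto
      with j show ?thesis by (simp add: out)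
    qed
  next
    show "eventually (\<lambda>z. z \<in> coord_space J \<longrightarrow>
        (\<forall>i\<in>J. (\<Sum>j\<in>J. B' z $ i $ j * g' j z) = z $ i ^ Suc (\<alpha> i))) (nhds 0)"
      using ev B[unfolded monomial_rep_def, THEN conjunct2, THEN conjunct2, THEN conjunct2]
    proof (eventually_elim, intro impI ballI)
      fix z i assume M: "z \<in> coord_space J \<longrightarrow> (\<forall>i\<in>J. g i z = (\<Sum>j\<in>J. M i j z * g' j z))"
        and Bz: "z \<in> coord_space J \<longrightarrow> (\<forall>i\<in>J. (\<Sum>j\<in>J. B z $ i $ j * g j z) = z $ i ^ Suc (\<alpha> i))"
        and z: "z \<in> coord_space J" and i: "i \<in> J"
      have "(\<Sum>j\<in>J. B' z $ i $ j * g' j z) = (\<Sum>j\<in>J. \<Sum>k\<in>J. B z $ i $ k * (M k j z * g' j z))"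
        using i by (intro sum.cong refl) (simp add: B'J sum_distrib_right mult.assoc)
      also have "\<dots> = (\<Sum>k\<in>J. B z $ i $ k * (\<Sum>j\<in>J. M k j z * g' j z))"
        by (subst sum.swap) (simp add: sum_distrib_left)
      also have "\<dots> = (\<Sum>k\<in>J. B z $ i $ k * g k z)"
        using M z by (intro sum.cong) auto
      finally show "(\<Sum>j\<in>J. B' z $ i $ j * g' j z) = z $ i ^ Suc (\<alpha> i)" using Bz z i by simp
    qed
  qed (use B in \<open>simp add: monomial_rep_def\<close>)
  moreover have "c = taylor_coeff J (\<lambda>z. W z * det (B' z)) \<alpha>"
    unfolding c B'_def by (simp add: det_mul minor_det_eq mult_ac)
  ultimately show ?thesis unfolding is_residue_def by blast
qed

text \<open>Every monomial of the \<open>i\<close>-th summand has an exponent of at least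
  \<open>a i\<close> in the variable \<open>i\<close>, which exceeds
  \<open>\<alpha> i\<close>.\<close>

lemma taylor_coeff_monomial_ideal:
  assumes \<alpha>: "\<alpha> \<in> multi_indices J" and S: "S \<subseteq> J" "\<And>i. i \<in> S \<Longrightarrow> \<alpha> i < a i"
    and X: "\<And>i. i \<in> S \<Longrightarrow> hol0 (X i)"
    and ev: "eventually (\<lambda>z. z \<in> coord_space J \<longrightarrow> F z = (\<Sum>i\<in>S. z $ i ^ a i * X i z)) (nhds 0)"
  shows "taylor_coeff J F \<alpha> = 0"
proof -
  have h: "hol0 (\<lambda>z. z $ i ^ a i * X i z)" if "i \<in> S" for i
    using X[OF that] by (intro hol0_mult hol0_power hol0_nth)
  have "taylor_coeff J F \<alpha> = taylor_coeff J (\<lambda>z. \<Sum>i\<in>S. z $ i ^ a i * X i z) \<alpha>"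
    by (rule taylor_coeff_cong[OF hol0_sum[OF h] \<alpha> ev])
  also have "\<dots> = (\<Sum>i\<in>S. taylor_coeff J (\<lambda>z. z $ i ^ a i * X i z) \<alpha>)"
    by (rule taylor_coeff_sum[OF h \<alpha>])
  also have "\<dots> = 0"
    using S by (intro sum.neutral ballI) (subst taylor_coeff_shift[OF X _ \<alpha>], auto simp: not_le[symmetric])
  finally show ?thesis .
qed

lemma matrix_vector_pad:
  assumes out: "\<And>i j. i \<notin> J \<or> j \<notin> J \<Longrightarrow> A $ i $ j = (if i = j then 1 else 0)"
  shows "((A :: complex^'n^'n::finite) *v (\<chi> j. if j \<in> J then g j else 0)) $ i =
    (if i \<in> J then \<Sum>j\<in>J. A $ i $ j * g j else 0)"
proof (cases "i \<in> J")
  case True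
  then show ?thesis
    unfolding matrix_vector_mult_def by (simp, intro sum.mono_neutral_cong_right) auto
next
  case False
  then show ?thesis
    unfolding matrix_vector_mult_def by (simp add: out sum.neutral)
qed

text \<open>By Cramer's rule \<open>det B\<close> maps the ideal of the \<open>g\<^sub>j\<close> into that of the powers \<open>z\<^sub>i ^ (\<alpha>\<^sub>i + 1)\<close>.\<close>

lemma det_mult_generator:
  fixes A :: "complex^'n^'n::finite"
  assumes out: "\<And>i j. i \<notin> J \<or> j \<notin> J \<Longrightarrow> A $ i $ j = (if i = j then 1 else 0)" and k: "k \<in> J"
  shows "det A * g k = (\<Sum>i\<in>J. (\<Sum>j\<in>J. A $ i $ j * g j) * cof A i k)"
proof -
  have "det A * g k = (\<Sum>i\<in>UNIV. (if i \<in> J then \<Sum>j\<in>J. A $ i $ j * g j else 0) * cof A i k)"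
    using det_mult_nth[of A "\<chi> j. if j \<in> J then g j else 0" k] k matrix_vector_pad[OF out, where g=g]
    by simp
  also have "\<dots> = (\<Sum>i\<in>J. (\<Sum>j\<in>J. A $ i $ j * g j) * cof A i k)"
    by (rule sum.mono_neutral_cong_right) auto
  finally show ?thesis .
qed

text \<open>The products of the two numerators with det B differ by an element of the ideal of the
  powers \<open>z $ i ^ Suc (\<alpha> i)\<close>, whose coefficient at \<alpha> is 0. The case
  \<open>e = 0\<close> allows a numerator to be replaced by any function that agrees with it near
  0.\<close>

lemma is_residue_congruent:
  assumes u: "hol0 u" and e: "\<And>j. j \<in> J \<Longrightarrow> hol0 (e j)"
    and ev: "eventually (\<lambda>z. z \<in> coord_space J \<longrightarrow> u' z = u z + (\<Sum>j\<in>J. e j z * g j z)) (nhds 0)"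
    and res: "is_residue J u g c"
  shows "is_residue J u' g c"
proof -
  obtain \<alpha> B where B: "monomial_rep J g \<alpha> B" and c: "c = taylor_coeff J (\<lambda>z. u z * det (B z)) \<alpha>"
    using res unfolding is_residue_def by blast
  note \<alpha> = monomial_repD(1)[OF B] and hB = monomial_repD(2)[OF B] and out = monomial_repD(3)[OF B]
    and evB = monomial_repD(4)[OF B]
  let ?X = "\<lambda>i z. \<Sum>j\<in>J. e j z * cof (B z) i j"
  let ?F = "\<lambda>z. \<Sum>i\<in>J. z $ i ^ Suc (\<alpha> i) * ?X i z"
  have hX: "hol0 (?X i)" for i using e hB by (intro hol0_sum hol0_mult hol0_cof) auto
  have hF: "hol0 ?F" by (intro hol0_sum hol0_mult[OF _ hX] hol0_power hol0_nth)
  have hD: "hol0 (\<lambda>z. u z * det (B z))" using u hB by (intro hol0_mult hol0_det_matrix)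
  have "taylor_coeff J (\<lambda>z. u' z * det (B z)) \<alpha> = taylor_coeff J (\<lambda>z. u z * det (B z) + ?F z) \<alpha>"
  proof (rule taylor_coeff_cong[OF hol0_add[OF hD hF] \<alpha>], use ev evB in \<open>eventually_elim, intro impI\<close>)
    fix z assume u': "z \<in> coord_space J \<longrightarrow> u' z = u z + (\<Sum>j\<in>J. e j z * g j z)"
      and Bz: "z \<in> coord_space J \<longrightarrow> (\<forall>i\<in>J. (\<Sum>j\<in>J. B z $ i $ j * g j z) = z $ i ^ Suc (\<alpha> i))"
      and z: "z \<in> coord_space J"
    have "(\<Sum>j\<in>J. e j z * g j z) * det (B z) = (\<Sum>j\<in>J. e j z * (det (B z) * g j z))"
      by (simp add: sum_distrib_left mult_ac)
    also have "\<dots> = (\<Sum>j\<in>J. \<Sum>i\<in>J. z $ i ^ Suc (\<alpha> i) * (e j z * cof (B z) i j))"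
    proof (rule sum.cong[OF refl])
      fix j assume "j \<in> J"
      then have "det (B z) * g j z = (\<Sum>i\<in>J. z $ i ^ Suc (\<alpha> i) * cof (B z) i j)"
        using det_mult_generator[of J "B z" j "\<lambda>j. g j z", OF out] Bz z by simp
      then show "e j z * (det (B z) * g j z) = (\<Sum>i\<in>J. z $ i ^ Suc (\<alpha> i) * (e j z * cof (B z) i j))"
        by (simp add: sum_distrib_left mult_ac)
    qed
    also have "\<dots> = ?F z" by (subst sum.swap) (simp add: sum_distrib_left)
    finally show "u' z * det (B z) = u z * det (B z) + ?F z"
      using u' z by (simp add: distrib_right)
  qed
  also have "\<dots> = c"
  proof -
    have "taylor_coeff J ?F \<alpha> = 0"
      by (rule taylor_coeff_monomial_ideal[where S=J and X="?X" and a="\<lambda>i. Suc (\<alpha> i)"])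
        (use \<alpha> hX in auto)
    then show ?thesis unfolding c taylor_coeff_add[OF hD hF \<alpha>] by simp
  qed
  finally show ?thesis using B unfolding is_residue_def by blast
qed

section \<open>Independence of the representation of the powers\<close>

lemma taylor_coeff_mult_monomial:
  assumes v: "hol0 v" and \<alpha>: "\<alpha> \<in> multi_indices J" and \<delta>: "\<delta> \<in> multi_indices J"
  shows "taylor_coeff J (\<lambda>z. cmonom z \<delta> * v z) (\<lambda>i. \<alpha> i + \<delta> i) = taylor_coeff J v \<alpha>"
proof -
  have "taylor_coeff J (\<lambda>z. (\<Prod>i\<in>K. z $ i ^ \<delta> i) * v z) (\<lambda>i. \<alpha> i + (if i \<in> K then \<delta> i else 0)) =
      taylor_coeff J v \<alpha>" if "K \<subseteq> J" for K
    using finite[of K] that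
  proof (induction K rule: finite_induct)
    case (insert k K)
    let ?\<gamma> = "\<lambda>K i. \<alpha> i + (if i \<in> K then \<delta> i else 0)"
    have "?\<gamma> (insert k K) \<in> multi_indices J" using \<alpha> \<delta> by (auto simp: multi_indices_def)
    moreover have "hol0 (\<lambda>z. (\<Prod>i\<in>K. z $ i ^ \<delta> i) * v z)"
      by (intro hol0_mult hol0_prod hol0_power hol0_nth v)
    moreover have "(?\<gamma> (insert k K))(k := ?\<gamma> (insert k K) k - \<delta> k) = ?\<gamma> K"
      using insert.hyps by auto
    ultimately have "taylor_coeff J (\<lambda>z. z $ k ^ \<delta> k * ((\<Prod>i\<in>K. z $ i ^ \<delta> i) * v z)) (?\<gamma> (insert k K)) =
        taylor_coeff J (\<lambda>z. (\<Prod>i\<in>K. z $ i ^ \<delta> i) * v z) (?\<gamma> K)"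
      using insert.prems by (subst taylor_coeff_shift) auto
    then show ?case using insert by (simp add: mult.assoc)
  qed simp
  from this[OF subset_refl] have "taylor_coeff J (\<lambda>z. (\<Prod>i\<in>J. z $ i ^ \<delta> i) * v z)
      (\<lambda>i. \<alpha> i + (if i \<in> J then \<delta> i else 0)) = taylor_coeff J v \<alpha>" .
  moreover have "(\<Prod>i\<in>J. z $ i ^ \<delta> i) = cmonom z \<delta>" for z
    by (rule prod.mono_neutral_left) (use \<delta> in \<open>auto simp: multi_indices_def\<close>)
  moreover have "(\<lambda>i. \<alpha> i + (if i \<in> J then \<delta> i else 0)) = (\<lambda>i. \<alpha> i + \<delta> i)"
    using \<delta> by (auto simp: multi_indices_def fun_eq_iff)
  ultimately show ?thesis by simp
qed

text \<open>Row \<open>i\<close> is multiplied by \<open>z $ i ^ \<delta> i\<close>. This raises the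
  exponents by \<delta> and multiplies the determinant by the monomial of exponent \<delta>, so that
  the coefficient is found again at the raised exponent.\<close>

lemma monomial_rep_raise:
  assumes B: "monomial_rep J g \<alpha> B" and \<delta>: "\<delta> \<in> multi_indices J" and u: "hol0 u"
  obtains B' where "monomial_rep J g (\<lambda>i. \<alpha> i + \<delta> i) B'"
    "taylor_coeff J (\<lambda>z. u z * det (B' z)) (\<lambda>i. \<alpha> i + \<delta> i) = taylor_coeff J (\<lambda>z. u z * det (B z)) \<alpha>"
proof -
  note \<alpha> = monomial_repD(1)[OF B] and hB = monomial_repD(2)[OF B] and out = monomial_repD(3)[OF B]
    and evB = monomial_repD(4)[OF B]
  define B' where "B' z = (\<chi> i. z $ i ^ \<delta> i *s B z $ i)" for z
  have "det (B' z) = cmonom z \<delta> * det (B z)" for z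
    unfolding B'_def det_rows_mul by (simp add: vec_lambda_eta)
  then have "(\<lambda>z. u z * det (B' z)) = (\<lambda>z. cmonom z \<delta> * (u z * det (B z)))" by (simp add: mult_ac)
  then have "taylor_coeff J (\<lambda>z. u z * det (B' z)) (\<lambda>i. \<alpha> i + \<delta> i) = taylor_coeff J (\<lambda>z. u z * det (B z)) \<alpha>"
    using taylor_coeff_mult_monomial[OF hol0_mult[OF u hol0_det_matrix[OF hB]] \<alpha> \<delta>] by simp
  moreover have "monomial_rep J g (\<lambda>i. \<alpha> i + \<delta> i) B'"
    unfolding monomial_rep_def
  proof (intro conjI allI impI)
    show "(\<lambda>i. \<alpha> i + \<delta> i) \<in> multi_indices J" using \<alpha> \<delta> by (simp add: multi_indices_def)
    show "hol0 (\<lambda>z. B' z $ i $ j)" for i j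
      unfolding B'_def by (simp, intro hol0_mult hol0_power hol0_nth hB)
    show "B' z $ i $ j = (if i = j then 1 else 0)" if "i \<notin> J \<or> j \<notin> J" for z i j
      using that \<delta> by (auto simp: B'_def out multi_indices_def)
    show "eventually (\<lambda>z. z \<in> coord_space J \<longrightarrow>
        (\<forall>i\<in>J. (\<Sum>j\<in>J. B' z $ i $ j * g j z) = z $ i ^ Suc (\<alpha> i + \<delta> i))) (nhds 0)"
      using evB by eventually_elim
        (auto simp: B'_def sum_distrib_left[symmetric] mult.assoc power_add)
  qed
  ultimately show ?thesis using that by blast
qed

text \<open>Exchanging one row at a time, the difference \<open>\<Delta>\<close> of the determinants satisfies
  \<open>\<Delta> z\<^sub>k ^ (\<gamma>\<^sub>k + 1) \<in> (z\<^sub>i ^ (\<gamma>\<^sub>i + 1), i \<noteq> k)\<close>, so its coefficients that matter vanish.\<close>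

lemma taylor_coeff_monomial_rep_unique:
  assumes u: "hol0 u" and B: "monomial_rep J g \<gamma> B" and B': "monomial_rep J g \<gamma> B'"
  shows "taylor_coeff J (\<lambda>z. u z * det (B z)) \<gamma> = taylor_coeff J (\<lambda>z. u z * det (B' z)) \<gamma>"
proof -
  note \<gamma> = monomial_repD(1)[OF B] and hB = monomial_repD(2)[OF B] and out = monomial_repD(3)[OF B]
    and evB = monomial_repD(4)[OF B]
  note hB' = monomial_repD(2)[OF B'] and out' = monomial_repD(3)[OF B'] and evB' = monomial_repD(4)[OF B']
  \<comment> \<open>The rows already exchanged, those in \<open>K\<close>, are from
    \<open>B'\<close> and the others from \<open>B\<close>.\<close>
  define R where "R K z = (\<chi> i. if i \<in> K then B' z $ i else B z $ i)" for K z
  have hR: "hol0 (\<lambda>z. R K z $ i $ j)" for K i j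
    by (cases "i \<in> K") (simp_all add: R_def hB hB')
  have "taylor_coeff J (\<lambda>z. u z * det (R K z)) \<gamma> = taylor_coeff J (\<lambda>z. u z * det (B z)) \<gamma>" for K
    using finite[of K]
  proof (induction K rule: finite_induct)
    case empty
    show ?case by (simp add: R_def vec_lambda_eta)
  next
    case (insert k K)
    \<comment> \<open>In row \<open>k\<close> stands the difference of two expressions of the same
      power, so that \<open>D\<close> applied to \<open>g\<close> vanishes in this row for
      \<open>k\<close> in \<open>J\<close>.\<close>
    define D where "D z = (\<chi> i. if i = k then B' z $ k - B z $ k else R K z $ i)" for z
    have hD: "hol0 (\<lambda>z. D z $ i $ j)" for i j
      by (cases "i = k") (auto simp: D_def hR intro: hB hB')
    have huD: "hol0 (\<lambda>z. u z * det (D z))" by (intro hol0_mult u hol0_det_matrix hD)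
    have "det (R (insert k K) z) = det (D z) + det (R K z)" for z
    proof -
      have "R (insert k K) z = (\<chi> i. if i = k then (B' z $ k - B z $ k) + B z $ k else R K z $ i)"
        by (auto simp: R_def vec_eq_iff)
      moreover have "(\<chi> i. if i = k then B z $ k else R K z $ i) = R K z"
        using insert.hyps by (auto simp: R_def vec_eq_iff)
      ultimately show ?thesis unfolding D_def by (simp only: det_row_add)
    qed
    then have "taylor_coeff J (\<lambda>z. u z * det (R (insert k K) z)) \<gamma> =
        taylor_coeff J (\<lambda>z. u z * det (D z)) \<gamma> + taylor_coeff J (\<lambda>z. u z * det (R K z)) \<gamma>"
      using taylor_coeff_add[OF huD hol0_mult[OF u hol0_det_matrix[OF hR]] \<gamma>] by (simp add: distrib_left)
    also have "taylor_coeff J (\<lambda>z. u z * det (D z)) \<gamma> = 0"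
    proof (cases "k \<in> J")
      case False
      then have "row k (D z) = 0" for z
        by (simp add: D_def row_def vec_eq_iff out out')
      then have "det (D z) = 0" for z by (rule det_zero_row(1))
      then show ?thesis by (simp add: taylor_coeff_zero[OF \<gamma>])
    next
      case True
      let ?X = "\<lambda>i z. u z * (\<Sum>j\<in>J. B z $ k $ j * cof (D z) i j)"
      have outD: "D z $ i $ j = (if i = j then 1 else 0)" if "i \<notin> J \<or> j \<notin> J" "i \<noteq> k" for z i j
        using that by (auto simp: D_def R_def out out')
      have outDk: "D z $ k $ j = 0" if "j \<notin> J" for z j
        using that by (simp add: D_def out out')
      have "taylor_coeff J (\<lambda>z. u z * det (D z)) \<gamma> =
          taylor_coeff J (\<lambda>z. z $ k ^ Suc (\<gamma> k) * (u z * det (D z))) (\<gamma>(k := \<gamma> k + Suc (\<gamma> k)))"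
        using \<gamma> True by (subst taylor_coeff_shift[OF huD True]) (auto simp: multi_indices_def)
      also have "\<dots> = 0"
      proof (rule taylor_coeff_monomial_ideal[where S="J - {k}" and a="\<lambda>i. Suc (\<gamma> i)" and X="?X"])
        show "\<gamma>(k := \<gamma> k + Suc (\<gamma> k)) \<in> multi_indices J" using \<gamma> True by (auto simp: multi_indices_def)
        show "hol0 (?X i)" for i using u hB hD by (intro hol0_mult hol0_sum hol0_cof)
        show "eventually (\<lambda>z. z \<in> coord_space J \<longrightarrow> z $ k ^ Suc (\<gamma> k) * (u z * det (D z)) =
            (\<Sum>i\<in>J - {k}. z $ i ^ Suc (\<gamma> i) * ?X i z)) (nhds 0)"
          using evB evB'
        proof (eventually_elim, intro impI)
          fix z assume "z \<in> coord_space J \<longrightarrow> (\<forall>i\<in>J. (\<Sum>j\<in>J. B z $ i $ j * g j z) = z $ i ^ Suc (\<gamma> i))"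
            and "z \<in> coord_space J \<longrightarrow> (\<forall>i\<in>J. (\<Sum>j\<in>J. B' z $ i $ j * g j z) = z $ i ^ Suc (\<gamma> i))"
            and "z \<in> coord_space J"
          then have Bz: "\<And>i. i \<in> J \<Longrightarrow> (\<Sum>j\<in>J. B z $ i $ j * g j z) = z $ i ^ Suc (\<gamma> i)"
            and B'z: "\<And>i. i \<in> J \<Longrightarrow> (\<Sum>j\<in>J. B' z $ i $ j * g j z) = z $ i ^ Suc (\<gamma> i)" by auto
          let ?G = "\<chi> j. if j \<in> J then g j z else 0"
          have DG: "(D z *v ?G) $ i = (if i \<in> J - {k} then z $ i ^ Suc (\<gamma> i) else 0)" for i
          proof -
            have "(D z *v ?G) $ i = (\<Sum>j\<in>J. D z $ i $ j * g j z)"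
              unfolding matrix_vector_mult_def by (simp, intro sum.mono_neutral_cong_right) auto
            also have "\<dots> = (if i \<in> J - {k} then z $ i ^ Suc (\<gamma> i) else 0)"
            proof (cases "i \<in> J - {k}")
              case True
              then show ?thesis using Bz B'z by (cases "i \<in> K") (auto simp: D_def R_def)
            next
              case False
              then consider "i = k" | "i \<notin> J" "i \<noteq> k" by auto
              then show ?thesis
              proof cases
                case 1
                then show ?thesis using Bz[OF True] B'z[OF True]
                  by (simp add: D_def left_diff_distrib sum_subtractf)
              next
                case 2
                then have "(\<Sum>j\<in>J. D z $ i $ j * g j z) = 0"
                  by (intro sum.neutral ballI) (auto simp: outD)
                with 2 show ?thesis by simp
              qed
            qed
            finally show ?thesis .
          qed
          have dg: "det (D z) * g j z = (\<Sum>i\<in>J - {k}. z $ i ^ Suc (\<gamma> i) * cof (D z) i j)" if "j \<in> J" for j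
          proof -
            have "det (D z) * g j z = (\<Sum>i\<in>UNIV. (if i \<in> J - {k} then z $ i ^ Suc (\<gamma> i) else 0) * cof (D z) i j)"
              using det_mult_nth[of "D z" ?G j] that unfolding DG by simp
            also have "\<dots> = (\<Sum>i\<in>J - {k}. z $ i ^ Suc (\<gamma> i) * cof (D z) i j)"
              by (rule sum.mono_neutral_cong_right) auto
            finally show ?thesis .
          qed
          \<comment> \<open>Row \<open>k\<close> of \<open>B\<close> expresses the power of
            \<open>z $ k\<close> by the generators. Multiplied by det D, each generator lies in the
            ideal of the other powers, since the \<open>k\<close>-th entry of \<open>D\<close>
            applied to \<open>g\<close> is 0.\<close>
          have "z $ k ^ Suc (\<gamma> k) * (u z * det (D z)) = (\<Sum>j\<in>J. u z * B z $ k $ j * (det (D z) * g j z))"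
            unfolding Bz[OF True, symmetric] by (simp add: sum_distrib_left sum_distrib_right mult_ac)
          also have "\<dots> = (\<Sum>j\<in>J. \<Sum>i\<in>J - {k}. z $ i ^ Suc (\<gamma> i) * (u z * (B z $ k $ j * cof (D z) i j)))"
            by (intro sum.cong refl, subst dg) (simp_all add: sum_distrib_left mult_ac)
          also have "\<dots> = (\<Sum>i\<in>J - {k}. z $ i ^ Suc (\<gamma> i) * ?X i z)"
            by (subst sum.swap) (simp add: sum_distrib_left)
          finally show "z $ k ^ Suc (\<gamma> k) * (u z * det (D z)) =
            (\<Sum>i\<in>J - {k}. z $ i ^ Suc (\<gamma> i) * ?X i z)" .
        qed
      qed auto
      finally show ?thesis .
    qed
    finally show ?case using insert.IH by simp
  qed
  from this[of UNIV] show ?thesis by (simp add: R_def vec_lambda_eta)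
qed

text \<open>Each representation is raised by the exponents of the other one. Both then have the
  exponents \<alpha> + \<alpha>' and can be exchanged row by row.\<close>

lemma is_residue_unique:
  assumes u: "hol0 u" and c: "is_residue J u g c" and c': "is_residue J u g c'"
  shows "c = c'"
proof -
  obtain \<alpha> B where B: "monomial_rep J g \<alpha> B" "c = taylor_coeff J (\<lambda>z. u z * det (B z)) \<alpha>"
    using c unfolding is_residue_def by blast
  obtain \<alpha>' B' where B': "monomial_rep J g \<alpha>' B'" "c' = taylor_coeff J (\<lambda>z. u z * det (B' z)) \<alpha>'"
    using c' unfolding is_residue_def by blast
  have \<alpha>: "\<alpha> \<in> multi_indices J" "\<alpha>' \<in> multi_indices J" using B B' by (auto simp: monomial_rep_def)
  obtain B1 where B1: "monomial_rep J g (\<lambda>i. \<alpha> i + \<alpha>' i) B1"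
    "taylor_coeff J (\<lambda>z. u z * det (B1 z)) (\<lambda>i. \<alpha> i + \<alpha>' i) = c"
    using monomial_rep_raise[OF B(1) \<alpha>(2) u] B(2) by metis
  obtain B2 where B2: "monomial_rep J g (\<lambda>i. \<alpha>' i + \<alpha> i) B2"
    "taylor_coeff J (\<lambda>z. u z * det (B2 z)) (\<lambda>i. \<alpha>' i + \<alpha> i) = c'"
    using monomial_rep_raise[OF B'(1) \<alpha>(1) u] B'(2) by metis
  show ?thesis
    using taylor_coeff_monomial_rep_unique[OF u B1(1), of B2] B1(2) B2 by (simp add: add.commute)
qed

section \<open>Determinants of block triangular matrices and change of the index type\<close>

lemma det_eq_sum_permutes:
  fixes A :: "'a::idom^'n^'n::finite"
  assumes A: "\<And>i k. i \<in> S \<Longrightarrow> k \<notin> S \<Longrightarrow> A $ i $ k = 0"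
    "\<And>k l. k \<notin> S \<Longrightarrow> l \<notin> S \<Longrightarrow> k \<noteq> l \<Longrightarrow> A $ k $ l = 0"
  shows "det A = (\<Sum>p | p permutes S. of_int (sign p) * (\<Prod>i\<in>UNIV. A $ i $ p i))"
  unfolding det_def
proof (rule sum.mono_neutral_right)
  show "{p. p permutes S} \<subseteq> {p. p permutes UNIV}" by (auto intro: permutes_subset)
  show "\<forall>p\<in>{p. p permutes UNIV} - {p. p permutes S}. of_int (sign p) * (\<Prod>i\<in>UNIV. A $ i $ p i) = 0"
  \<comment> \<open>A permutation with a nonzero product maps \<open>S\<close> into itself, hence
    onto itself by finiteness. It therefore preserves the complement, where the matrix is diagonal,
    and has to fix it pointwise.\<close>
  proof (rule ballI, rule ccontr)
    fix p assume p: "p \<in> {p. p permutes UNIV} - {p. p permutes S}"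
      and "of_int (sign p) * (\<Prod>i\<in>UNIV. A $ i $ p i) \<noteq> 0"
    then have nz: "A $ i $ p i \<noteq> 0" for i by auto
    have inj: "inj p" using p permutes_inj by blast
    have "p ` S \<subseteq> S" using A(1) nz by blast
    then have pS: "p ` S = S" by (rule endo_inj_surj[OF finite]) (use inj in \<open>auto intro: inj_on_subset\<close>)
    have "p k = k" if "k \<notin> S" for k
    proof -
      have "p k \<notin> S" using pS inj that by (metis (no_types, lifting) imageE inj_eq)
      then show ?thesis using A(2)[OF that] nz[of k] by metis
    qed
    with pS inj have "p permutes S"
      by (intro bij_imp_permutes bij_betw_imageI) (auto intro: inj_on_subset)
    with p show False by simp
  qed
qed simp

lemma det_pad: "det (pad S b) = (\<Sum>p | p permutes S. of_int (sign p) * (\<Prod>i\<in>S. b i (p i)))"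
proof -
  have "(\<Prod>i\<in>UNIV. pad S b $ i $ p i) = (\<Prod>i\<in>S. b i (p i))" if "p permutes S" for p
    using that by (intro prod.mono_neutral_cong_right) (auto simp: permutes_in_image permutes_not_in)
  then show ?thesis by (subst det_eq_sum_permutes[of S]) (auto intro!: sum.cong)
qed

lemma det_block_diagonal:
  fixes A :: "complex^'n^'n::finite"
  assumes "\<And>i k. i \<in> S \<Longrightarrow> k \<notin> S \<Longrightarrow> A $ i $ k = 0"
    "\<And>k l. k \<notin> S \<Longrightarrow> l \<notin> S \<Longrightarrow> k \<noteq> l \<Longrightarrow> A $ k $ l = 0"
  shows "det A = det (pad S (\<lambda>i j. A $ i $ j)) * (\<Prod>k\<in>- S. A $ k $ k)"
proof -
  have "(\<Prod>i\<in>UNIV. A $ i $ p i) = (\<Prod>i\<in>S. A $ i $ p i) * (\<Prod>k\<in>- S. A $ k $ k)" if "p permutes S" for p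
  proof -
    have "(\<Prod>i\<in>UNIV. A $ i $ p i) = (\<Prod>i\<in>S. A $ i $ p i) * (\<Prod>k\<in>- S. A $ k $ p k)"
      by (subst prod.union_disjoint[symmetric]) auto
    then show ?thesis using that by (simp add: permutes_not_in)
  qed
  then show ?thesis
    unfolding det_pad sum_distrib_right
    by (subst det_eq_sum_permutes[of S, OF assms]) (auto intro!: sum.cong)
qed

text \<open>The index types on the two sides may differ, so the comparison is made in the Leibniz
  formula: transport along \<iota> matches the permutations and preserves their signs.\<close>

lemma det_pad_image:
  assumes \<iota>: "inj_on \<iota> J" and b: "\<And>i j. i \<in> J \<Longrightarrow> j \<in> J \<Longrightarrow> b' (\<iota> i) (\<iota> j) = b i j"
  shows "det (pad (\<iota> ` J) b') = det (pad J b)"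
proof -
  have bij: "bij_betw \<iota> J (\<iota> ` J)" using \<iota> by (rule inj_on_imp_bij_betw)
  have "det (pad J b) = (\<Sum>p | p permutes J. of_int (sign p) * (\<Prod>i\<in>J. b i (p i)))" by (rule det_pad)
  also have "\<dots> = (\<Sum>q | q permutes \<iota> ` J. of_int (sign q) * (\<Prod>k\<in>\<iota> ` J. b' k (q k)))"
  proof (rule sum.reindex_bij_witness[where j="map_permutation J \<iota>" and i="map_permutation (\<iota> ` J) (inv_into J \<iota>)"])
    fix p assume "p \<in> {p. p permutes J}"
    then have p: "p permutes J" by simp
    show "map_permutation (\<iota> ` J) (inv_into J \<iota>) (map_permutation J \<iota> p) = p"
      by (rule map_permutation_compose_inv[OF bij p]) (simp add: \<iota>)
    show "map_permutation J \<iota> p \<in> {q. q permutes \<iota> ` J}"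
      using map_permutation_permutes[OF bij p] by simp
    show "of_int (sign (map_permutation J \<iota> p)) * (\<Prod>k\<in>\<iota> ` J. b' k (map_permutation J \<iota> p k)) =
        of_int (sign p) * (\<Prod>i\<in>J. b i (p i))"
      using p by (simp add: sign_map_permutation[OF \<iota> p] prod.reindex[OF \<iota>] map_permutation_apply[OF \<iota>]
          b permutes_in_image)
  next
    fix q assume "q \<in> {q. q permutes \<iota> ` J}"
    then have q: "q permutes \<iota> ` J" by simp
    show "map_permutation J \<iota> (map_permutation (\<iota> ` J) (inv_into J \<iota>) q) = q"
      by (rule map_permutation_compose_inv[OF bij_betw_inv_into[OF bij] q]) (rule f_inv_into_f)
    show "map_permutation (\<iota> ` J) (inv_into J \<iota>) q \<in> {p. p permutes J}"
      using map_permutation_permutes[OF bij_betw_inv_into[OF bij] q] by simp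
  qed
  also have "\<dots> = det (pad (\<iota> ` J) b')" by (rule det_pad[symmetric])
  finally show ?thesis ..
qed

section \<open>Hadamard's lemma\<close>

lemma hol_map0_pair:
  fixes p q :: "complex^'m::finite \<Rightarrow> complex^'n::finite"
  assumes "hol_map0 p" "hol_map0 q"
  shows "hol_map0 (\<lambda>w. \<chi> k. case k of Inl i \<Rightarrow> p w $ i | Inr i \<Rightarrow> q w $ i)"
  unfolding hol_map0_def
proof (intro conjI allI)
  fix k :: "'n + 'n"
  show "hol0 (\<lambda>w. (\<chi> k. case k of Inl i \<Rightarrow> p w $ i | Inr i \<Rightarrow> q w $ i) $ k)"
    using assms by (cases k) (auto simp: hol_map0_def)
qed (use assms in \<open>auto simp: hol_map0_def vec_eq_iff split: sum.splits\<close>)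

text \<open>The version on a ball, composed with the map w \<mapsto> (p w, q w).\<close>

lemma Hadamard:
  fixes p q :: "complex^'m::finite \<Rightarrow> complex^'n::finite"
  assumes u: "hol0 u" and p: "hol_map0 p" and q: "hol_map0 q"
  obtains e where "\<And>i. hol0 (e i)"
    "eventually (\<lambda>w. u (p w) = u (q w) + (\<Sum>i\<in>UNIV. e i w * (p w $ i - q w $ i))) (nhds 0)"
    "\<And>i w. p w = q w \<Longrightarrow> e i w = pd i u (p w)"
proof -
  obtain V where V: "open V" "0 \<in> V" "cn_holomorphic_on u V" using u unfolding hol0_def by blast
  then obtain r where r: "r > 0" "ball 0 r \<subseteq> V" using open_contains_ball by blast
  obtain e :: "'n \<Rightarrow> complex^('n + 'n) \<Rightarrow> complex" where
    e: "\<And>i. cn_holomorphic_on (e i) (ball 0 r)"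
      "\<And>w. w \<in> ball 0 r \<Longrightarrow> u (lpart w) - u (rpart w) = (\<Sum>i\<in>UNIV. e i w * (w $ Inl i - w $ Inr i))"
      "\<And>i w. lpart w = rpart w \<Longrightarrow> e i w = pd i u (lpart w)"
    using Hadamard_ball[OF cn_holomorphic_on_subset[OF V(3) r(2)]] by blast
  define pq where "pq w = (\<chi> k. case k of Inl i \<Rightarrow> p w $ i | Inr i \<Rightarrow> q w $ i)" for w
  have pq: "hol_map0 pq" unfolding pq_def using p q by (rule hol_map0_pair)
  have parts: "lpart (pq w) = p w" "rpart (pq w) = q w" for w by (simp_all add: vec_eq_iff pq_def)
  have "hol0 (e i)" for i
    unfolding hol0_def using e(1) r(1) by (intro exI[of _ "ball 0 r"]) auto
  then have "hol0 (\<lambda>w. e i (pq w))" for i using pq by (rule hol0_compose)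
  moreover have "eventually (\<lambda>w. pq w \<in> ball 0 r) (nhds 0)"
    by (rule hol_map0_eventually[OF pq eventually_nhds_in_open]) (use r in auto)
  then have "eventually (\<lambda>w. u (p w) = u (q w) + (\<Sum>i\<in>UNIV. e i (pq w) * (p w $ i - q w $ i))) (nhds 0)"
  proof eventually_elim
    case (elim w)
    from e(2)[OF this] show ?case unfolding parts by (simp add: pq_def algebra_simps)
  qed
  moreover have "e i (pq w) = pd i u (p w)" if "p w = q w" for i w
    using e(3)[of "pq w"] that by (simp add: parts)
  ultimately show ?thesis by (rule that)
qed

lemma hol_map0_id [simp, intro]: "hol_map0 (\<lambda>z. z)" and hol_map0_0 [simp, intro]: "hol_map0 (\<lambda>z. 0)"
  by (auto simp: hol_map0_def)

text \<open>A combination of the \<open>x i\<close> has a power in the ideal of the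
  \<open>x i ^ a i\<close>; the coefficients are made explicit because they have to be holomorphic
  germs. In the binomial expansion with exponent \<open>n = a k + N\<close> each term either has at
  least \<open>a k\<close> factors \<open>y\<close> or at least \<open>N\<close> factors
  \<open>s\<close>, where \<open>y\<close> is the new summand and \<open>s\<close> the sum of the
  old ones.\<close>

lemma sum_power_in_monomial_ideal:
  fixes h :: "'i \<Rightarrow> complex^'n::finite \<Rightarrow> complex"
  assumes "finite K" and x: "\<And>i. i \<in> K \<Longrightarrow> hol0 (x i)" and h: "\<And>i. i \<in> K \<Longrightarrow> hol0 (h i)"
  shows "\<exists>N e. (\<forall>i\<in>K. hol0 (e i)) \<and> (\<forall>z. (\<Sum>i\<in>K. x i z * h i z) ^ N = (\<Sum>i\<in>K. x i z ^ a i * e i z))"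
  using assms
proof (induction K rule: finite_induct)
  case empty
  \<comment> \<open>The exponent is 1 since the power of the empty sum has to be 0, whereas 0 ^ 0 =
    1.\<close>
  show ?case by (intro exI[of _ 1]) simp
next
  case (insert k K)
  have "\<exists>N e. (\<forall>i\<in>K. hol0 (e i)) \<and> (\<forall>z. (\<Sum>i\<in>K. x i z * h i z) ^ N = (\<Sum>i\<in>K. x i z ^ a i * e i z))"
    by (rule insert.IH) (simp_all add: insert.prems)
  then obtain N e where "(\<forall>i\<in>K. hol0 (e i)) \<and>
      (\<forall>z. (\<Sum>i\<in>K. x i z * h i z) ^ N = (\<Sum>i\<in>K. x i z ^ a i * e i z))" by (elim exE)
  then have e: "\<And>i. i \<in> K \<Longrightarrow> hol0 (e i)"
    "\<And>z. (\<Sum>i\<in>K. x i z * h i z) ^ N = (\<Sum>i\<in>K. x i z ^ a i * e i z)" by simp_all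
  define s where "s z = (\<Sum>i\<in>K. x i z * h i z)" for z
  define y where "y z = x k z * h k z" for z
  define n where "n = a k + N"
  define E where "E z = (\<Sum>j\<in>{a k..n}. of_nat (n choose j) * h k z ^ a k * y z ^ (j - a k) * s z ^ (n - j))" for z
  define F where "F z = (\<Sum>j<a k. of_nat (n choose j) * y z ^ j * s z ^ (n - j - N))" for z
  have hs: "hol0 s" unfolding s_def using insert.prems by (intro hol0_sum hol0_mult) auto
  have hy: "hol0 y" unfolding y_def using insert.prems by (intro hol0_mult) auto
  have hE: "hol0 E" unfolding E_def using insert.prems by (intro hol0_sum hol0_mult hol0_power hol0_const hs hy) auto
  have hF: "hol0 F" unfolding F_def by (intro hol0_sum hol0_mult hol0_power hol0_const hs hy)
  have "(y z + s z) ^ n = x k z ^ a k * E z + s z ^ N * F z" for z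
  proof -
    have "(y z + s z) ^ n = (\<Sum>j\<le>n. of_nat (n choose j) * y z ^ j * s z ^ (n - j))" by (rule binomial_ring)
    also have "{..n} = {a k..n} \<union> {..<a k}" by (auto simp: n_def)
    also have "(\<Sum>j\<in>{a k..n} \<union> {..<a k}. of_nat (n choose j) * y z ^ j * s z ^ (n - j)) =
      (\<Sum>j\<in>{a k..n}. of_nat (n choose j) * y z ^ j * s z ^ (n - j)) +
      (\<Sum>j<a k. of_nat (n choose j) * y z ^ j * s z ^ (n - j))"
      by (rule sum.union_disjoint) auto
    also have "(\<Sum>j\<in>{a k..n}. of_nat (n choose j) * y z ^ j * s z ^ (n - j)) = x k z ^ a k * E z"
      unfolding E_def sum_distrib_left
    proof (rule sum.cong[OF refl])
      fix j assume "j \<in> {a k..n}"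
      then have "y z ^ j = y z ^ a k * y z ^ (j - a k)" by (simp flip: power_add)
      also have "y z ^ a k = x k z ^ a k * h k z ^ a k" by (simp add: y_def power_mult_distrib)
      finally show "of_nat (n choose j) * y z ^ j * s z ^ (n - j) =
          x k z ^ a k * (of_nat (n choose j) * h k z ^ a k * y z ^ (j - a k) * s z ^ (n - j))"
        by (simp add: mult_ac)
    qed
    also have "(\<Sum>j<a k. of_nat (n choose j) * y z ^ j * s z ^ (n - j)) = s z ^ N * F z"
      unfolding F_def sum_distrib_left
    proof (rule sum.cong[OF refl])
      fix j assume "j \<in> {..<a k}"
      then have "n - j = N + (n - j - N)" by (simp add: n_def)
      then have "s z ^ (n - j) = s z ^ N * s z ^ (n - j - N)" by (metis power_add)
      then show "of_nat (n choose j) * y z ^ j * s z ^ (n - j) =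
          s z ^ N * (of_nat (n choose j) * y z ^ j * s z ^ (n - j - N))"
        by (simp add: mult_ac)
    qed
    finally show ?thesis .
  qed
  then have "(\<Sum>i\<in>insert k K. x i z * h i z) ^ n =
      (\<Sum>i\<in>insert k K. x i z ^ a i * (if i = k then E z else e i z * F z))" for z
  proof -
    have "(\<Sum>i\<in>K. x i z ^ a i * (if i = k then E z else e i z * F z)) = (\<Sum>i\<in>K. x i z ^ a i * e i z) * F z"
      unfolding sum_distrib_right using insert.hyps by (intro sum.cong) (auto simp: mult.assoc)
    moreover have "(\<Sum>i\<in>insert k K. x i z * h i z) = y z + s z"
      using insert.hyps by (simp add: y_def s_def)
    ultimately show ?thesis
      using insert.hyps \<open>(y z + s z) ^ n = x k z ^ a k * E z + s z ^ N * F z\<close> e(2)[of z]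
      by (simp add: s_def)
  qed
  moreover have "hol0 (\<lambda>z. if i = k then E z else e i z * F z)" if "i \<in> insert k K" for i
    using that hE hF e(1) by (cases "i = k") auto
  ultimately show ?case by (intro exI[of _ n] exI[of _ "\<lambda>i z. if i = k then E z else e i z * F z"]) auto
qed

text \<open>By Hadamard's lemma at the origin \<open>h\<close> is a combination of the coordinates,
  and on \<open>coord_space J\<close> only those in \<open>J\<close> remain. One additional factor
  \<open>h\<close> brings the exponent into the form \<open>Suc N\<close> that occurs in
  \<open>monomial_rep\<close>.\<close>

lemma power_in_monomial_ideal:
  fixes h :: "complex^'n::finite \<Rightarrow> complex"
  assumes h: "hol0 h" "h 0 = 0"
  obtains N e where "\<And>i. hol0 (e i)"
    "eventually (\<lambda>z. z \<in> coord_space J \<longrightarrow> h z ^ Suc N = (\<Sum>i\<in>J. z $ i ^ a i * e i z)) (nhds 0)"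
proof -
  obtain e where e: "\<And>i. hol0 (e i)"
    "eventually (\<lambda>w. h w = h 0 + (\<Sum>i\<in>UNIV. e i w * (w $ i - 0 $ i))) (nhds 0)"
    "\<And>i w. w = 0 \<Longrightarrow> e i w = pd i h w"
    by (rule Hadamard[OF h(1) hol_map0_id hol_map0_0], rule that)
  obtain N E where "(\<forall>i\<in>J. hol0 (E i)) \<and>
      (\<forall>z. (\<Sum>i\<in>J. z $ i * e i z) ^ N = (\<Sum>i\<in>J. z $ i ^ a i * E i z))"
    using sum_power_in_monomial_ideal[of J "\<lambda>i z. z $ i" e a, OF finite hol0_nth e(1)] by (elim exE)
  then have E: "\<And>i. i \<in> J \<Longrightarrow> hol0 (E i)"
    "\<And>z. (\<Sum>i\<in>J. z $ i * e i z) ^ N = (\<Sum>i\<in>J. z $ i ^ a i * E i z)" by simp_all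
  show ?thesis
  proof (rule that[of "\<lambda>i z. if i \<in> J then E i z * h z else 0" N])
    show "hol0 (\<lambda>z. if i \<in> J then E i z * h z else 0)" for i
      using E(1) h(1) by (cases "i \<in> J") auto
    show "eventually (\<lambda>z. z \<in> coord_space J \<longrightarrow>
        h z ^ Suc N = (\<Sum>i\<in>J. z $ i ^ a i * (if i \<in> J then E i z * h z else 0))) (nhds 0)"
      using e(2)
    proof (eventually_elim, intro impI)
      fix z assume hz: "h z = h 0 + (\<Sum>i\<in>UNIV. e i z * (z $ i - 0 $ i))" and z: "z \<in> coord_space J"
      have "(\<Sum>i\<in>UNIV. e i z * z $ i) = (\<Sum>i\<in>J. z $ i * e i z)"
        using z by (intro sum.mono_neutral_cong_right) (auto simp: coord_space_def)
      with hz h(2) have "h z ^ N = (\<Sum>i\<in>J. z $ i ^ a i * E i z)" by (simp add: E(2))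
      then show "h z ^ Suc N = (\<Sum>i\<in>J. z $ i ^ a i * (if i \<in> J then E i z * h z else 0))"
        by (simp add: sum_distrib_left mult_ac)
    qed
  qed
qed

section \<open>Elimination of variables\<close>

text \<open>Some \<open>\<phi>\<^sub>k ^ (\<beta> + 1)\<close> lies in the ideal of the \<open>g\<^sub>i\<close>, and \<open>w\<^sub>k - \<phi>\<^sub>k\<close> divides
  \<open>w\<^sub>k ^ (\<beta> + 1) - \<phi>\<^sub>k ^ (\<beta> + 1)\<close>. Only the leading term \<open>w\<^sub>k ^ \<beta>\<close> of the quotient contributes to the
  coefficient that is the residue.\<close>

lemma is_residue_graph:
  fixes \<iota> :: "'n::finite \<Rightarrow> 'm::finite"
  assumes \<iota>: "inj_on \<iota> J" and u: "hol0 u"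
    and \<phi>: "\<And>k. hol0 (\<phi> k)" "\<And>k. \<phi> k 0 = 0"
    and G: "eventually (\<lambda>w. (\<forall>i\<in>J. G (\<iota> i) w = g i (pull J \<iota> w)) \<and>
      (\<forall>k\<in>- \<iota> ` J. G k w = w $ k - \<phi> k (pull J \<iota> w))) (nhds 0)"
    and res: "is_residue J u g c"
  shows "is_residue UNIV (\<lambda>w. u (pull J \<iota> w)) G c"
proof -
  let ?\<pi> = "pull J \<iota>"
  obtain \<alpha> B where B: "monomial_rep J g \<alpha> B" and c: "c = taylor_coeff J (\<lambda>z. u z * det (B z)) \<alpha>"
    using res unfolding is_residue_def by blast
  note \<alpha> = monomial_repD(1)[OF B] and hB = monomial_repD(2)[OF B] and out = monomial_repD(3)[OF B]
    and evB = monomial_repD(4)[OF B]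
  let ?Q = "\<lambda>k N e. (\<forall>i. hol0 (e i)) \<and> eventually (\<lambda>z. z \<in> coord_space J \<longrightarrow>
      \<phi> k z ^ Suc N = (\<Sum>i\<in>J. z $ i ^ Suc (\<alpha> i) * e i z)) (nhds 0)"
  have "\<forall>k. \<exists>N e. ?Q k N e"
  proof
    fix k
    obtain N e where "\<And>i. hol0 (e i)"
      "eventually (\<lambda>z. z \<in> coord_space J \<longrightarrow> \<phi> k z ^ Suc N = (\<Sum>i\<in>J. z $ i ^ Suc (\<alpha> i) * e i z)) (nhds 0)"
      by (rule power_in_monomial_ideal[OF \<phi>(1)[of k] \<phi>(2)[of k],
            where a="\<lambda>i. Suc (\<alpha> i)" and J=J], rule that)
    then show "\<exists>N e. ?Q k N e" by (intro exI conjI allI)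
  qed
  then have "\<exists>\<beta>. \<forall>k. \<exists>e. ?Q k (\<beta> k) e" by (rule choice)
  then obtain \<beta> where "\<forall>k. \<exists>e. ?Q k (\<beta> k) e" ..
  then have "\<exists>e. \<forall>k. ?Q k (\<beta> k) (e k)" by (rule choice)
  then obtain e where e0: "\<forall>k. ?Q k (\<beta> k) (e k)" ..
  note e = e0[THEN spec, THEN conjunct1, THEN spec] e0[THEN spec, THEN conjunct2]
  define \<kappa> where "\<kappa> = inv_into J \<iota>"
  have \<kappa>: "\<kappa> (\<iota> i) = i" if "i \<in> J" for i using \<iota> that by (simp add: \<kappa>_def)
  define P where "P k w = (\<Sum>p<Suc (\<beta> k). w $ k ^ p * \<phi> k (?\<pi> w) ^ (\<beta> k - p))" for k w
  \<comment> \<open>In a row \<open>k\<close> outside the image of \<iota>, the first block produces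
    \<open>\<phi> k ^ Suc (\<beta> k)\<close> from the generators of the smaller system, and the
    diagonal entry \<open>P k\<close> contributes the difference of this power and
    \<open>w $ k ^ Suc (\<beta> k)\<close>. The matrix is block triangular with determinant det B
    times the product of the \<open>P k\<close>.\<close>
  define C where "C w = (\<chi> k l. if k \<in> \<iota> ` J
      then if l \<in> \<iota> ` J then B (?\<pi> w) $ \<kappa> k $ \<kappa> l else 0
      else if l \<in> \<iota> ` J then \<Sum>i\<in>J. e k i (?\<pi> w) * B (?\<pi> w) $ i $ \<kappa> l else if k = l then P k w else 0)" for w
  \<comment> \<open>The set \<open>K\<close> contains the additional variables whose factors
    \<open>P k\<close> are still present in the product. It shrinks from all additional variables to
    the empty set as these factors are removed one by one.\<close>
  define \<gamma> where "\<gamma> K k = (if k \<in> \<iota> ` J then \<alpha> (\<kappa> k) else if k \<in> K then \<beta> k else 0)" for K k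
  have hP: "hol0 (P k)" for k
    unfolding P_def by (intro hol0_sum hol0_mult hol0_power hol0_nth hol0_compose[OF \<phi>(1)] hol_map0_pull)
  have hC: "hol0 (\<lambda>w. C w $ k $ l)" for k l
  proof -
    have "hol0 (\<lambda>w. B (?\<pi> w) $ i $ j)" for i j
      by (rule hol0_compose[OF hB hol_map0_pull])
    moreover have "hol0 (\<lambda>w. e k i (?\<pi> w))" for i
      by (rule hol0_compose[OF e(1) hol_map0_pull])
    moreover from calculation have "hol0 (\<lambda>w. \<Sum>i\<in>J. e k i (?\<pi> w) * B (?\<pi> w) $ i $ \<kappa> l)"
      by (intro hol0_sum hol0_mult)
    ultimately show ?thesis
      by (cases "k \<in> \<iota> ` J"; cases "l \<in> \<iota> ` J"; cases "k = l") (simp_all add: C_def hP)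
  qed
  have sumJ: "(\<Sum>l\<in>UNIV. y l) = (\<Sum>j\<in>J. y (\<iota> j)) + (\<Sum>l\<in>- \<iota> ` J. y l)" for y :: "'m \<Rightarrow> complex"
  proof -
    have "(\<Sum>l\<in>UNIV. y l) = (\<Sum>l\<in>\<iota> ` J. y l) + (\<Sum>l\<in>- \<iota> ` J. y l)"
      by (subst sum.union_disjoint[symmetric]) auto
    then show ?thesis by (simp add: sum.reindex[OF \<iota>])
  qed
  have "monomial_rep UNIV G (\<gamma> UNIV) C"
    unfolding monomial_rep_def
  proof (intro conjI allI)
    have "eventually (\<lambda>w. \<forall>k. ?\<pi> w \<in> coord_space J \<longrightarrow>
      \<phi> k (?\<pi> w) ^ Suc (\<beta> k) = (\<Sum>i\<in>J. ?\<pi> w $ i ^ Suc (\<alpha> i) * e k i (?\<pi> w))) (nhds 0)"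
      by (rule eventually_all_finite) (rule hol_map0_eventually[OF hol_map0_pull e(2)])
    moreover have "eventually (\<lambda>w. ?\<pi> w \<in> coord_space J \<longrightarrow>
       (\<forall>i\<in>J. (\<Sum>j\<in>J. B (?\<pi> w) $ i $ j * g j (?\<pi> w)) = ?\<pi> w $ i ^ Suc (\<alpha> i))) (nhds 0)"
      by (rule hol_map0_eventually[OF hol_map0_pull evB])
    ultimately show "eventually (\<lambda>w. w \<in> coord_space UNIV \<longrightarrow>
        (\<forall>k\<in>UNIV. (\<Sum>l\<in>UNIV. C w $ k $ l * G l w) = w $ k ^ Suc (\<gamma> UNIV k))) (nhds 0)"
      using G
    proof (eventually_elim, intro impI ballI)
      fix w k
      assume \<phi>w: "\<forall>k. ?\<pi> w \<in> coord_space J \<longrightarrow>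
          \<phi> k (?\<pi> w) ^ Suc (\<beta> k) = (\<Sum>i\<in>J. ?\<pi> w $ i ^ Suc (\<alpha> i) * e k i (?\<pi> w))"
        and Bw: "?\<pi> w \<in> coord_space J \<longrightarrow>
          (\<forall>i\<in>J. (\<Sum>j\<in>J. B (?\<pi> w) $ i $ j * g j (?\<pi> w)) = ?\<pi> w $ i ^ Suc (\<alpha> i))"
        and Gw: "(\<forall>i\<in>J. G (\<iota> i) w = g i (?\<pi> w)) \<and> (\<forall>k\<in>- \<iota> ` J. G k w = w $ k - \<phi> k (?\<pi> w))"
      have Bw': "(\<Sum>j\<in>J. B (?\<pi> w) $ i $ j * G (\<iota> j) w) = ?\<pi> w $ i ^ Suc (\<alpha> i)" if "i \<in> J" for i
        using Bw Gw that by simp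
      show "(\<Sum>l\<in>UNIV. C w $ k $ l * G l w) = w $ k ^ Suc (\<gamma> UNIV k)"
      proof (cases "k \<in> \<iota> ` J")
        case True
        then obtain i where i: "i \<in> J" "k = \<iota> i" by blast
        have "(\<Sum>l\<in>UNIV. C w $ k $ l * G l w) = (\<Sum>j\<in>J. B (?\<pi> w) $ i $ j * G (\<iota> j) w)"
          unfolding sumJ using i by (simp add: C_def \<kappa>)
        then show ?thesis using Bw'[OF i(1)] i by (simp add: \<gamma>_def \<kappa>)
      next
        case False
        have "(\<Sum>j\<in>J. C w $ k $ \<iota> j * G (\<iota> j) w) =
            (\<Sum>j\<in>J. \<Sum>i\<in>J. e k i (?\<pi> w) * (B (?\<pi> w) $ i $ j * G (\<iota> j) w))"
          using False by (intro sum.cong refl) (simp add: C_def \<kappa> sum_distrib_right mult.assoc)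
        also have "\<dots> = (\<Sum>i\<in>J. e k i (?\<pi> w) * (\<Sum>j\<in>J. B (?\<pi> w) $ i $ j * G (\<iota> j) w))"
          by (subst sum.swap) (simp add: sum_distrib_left)
        also have "\<dots> = (\<Sum>i\<in>J. e k i (?\<pi> w) * ?\<pi> w $ i ^ Suc (\<alpha> i))"
          by (intro sum.cong refl arg_cong2[where f="(*)"] Bw')
        also have "\<dots> = \<phi> k (?\<pi> w) ^ Suc (\<beta> k)"
          using \<phi>w by (simp add: mult.commute)
        finally have 1: "(\<Sum>j\<in>J. C w $ k $ \<iota> j * G (\<iota> j) w) = \<phi> k (?\<pi> w) ^ Suc (\<beta> k)" .
        have "(\<Sum>l\<in>- \<iota> ` J. C w $ k $ l * G l w) = (\<Sum>l\<in>- \<iota> ` J. if k = l then P k w * G k w else 0)"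
          using False by (intro sum.cong) (auto simp: C_def)
        also have "\<dots> = P k w * (w $ k - \<phi> k (?\<pi> w))"
          using False Gw by simp
        also have "\<dots> = w $ k ^ Suc (\<beta> k) - \<phi> k (?\<pi> w) ^ Suc (\<beta> k)"
          unfolding diff_power_eq_sum P_def by (simp add: mult.commute)
        finally show ?thesis unfolding sumJ 1 using False by (simp add: \<gamma>_def)
      qed
    qed
  qed (auto simp: hC multi_indices_def)
  moreover have "c = taylor_coeff UNIV (\<lambda>w. u (?\<pi> w) * det (C w)) (\<gamma> UNIV)"
  proof -
    define F where "F z = u z * det (B z)" for z
    have hF: "hol0 F" unfolding F_def by (intro hol0_mult u hol0_det_matrix hB)
    have det: "det (C w) = det (B (?\<pi> w)) * (\<Prod>k\<in>- \<iota> ` J. P k w)" for w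
    proof -
      have "det (C w) = det (pad (\<iota> ` J) (\<lambda>k l. C w $ k $ l)) * (\<Prod>k\<in>- \<iota> ` J. C w $ k $ k)"
        by (rule det_block_diagonal) (auto simp: C_def)
      also have "det (pad (\<iota> ` J) (\<lambda>k l. C w $ k $ l)) = det (pad J (\<lambda>i j. B (?\<pi> w) $ i $ j))"
        by (rule det_pad_image[OF \<iota>]) (simp add: C_def \<kappa>)
      also have "pad J (\<lambda>i j. B (?\<pi> w) $ i $ j) = B (?\<pi> w)"
        by (rule pad_self[OF out])
      also have "(\<Prod>k\<in>- \<iota> ` J. C w $ k $ k) = (\<Prod>k\<in>- \<iota> ` J. P k w)"
        by (rule prod.cong) (auto simp: C_def)
      finally show ?thesis .
    qed
    have hH: "hol0 (\<lambda>w. F (?\<pi> w) * (\<Prod>k\<in>K. P k w))" for K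
      by (intro hol0_mult hol0_compose[OF hF] hol_map0_pull hol0_prod hP)
    have "taylor_coeff UNIV (\<lambda>w. F (?\<pi> w) * (\<Prod>k\<in>K. P k w)) (\<gamma> K) =
        taylor_coeff UNIV (\<lambda>w. F (?\<pi> w)) (\<gamma> {})" if "K \<subseteq> - \<iota> ` J" for K
      using finite[of K] that
    proof (induction K rule: finite_induct)
      case (insert k K)
      define H where "H w = F (?\<pi> w) * (\<Prod>k\<in>K. P k w)" for w
      have hH': "hol0 H" unfolding H_def by (rule hH)
      have k: "k \<notin> \<iota> ` J" using insert.prems by auto
      let ?Q = "\<lambda>p w. \<phi> k (?\<pi> w) ^ (\<beta> k - p) * H w"
      have hQ: "hol0 (?Q p)" for p
        by (intro hol0_mult hol0_power hol0_compose[OF \<phi>(1)] hol_map0_pull hH')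
      have uni: "\<delta> \<in> multi_indices UNIV" for \<delta> :: "'m \<Rightarrow> nat" by (simp add: multi_indices_def)
      have \<pi>k: "?\<pi> (upd w k 0) = ?\<pi> w" for w
        using k by (auto simp: vec_eq_iff)
      have "P k' (upd w k 0) = P k' w" if "k' \<in> K" for k' w
        using that insert.hyps(2) by (auto simp: P_def \<pi>k)
      then have Hk: "H (upd w k 0) = H w" for w
        unfolding H_def \<pi>k by simp
      have "(\<lambda>w. F (?\<pi> w) * (\<Prod>k\<in>insert k K. P k w)) = (\<lambda>w. \<Sum>p<Suc (\<beta> k). w $ k ^ p * ?Q p w)"
        using insert.hyps by (simp add: H_def P_def sum_distrib_left sum_distrib_right mult_ac del: sum.lessThan_Suc)
      then have "taylor_coeff UNIV (\<lambda>w. F (?\<pi> w) * (\<Prod>k\<in>insert k K. P k w)) (\<gamma> (insert k K)) =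
          (\<Sum>p<Suc (\<beta> k). taylor_coeff UNIV (\<lambda>w. w $ k ^ p * ?Q p w) (\<gamma> (insert k K)))"
        by (simp only:) (intro taylor_coeff_sum uni hol0_mult hol0_power hol0_nth hQ)
      \<comment> \<open>The variable \<open>w $ k\<close> occurs only in the explicit power
        \<open>w $ k ^ p\<close>, so that the exponent \<open>\<beta> k\<close> selects the summand
        p = \<open>\<beta> k\<close>. There the power of \<open>\<phi> k\<close> has exponent 0 and
        equals 1.\<close>
      also have "\<dots> = (\<Sum>p<Suc (\<beta> k). if p = \<beta> k then taylor_coeff UNIV H (\<gamma> K) else 0)"
      proof (rule sum.cong[OF refl])
        fix p assume p: "p \<in> {..<Suc (\<beta> k)}"
        have "\<gamma> (insert k K) k = \<beta> k" using k by (simp add: \<gamma>_def)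
        then have "taylor_coeff UNIV (\<lambda>w. w $ k ^ p * ?Q p w) (\<gamma> (insert k K)) =
            taylor_coeff UNIV (?Q p) ((\<gamma> (insert k K))(k := \<beta> k - p))"
          using p by (subst taylor_coeff_shift[OF hQ UNIV_I uni]) auto
        also have "\<dots> = (if p = \<beta> k then taylor_coeff UNIV H (\<gamma> K) else 0)"
        proof (cases "p = \<beta> k")
          case True
          have "(\<gamma> (insert k K))(k := 0) = \<gamma> K"
            using k insert.hyps by (auto simp: \<gamma>_def fun_eq_iff)
          with True show ?thesis by simp
        next
          case False
          with p show ?thesis
            by (simp, intro taylor_coeff_independent[OF hQ uni, where i=k]) (auto simp: \<pi>k Hk)
        qed
        finally show "taylor_coeff UNIV (\<lambda>w. w $ k ^ p * ?Q p w) (\<gamma> (insert k K)) =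
          (if p = \<beta> k then taylor_coeff UNIV H (\<gamma> K) else 0)" .
      qed
      also have "\<dots> = taylor_coeff UNIV H (\<gamma> K)" by simp
      also have "H = (\<lambda>w. F (?\<pi> w) * (\<Prod>k\<in>K. P k w))" by (rule ext) (rule H_def)
      also have "taylor_coeff UNIV \<dots> (\<gamma> K) = taylor_coeff UNIV (\<lambda>w. F (?\<pi> w)) (\<gamma> {})"
        using insert.prems by (intro insert.IH) simp
      finally show ?case .
    qed simp
    from this[OF subset_refl] have "taylor_coeff UNIV (\<lambda>w. u (?\<pi> w) * det (C w)) (\<gamma> (- \<iota> ` J)) =
        taylor_coeff UNIV (\<lambda>w. F (?\<pi> w)) (\<gamma> {})"
      by (simp add: det F_def mult.assoc)
    also have "\<gamma> (- \<iota> ` J) = \<gamma> UNIV" by (auto simp: \<gamma>_def fun_eq_iff)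
    also have "taylor_coeff UNIV (\<lambda>w. F (?\<pi> w)) (\<gamma> {}) =
        taylor_coeff J F (\<lambda>i. if i \<in> J then \<gamma> {} (\<iota> i) else 0)"
      by (rule taylor_coeff_pull[OF hF \<iota>]) (auto simp: \<gamma>_def multi_indices_def)
    also have "(\<lambda>i. if i \<in> J then \<gamma> {} (\<iota> i) else 0) = \<alpha>"
      using \<alpha> by (auto simp: \<gamma>_def \<kappa> multi_indices_def fun_eq_iff)
    finally show ?thesis by (simp add: c F_def)
  qed
  ultimately show ?thesis unfolding is_residue_def by blast
qed

lemma hol_map0_eq_0: "hol_map0 p \<Longrightarrow> p 0 = 0"
  by (simp add: hol_map0_def)

text \<open>Substituting \<sigma>, along which the generators outside the image of \<kappa> vanish,
  leaves a representation of the powers by the \<open>g\<close>. It shows that a value exists for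
  every numerator \<open>v\<close> but not which one; the value is identified later by
  uniqueness.\<close>

lemma is_residue_restrict_exists:
  fixes \<sigma> :: "complex^'n::finite \<Rightarrow> complex^'m::finite" and \<kappa> :: "'n \<Rightarrow> 'm"
  assumes \<sigma>: "hol_map0 \<sigma>" and \<kappa>: "inj_on \<kappa> J"
    and G: "eventually (\<lambda>y. y \<in> coord_space J \<longrightarrow> (\<forall>l\<in>J. G (\<kappa> l) (\<sigma> y) = g l y \<and> \<sigma> y $ \<kappa> l = y $ l) \<and>
      (\<forall>k\<in>- \<kappa> ` J. G k (\<sigma> y) = 0)) (nhds 0)"
    and res: "is_residue UNIV u G c"
  obtains c' where "is_residue J v g c'"
proof -
  obtain \<alpha> B where B: "monomial_rep UNIV G \<alpha> B" using res unfolding is_residue_def by blast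
  have hB: "\<And>i j. hol0 (\<lambda>z. B z $ i $ j)"
    and evB: "eventually (\<lambda>z. \<forall>k. (\<Sum>l\<in>UNIV. B z $ k $ l * G l z) = z $ k ^ Suc (\<alpha> k)) (nhds 0)"
    using B unfolding monomial_rep_def by (auto simp: coord_space_def)
  have "monomial_rep J g (\<lambda>i. if i \<in> J then \<alpha> (\<kappa> i) else 0)
      (\<lambda>y. pad J (\<lambda>i j. B (\<sigma> y) $ \<kappa> i $ \<kappa> j))"
    unfolding monomial_rep_def
  proof (intro conjI allI)
    fix i j show "hol0 (\<lambda>y. pad J (\<lambda>i j. B (\<sigma> y) $ \<kappa> i $ \<kappa> j) $ i $ j)"
      using hol0_compose[OF hB \<sigma>] by (cases "i \<in> J \<and> j \<in> J") auto
  next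
    have "eventually (\<lambda>y. \<forall>k. (\<Sum>l\<in>UNIV. B (\<sigma> y) $ k $ l * G l (\<sigma> y)) = \<sigma> y $ k ^ Suc (\<alpha> k)) (nhds 0)"
      by (rule hol_map0_eventually[OF \<sigma> evB])
    then show "eventually (\<lambda>y. y \<in> coord_space J \<longrightarrow>
        (\<forall>i\<in>J. (\<Sum>j\<in>J. pad J (\<lambda>i j. B (\<sigma> y) $ \<kappa> i $ \<kappa> j) $ i $ j * g j y) =
          y $ i ^ Suc (if i \<in> J then \<alpha> (\<kappa> i) else 0))) (nhds 0)"
      using G
    proof (eventually_elim, intro impI ballI)
      fix y i
      assume By: "\<forall>k. (\<Sum>l\<in>UNIV. B (\<sigma> y) $ k $ l * G l (\<sigma> y)) = \<sigma> y $ k ^ Suc (\<alpha> k)"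
        and "y \<in> coord_space J \<longrightarrow> (\<forall>l\<in>J. G (\<kappa> l) (\<sigma> y) = g l y \<and> \<sigma> y $ \<kappa> l = y $ l) \<and>
          (\<forall>k\<in>- \<kappa> ` J. G k (\<sigma> y) = 0)" "y \<in> coord_space J" and i: "i \<in> J"
      then have Gy: "\<And>l. l \<in> J \<Longrightarrow> G (\<kappa> l) (\<sigma> y) = g l y" "\<And>l. l \<in> J \<Longrightarrow> \<sigma> y $ \<kappa> l = y $ l"
        "\<And>k. k \<notin> \<kappa> ` J \<Longrightarrow> G k (\<sigma> y) = 0" by auto
      have "(\<Sum>j\<in>J. pad J (\<lambda>i j. B (\<sigma> y) $ \<kappa> i $ \<kappa> j) $ i $ j * g j y) =
          (\<Sum>j\<in>J. B (\<sigma> y) $ \<kappa> i $ \<kappa> j * G (\<kappa> j) (\<sigma> y))"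
        using i by (intro sum.cong) (auto simp: Gy)
      also have "\<dots> = (\<Sum>k\<in>\<kappa> ` J. B (\<sigma> y) $ \<kappa> i $ k * G k (\<sigma> y))"
        by (simp add: sum.reindex[OF \<kappa>])
      also have "\<dots> = (\<Sum>k\<in>UNIV. B (\<sigma> y) $ \<kappa> i $ k * G k (\<sigma> y))"
        by (rule sum.mono_neutral_left) (auto simp: Gy)
      also have "\<dots> = y $ i ^ Suc (\<alpha> (\<kappa> i))"
        using By Gy(2)[OF i] by simp
      finally show "(\<Sum>j\<in>J. pad J (\<lambda>i j. B (\<sigma> y) $ \<kappa> i $ \<kappa> j) $ i $ j * g j y) =
          y $ i ^ Suc (if i \<in> J then \<alpha> (\<kappa> i) else 0)"
        using i by simp
    qed
  qed (auto simp: multi_indices_def)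
  then show ?thesis using that unfolding is_residue_def by blast
qed

section \<open>Invariance under coordinate changes\<close>

lemma pull_UNIV_Inl: "pull UNIV Inl = lpart" and pull_UNIV_Inr: "pull UNIV Inr = rpart"
  by (auto simp: fun_eq_iff vec_eq_iff)

section \<open>Block matrices over the doubled index type and the Jacobians of inverse germs\<close>

definition block :: "complex^'n^'n \<Rightarrow> complex^'n^'n \<Rightarrow> complex^'n^'n \<Rightarrow> complex^'n^'n \<Rightarrow>
    complex^('n::finite + 'n)^('n + 'n)" where
  "block A B C D = (\<chi> k l. case k of
     Inl i \<Rightarrow> (case l of Inl j \<Rightarrow> A $ i $ j | Inr j \<Rightarrow> B $ i $ j)
   | Inr i \<Rightarrow> (case l of Inl j \<Rightarrow> C $ i $ j | Inr j \<Rightarrow> D $ i $ j))"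

lemma block_nth [simp]:
  "block A B C D $ Inl i $ Inl j = A $ i $ j" "block A B C D $ Inl i $ Inr j = B $ i $ j"
  "block A B C D $ Inr i $ Inl j = C $ i $ j" "block A B C D $ Inr i $ Inr j = D $ i $ j"
  by (simp_all add: block_def)

lemma block_eqI:
  assumes "\<And>i j. M $ Inl i $ Inl j = A $ i $ j" "\<And>i j. M $ Inl i $ Inr j = B $ i $ j"
    "\<And>i j. M $ Inr i $ Inl j = C $ i $ j" "\<And>i j. M $ Inr i $ Inr j = D $ i $ j"
  shows "M = block A B C D"
proof -
  have "M $ k $ l = block A B C D $ k $ l" for k l
    by (cases k; cases l) (simp_all add: assms)
  then show ?thesis by (simp add: vec_eq_iff)
qed

lemma block_mult:
  "block A B C D ** block A' B' C' D' =
   block (A ** A' + B ** C') (A ** B' + B ** D') (C ** A' + D ** C') (C ** B' + D ** D')"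
  by (rule block_eqI) (simp_all add: matrix_matrix_mult_def sum_UNIV_sum)

lemma det_pad_UNIV: "det (pad UNIV b) = det (\<chi> i j. b i j)"
  by (rule arg_cong[where f=det]) (simp add: vec_eq_iff)

lemma det_block_lower: "det (block A 0 C (mat 1)) = det A"
proof -
  have "det (block A 0 C (mat 1)) = det (pad (range Inl) (\<lambda>k l. block A 0 C (mat 1) $ k $ l)) *
      (\<Prod>k\<in>- range Inl. block A 0 C (mat 1) $ k $ k)"
  proof (rule det_block_diagonal)
    fix k l :: "'a + 'a" assume kl: "k \<in> range Inl" "l \<notin> range Inl"
    then show "block A 0 C (mat 1) $ k $ l = 0" by (cases l) auto
  next
    fix k l :: "'a + 'a" assume kl: "k \<notin> range Inl" "l \<notin> range Inl" "k \<noteq> l"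
    then show "block A 0 C (mat 1) $ k $ l = 0" by (cases k; cases l) (auto simp: mat_def)
  qed
  also have "det (pad (range Inl) (\<lambda>k l. block A 0 C (mat 1) $ k $ l)) = det (pad UNIV (\<lambda>i j. A $ i $ j))"
    by (rule det_pad_image) auto
  also have "det (pad UNIV (\<lambda>i j. A $ i $ j)) = det A" by (simp add: det_pad_UNIV vec_lambda_eta)
  also have "(\<Prod>k\<in>- range Inl. block A 0 C (mat 1) $ k $ k) = 1"
  proof (rule prod.neutral, rule ballI)
    fix k :: "'a + 'a" assume "k \<in> - range Inl"
    then show "block A 0 C (mat 1) $ k $ k = 1" by (cases k) (auto simp: mat_def)
  qed
  finally show ?thesis by simp
qed

lemma transpose_block: "transpose (block A B C D) = block (transpose A) (transpose C) (transpose B) (transpose D)"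
  by (rule block_eqI) (simp_all add: transpose_def)

lemma det_block_upper: "det (block A B 0 (mat 1)) = det A"
proof -
  have "det (block A B 0 (mat 1)) = det (transpose (block A B 0 (mat 1)))" by (simp only: det_transpose)
  also have "\<dots> = det (block (transpose A) 0 (transpose B) (mat 1))"
  proof -
    have "transpose 0 = (0 :: complex^'a^'a)" by (simp add: transpose_def vec_eq_iff)
    then show ?thesis unfolding transpose_block by simp
  qed
  also have "\<dots> = det A" by (simp add: det_block_lower)
  finally show ?thesis .
qed

lemma det_block_upper': "det (block (mat 1) B 0 D) = det D"
proof -
  let ?M = "block (mat 1) B 0 D"
  have "det ?M = det (pad (range Inr) (\<lambda>k l. ?M $ k $ l)) * (\<Prod>k\<in>- range Inr. ?M $ k $ k)"
  proof (rule det_block_diagonal)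
    fix k l :: "'a + 'a" assume kl: "k \<in> range Inr" "l \<notin> range Inr"
    then show "?M $ k $ l = 0" by (cases l) auto
  next
    fix k l :: "'a + 'a" assume kl: "k \<notin> range Inr" "l \<notin> range Inr" "k \<noteq> l"
    then show "?M $ k $ l = 0" by (cases k; cases l) (auto simp: mat_def)
  qed
  also have "det (pad (range Inr) (\<lambda>k l. ?M $ k $ l)) = det (pad UNIV (\<lambda>i j. D $ i $ j))"
    by (rule det_pad_image) auto
  also have "det (pad UNIV (\<lambda>i j. D $ i $ j)) = det D" by (simp add: det_pad_UNIV vec_lambda_eta)
  also have "(\<Prod>k\<in>- range Inr. ?M $ k $ k) = 1"
  proof (rule prod.neutral, rule ballI)
    fix k :: "'a + 'a" assume "k \<in> - range Inr"
    then show "?M $ k $ k = 1" by (cases k) (auto simp: mat_def)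
  qed
  finally show ?thesis by simp
qed

lemma matrix_mult_neg_mat_1:
  fixes X :: "complex^'n^'n::finite"
  shows "X ** (- mat 1) = - X"
proof -
  have "(\<Sum>k\<in>UNIV. X $ i $ k * (- mat 1 :: complex^'n^'n) $ k $ j) = (\<Sum>k\<in>UNIV. if k = j then - X $ i $ j else 0)" for i j
    by (rule sum.cong) (auto simp: mat_def)
  then show ?thesis by (simp add: matrix_matrix_mult_def vec_eq_iff)
qed

text \<open>The sign of the block permutation is absorbed by \<open>(0 1; -1 0)\<close>, a product of three
  unitriangular matrices.\<close>

lemma det_block_antidiagonal:
  fixes K L H :: "complex^'n^'n::finite"
  shows "det (block K L (- H) 0) = det L * det H"
proof -
  have 1: "block (mat 1) (mat 1) 0 (mat 1) ** block (mat 1) 0 (- mat 1) (mat 1) ** block (mat 1) (mat 1) 0 (mat 1) =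
      block 0 (mat 1) (- mat 1) (0 :: complex^'n^'n)"
    by (simp add: block_mult)
  have "det (block 0 (mat 1) (- mat 1) (0 :: complex^'n^'n)) = 1"
    unfolding 1[symmetric] by (simp add: det_mul det_block_lower det_block_upper)
  moreover have 2: "block K L (- H) 0 = block (mat 1) 0 0 H ** block L (- K) 0 (mat 1) ** block 0 (mat 1) (- mat 1) 0"
    by (simp add: block_mult matrix_mult_neg_mat_1)
  have "det (block K L (- H) 0) = det (block (mat 1) 0 0 H) * det (block L (- K) 0 (mat 1)) *
      det (block 0 (mat 1) (- mat 1) (0 :: complex^'n^'n))"
    unfolding 2 by (simp only: det_mul)
  ultimately show ?thesis by (simp add: det_block_upper det_block_upper')
qed

lemma Jacobian_inverse:
  fixes \<phi> \<psi> :: "complex^'n::finite \<Rightarrow> complex^'n"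
  assumes \<phi>: "hol_map0 \<phi>" and \<psi>: "hol_map0 \<psi>" and inv: "eventually (\<lambda>y. \<phi> (\<psi> y) = y) (nhds 0)"
  shows "eventually (\<lambda>y. det (\<chi> k i. pd i (\<lambda>z. \<phi> z $ k) (\<psi> y)) * det (\<chi> i l. pd l (\<lambda>y. \<psi> y $ i) y) = 1) (nhds 0)"
proof -
  obtain V where V: "open V" "0 \<in> V" "\<And>k. cn_holomorphic_on (\<lambda>z. \<phi> z $ k) V" using hol_map0_common[OF \<phi>] by blast
  obtain W where W: "open W" "0 \<in> W" "\<And>i. cn_holomorphic_on (\<lambda>y. \<psi> y $ i) W" using hol_map0_common[OF \<psi>] by blast
  have "eventually (\<lambda>y. \<psi> y \<in> V) (nhds 0)"
    by (rule hol_map0_eventually[OF \<psi> eventually_nhds_in_open[OF V(1,2)]])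
  moreover have "eventually (\<lambda>y. y \<in> W) (nhds 0)" using W(1,2) by (rule eventually_nhds_in_open)
  \<comment> \<open>To be differentiated at y, the identity has to hold in a neighbourhood of y and
    not only at y.\<close>
  moreover have "eventually (\<lambda>y. eventually (\<lambda>y'. \<phi> (\<psi> y') = y') (nhds y)) (nhds 0)"
    using inv by (subst eventually_eventually)
  ultimately show ?thesis
  proof eventually_elim
    case (elim y)
    have "(\<Sum>i\<in>UNIV. pd i (\<lambda>z. \<phi> z $ k) (\<psi> y) * pd l (\<lambda>y. \<psi> y $ i) y) = (if k = l then 1 else 0)" for k l
    proof -
      have "((\<lambda>y. \<phi> (\<psi> y) $ k) has_derivative (\<lambda>h. \<Sum>l\<in>UNIV. h $ l *
          (\<Sum>i\<in>UNIV. pd i (\<lambda>z. \<phi> z $ k) (\<psi> y) * pd l (\<lambda>y. \<psi> y $ i) y))) (at y)"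
        by (rule has_derivative_compose_pd[OF V(3) W(3) elim(2,1)])
      moreover obtain Y where Y: "open Y" "y \<in> Y" "\<And>y'. y' \<in> Y \<Longrightarrow> \<phi> (\<psi> y') = y'"
        using elim(3) unfolding eventually_nhds by blast
      have "((\<lambda>y. \<phi> (\<psi> y) $ k) has_derivative (\<lambda>h. h $ k)) (at y)"
        by (rule has_derivative_transform_within_open[OF bounded_linear_imp_has_derivative[OF bounded_linear_vec_nth] Y(1,2)])
          (simp add: Y(3))
      ultimately have "(\<lambda>h. \<Sum>l\<in>UNIV. h $ l *
          (\<Sum>i\<in>UNIV. pd i (\<lambda>z. \<phi> z $ k) (\<psi> y) * pd l (\<lambda>y. \<psi> y $ i) y)) = (\<lambda>h. h $ k)"
        by (rule has_derivative_unique)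
      from fun_cong[OF this, of "axis l 1"]
      have "(\<Sum>j\<in>UNIV. axis l 1 $ j * (\<Sum>i\<in>UNIV. pd i (\<lambda>z. \<phi> z $ k) (\<psi> y) * pd j (\<lambda>y. \<psi> y $ i) y)) =
          (axis l 1 :: complex^'n) $ k" .
      moreover have "(\<Sum>j\<in>UNIV. axis l 1 $ j * (\<Sum>i\<in>UNIV. pd i (\<lambda>z. \<phi> z $ k) (\<psi> y) * pd j (\<lambda>y. \<psi> y $ i) y)) =
          (\<Sum>j\<in>UNIV. if j = l then (\<Sum>i\<in>UNIV. pd i (\<lambda>z. \<phi> z $ k) (\<psi> y) * pd l (\<lambda>y. \<psi> y $ i) y) else 0)"
        by (rule sum.cong) (auto simp: axis_def)
      ultimately show ?thesis by (simp add: axis_def)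
    qed
    then have "(\<chi> k i. pd i (\<lambda>z. \<phi> z $ k) (\<psi> y)) ** (\<chi> i l. pd l (\<lambda>y. \<psi> y $ i) y) = mat 1"
      by (simp add: matrix_matrix_mult_def mat_def vec_eq_iff)
    then show ?case by (metis det_mul det_I)
  qed
qed


text \<open>In w = (z, y) the point z is \<open>lpart w\<close> and y is \<open>rpart w\<close>. The
  generators \<open>g\<close> belong to the map \<psi> F \<phi> in the coordinates z, and
  \<open>g'\<close> to the map F in the coordinates y. A value is extended from \<open>g\<close> to
  \<open>G1\<close>, carried to \<open>G2\<close> by the transformation law and brought down to
  \<open>g'\<close> by uniqueness.\<close>

lemma is_residue_coordinate_change:
  fixes \<phi> \<psi> F :: "complex^'n::finite \<Rightarrow> complex^'n"
  assumes \<phi>: "hol_map0 \<phi>" and \<psi>: "hol_map0 \<psi>" and F: "hol_map0 F" and u: "hol0 u"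
    and \<phi>\<psi>: "eventually (\<lambda>y. \<phi> (\<psi> y) = y) (nhds 0)"
    and g: "eventually (\<lambda>z. \<forall>i. g i z = z $ i - \<psi> (F (\<phi> z)) $ i) (nhds 0)"
    and g': "eventually (\<lambda>y. \<forall>i. g' i y = y $ i - F y $ i) (nhds 0)"
    and res: "is_residue UNIV u g c"
  shows "is_residue UNIV (\<lambda>y. u (\<psi> y)) g' c"
proof -
  have \<psi>r: "hol_map0 (\<lambda>w. \<psi> (rpart w))"
    by (rule hol_map0_compose[OF \<psi> hol_map0_rpart])
  have Fr: "hol_map0 (\<lambda>w. F (rpart w))" by (rule hol_map0_compose[OF F hol_map0_rpart])
  note l = hol_map0_lpart and r = hol_map0_rpart
  define G1 where "G1 k w = (case k of Inl i \<Rightarrow> g i (lpart w) | Inr i \<Rightarrow> w $ Inr i - \<phi> (lpart w) $ i)"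
    for k and w :: "complex^('n + 'n)"
  define G2 where "G2 k w = (case k of Inl i \<Rightarrow> w $ Inl i - \<psi> (rpart w) $ i | Inr i \<Rightarrow> g' i (rpart w))"
    for k and w :: "complex^('n + 'n)"
  have res1: "is_residue UNIV (\<lambda>w. u (lpart w)) G1 c"
  proof (rule is_residue_graph[of Inl UNIV u "\<lambda>k z. case k of Inl i \<Rightarrow> 0 | Inr i \<Rightarrow> \<phi> z $ i" G1 g c, unfolded pull_UNIV_Inl])
    show "inj Inl" by simp
    show "hol0 (\<lambda>z. case k of Inl i \<Rightarrow> 0 | Inr i \<Rightarrow> \<phi> z $ i)" for k :: "'n + 'n"
      using \<phi> by (cases k) auto
    show "(case k of Inl i \<Rightarrow> 0 | Inr i \<Rightarrow> \<phi> 0 $ i) = 0" for k :: "'n + 'n"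
      by (cases k) (auto simp: hol_map0_eq_0[OF \<phi>])
    show "eventually (\<lambda>w. (\<forall>i\<in>UNIV. G1 (Inl i) w = g i (lpart w)) \<and>
      (\<forall>k\<in>- range Inl. G1 k w = w $ k - (case k of Inl i \<Rightarrow> 0 | Inr i \<Rightarrow> \<phi> (lpart w) $ i))) (nhds 0)"
    proof (rule always_eventually, intro allI conjI ballI)
      fix w and k :: "'n + 'n" assume "k \<in> - range Inl"
      then show "G1 k w = w $ k - (case k of Inl i \<Rightarrow> 0 | Inr i \<Rightarrow> \<phi> (lpart w) $ i)"
        by (cases k) (auto simp: G1_def)
    qed (simp add: G1_def)
  qed (rule u res)+

  \<comment> \<open>Compares \<phi> at \<psi> y and at z. On the graph z = \<psi> y the coefficients
    \<open>H\<close> are the entries of the Jacobian matrix of \<phi>.\<close>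
  let ?PH = "\<lambda>k H. (\<forall>i. hol0 (H i)) \<and> eventually (\<lambda>w. \<phi> (\<psi> (rpart w)) $ k = \<phi> (lpart w) $ k +
      (\<Sum>i\<in>UNIV. H i w * (\<psi> (rpart w) $ i - lpart w $ i))) (nhds 0) \<and>
      (\<forall>i w. \<psi> (rpart w) = lpart w \<longrightarrow> H i w = pd i (\<lambda>z. \<phi> z $ k) (\<psi> (rpart w)))"
  have "\<exists>H. ?PH k H" for k
    by (rule Hadamard[OF hol_map0_nth[OF \<phi>, of k] \<psi>r l], rule exI, intro conjI allI impI, assumption, assumption, blast)
  then have "\<exists>H. \<forall>k. ?PH k (H k)" by (intro choice allI)
  then obtain H where H0: "\<forall>k. ?PH k (H k)" ..
  note H = H0[THEN spec, THEN conjunct1, THEN spec] H0[THEN spec, THEN conjunct2, THEN conjunct1]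
    H0[THEN spec, THEN conjunct2, THEN conjunct2, THEN spec, THEN spec, THEN mp]
  have hFx: "hol0 (\<lambda>z. z $ i - \<psi> (F (\<phi> z)) $ i)" for i
    using hol_map0_compose[OF hol_map0_compose[OF \<psi> F] \<phi>] by (intro hol0_diff hol0_nth hol_map0_nth)
  \<comment> \<open>Compares the generator \<open>g i\<close> at z and at \<psi> y.\<close>
  let ?PK = "\<lambda>i K. (\<forall>j. hol0 (K j)) \<and> eventually (\<lambda>w. lpart w $ i - \<psi> (F (\<phi> (lpart w))) $ i =
      \<psi> (rpart w) $ i - \<psi> (F (\<phi> (\<psi> (rpart w)))) $ i +
      (\<Sum>j\<in>UNIV. K j w * (lpart w $ j - \<psi> (rpart w) $ j))) (nhds 0)"
  have "\<exists>K. ?PK i K" for i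
    by (rule Hadamard[OF hFx[of i] l \<psi>r], rule exI, intro conjI allI, assumption, assumption)
  then have "\<exists>K. \<forall>i. ?PK i (K i)" by (intro choice allI)
  then obtain K where K0: "\<forall>i. ?PK i (K i)" ..
  note K = K0[THEN spec, THEN conjunct1, THEN spec] K0[THEN spec, THEN conjunct2]
  \<comment> \<open>Stated for an arbitrary pair of points: the coefficients are needed at (y, F y),
    where they enter the matrix, and at (y, y), where they are the entries of the Jacobian matrix of
    \<psi>.\<close>
  let ?PE = "\<lambda>i E. (\<forall>k. hol0 (E k)) \<and> eventually (\<lambda>w. \<psi> (lpart w) $ i = \<psi> (rpart w) $ i +
      (\<Sum>k\<in>UNIV. E k w * (lpart w $ k - rpart w $ k))) (nhds 0) \<and>
      (\<forall>k w. lpart w = (rpart w :: complex^'n) \<longrightarrow> E k w = pd k (\<lambda>y. \<psi> y $ i) (lpart w))"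
  have "\<exists>E. ?PE i E" for i
    by (rule Hadamard[OF hol_map0_nth[OF \<psi>, of i] l r], rule exI, intro conjI allI impI, assumption, assumption, blast)
  then have "\<exists>E. \<forall>i. ?PE i (E i)" by (intro choice allI)
  then obtain E where E0: "\<forall>i. ?PE i (E i)" ..
  note E = E0[THEN spec, THEN conjunct1, THEN spec] E0[THEN spec, THEN conjunct2, THEN conjunct1]
    E0[THEN spec, THEN conjunct2, THEN conjunct2, THEN spec, THEN spec, THEN mp]

  define yF :: "complex^('n + 'n) \<Rightarrow> complex^('n + 'n)"
    where "yF w = (\<chi> k. case k of Inl i \<Rightarrow> rpart w $ i | Inr i \<Rightarrow> F (rpart w) $ i)" for w
  define yy :: "complex^('n + 'n) \<Rightarrow> complex^('n + 'n)"
    where "yy w = (\<chi> k. case k of Inl i \<Rightarrow> rpart w $ i | Inr i \<Rightarrow> rpart w $ i)" for w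
  define \<psi>y :: "complex^('n + 'n) \<Rightarrow> complex^('n + 'n)"
    where "\<psi>y w = (\<chi> k. case k of Inl i \<Rightarrow> \<psi> (rpart w) $ i | Inr i \<Rightarrow> rpart w $ i)" for w
  have yF: "hol_map0 yF" unfolding yF_def by (rule hol_map0_pair[OF r Fr])
  have yy: "hol_map0 yy" unfolding yy_def by (rule hol_map0_pair[OF r r])
  have \<psi>y: "hol_map0 \<psi>y" unfolding \<psi>y_def by (rule hol_map0_pair[OF \<psi>r r])
  have parts: "lpart (yF w) = rpart w" "rpart (yF w) = F (rpart w)" "lpart (yy w) = rpart w"
    "rpart (yy w) = rpart w" "lpart (\<psi>y w) = \<psi> (rpart w)" "rpart (\<psi>y w) = rpart w" for w
    by (simp_all add: vec_eq_iff yF_def yy_def \<psi>y_def)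

  \<comment> \<open>The first row of blocks combines \<open>g i\<close> at \<psi> y, which is a
    combination of the components of y - F y by \<open>E\<close>, with the correction by
    \<open>K\<close> in z - \<psi> y. In the second row, y - \<phi> z equals \<phi> (\<psi> y) -
    \<phi> z, which is a combination of the components of \<psi> y - z by \<open>H\<close>; hence
    the sign.\<close>
  define M where "M w = block (\<chi> i j. K i j w) (\<chi> i k. E i k (yF w)) (- (\<chi> k i. H k i w)) 0" for w
  define D where "D w = det (\<chi> i k. E i k (yF w)) * det (\<chi> k i. H k i w)" for w
  have detM: "det (M w) = D w" for w unfolding M_def D_def by (rule det_block_antidiagonal)
  have hM: "hol0 (\<lambda>w. M w $ k $ l)" for k l
    by (cases k; cases l) (auto simp: M_def K(1) H(1) intro: hol0_compose[OF E(1) yF] hol0_minus[OF H(1)])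
  have g_l: "eventually (\<lambda>w. \<forall>i. g i (lpart w) = lpart w $ i - \<psi> (F (\<phi> (lpart w))) $ i) (nhds 0)"
    by (rule hol_map0_eventually[OF l g])
  have g'_r: "eventually (\<lambda>w. \<forall>i. g' i (rpart w) = rpart w $ i - F (rpart w) $ i) (nhds 0)"
    by (rule hol_map0_eventually[OF r g'])
  have \<phi>\<psi>_r: "eventually (\<lambda>w. \<phi> (\<psi> (rpart w)) = rpart w) (nhds 0)"
    by (rule hol_map0_eventually[OF r \<phi>\<psi>])
  have H_all: "eventually (\<lambda>w. \<forall>k. \<phi> (\<psi> (rpart w)) $ k = \<phi> (lpart w) $ k +
      (\<Sum>i\<in>UNIV. H k i w * (\<psi> (rpart w) $ i - lpart w $ i))) (nhds 0)"
    by (rule eventually_all_finite) (rule H(2))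
  have K_all: "eventually (\<lambda>w. \<forall>i. lpart w $ i - \<psi> (F (\<phi> (lpart w))) $ i =
        \<psi> (rpart w) $ i - \<psi> (F (\<phi> (\<psi> (rpart w)))) $ i +
        (\<Sum>j\<in>UNIV. K i j w * (lpart w $ j - \<psi> (rpart w) $ j))) (nhds 0)"
    by (rule eventually_all_finite) (rule K(2))
  have E_all: "eventually (\<lambda>w. \<forall>i. \<psi> (rpart w) $ i = \<psi> (F (rpart w)) $ i +
        (\<Sum>k\<in>UNIV. E i k (yF w) * (rpart w $ k - F (rpart w) $ k))) (nhds 0)"
    using hol_map0_eventually[OF yF E(2)] unfolding parts by (rule eventually_all_finite)
  have G12: "eventually (\<lambda>w. \<forall>k. G1 k w = (\<Sum>l\<in>UNIV. M w $ k $ l * G2 l w)) (nhds 0)"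
    using g_l g'_r \<phi>\<psi>_r H_all K_all E_all
  proof eventually_elim
    case (elim w)
    note gl = elim(1) and g'r = elim(2) and inv = elim(3) and Hw = elim(4) and Kw = elim(5) and Ew = elim(6)
    show ?case
    proof
      fix k
      show "G1 k w = (\<Sum>l\<in>UNIV. M w $ k $ l * G2 l w)"
      proof (cases k)
        case (Inl i)
        have "G1 k w = \<psi> (rpart w) $ i - \<psi> (F (rpart w)) $ i +
            (\<Sum>j\<in>UNIV. K i j w * (lpart w $ j - \<psi> (rpart w) $ j))"
          using gl Kw inv by (simp add: G1_def Inl)
        also have "\<psi> (rpart w) $ i - \<psi> (F (rpart w)) $ i =
            (\<Sum>k\<in>UNIV. E i k (yF w) * (rpart w $ k - F (rpart w) $ k))"
          using Ew by (metis add_diff_cancel_left')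
        finally show ?thesis using g'r by (simp add: Inl sum_UNIV_sum M_def G2_def)
      next
        case (Inr i)
        have "G1 k w = (\<Sum>j\<in>UNIV. H i j w * (\<psi> (rpart w) $ j - lpart w $ j))"
          using Hw[rule_format, of i] by (simp add: G1_def Inr inv)
        also have "\<dots> = (\<Sum>j\<in>UNIV. - H i j w * (lpart w $ j - \<psi> (rpart w) $ j))"
          by (intro sum.cong) (auto simp: algebra_simps)
        finally show ?thesis by (simp add: Inr sum_UNIV_sum M_def G2_def)
      qed
    qed
  qed

  have hD: "hol0 D" unfolding detM[symmetric] using hM by (intro hol0_det_matrix)
  define \<Lambda> where "\<Lambda> v = det (\<chi> i k. E i k v)" for v
  have h\<Lambda>: "hol0 \<Lambda>" unfolding \<Lambda>_def by (intro hol0_det E(1))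
  define \<Theta> where "\<Theta> w = det (\<chi> k i. H k i (\<psi>y w))" for w
  have h\<Theta>: "hol0 \<Theta>" unfolding \<Theta>_def by (intro hol0_det hol0_compose[OF H(1) \<psi>y])
  \<comment> \<open>The determinant is reduced in two stages: modulo z - \<psi> y it may be
    evaluated at (\<psi> y, y), and modulo y - F y its factor \<Lambda> may be moved from (y, F y)
    to (y, y). What remains is a product of Jacobian determinants of inverse germs.\<close>
  obtain d where d: "\<And>k. hol0 (d k)"
      "eventually (\<lambda>w. D w = D (\<psi>y w) + (\<Sum>k\<in>UNIV. d k w * (w $ k - \<psi>y w $ k))) (nhds 0)"
    by (rule Hadamard[OF hD hol_map0_id \<psi>y], rule that)
  obtain t where t: "\<And>k. hol0 (t k)"
      "eventually (\<lambda>w. \<Lambda> (yF w) = \<Lambda> (yy w) + (\<Sum>k\<in>UNIV. t k w * (yF w $ k - yy w $ k))) (nhds 0)"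
    by (rule Hadamard[OF h\<Lambda> yF yy], rule that)
  define d2 where "d2 k w = (case k of Inl i \<Rightarrow> d (Inl i) w | Inr i \<Rightarrow> - t (Inr i) w * \<Theta> w)" for k w
  have hd2: "hol0 (d2 k)" for k
    unfolding d2_def by (cases k) (auto intro!: d(1) hol0_minus hol0_mult t(1) h\<Theta>)
  have jac: "eventually (\<lambda>w. \<Theta> w * \<Lambda> (yy w) = 1) (nhds 0)"
    using hol_map0_eventually[OF r Jacobian_inverse[OF \<phi> \<psi> \<phi>\<psi>]]
    by (simp add: \<Theta>_def \<Lambda>_def E(3) H(3) parts)
  have D1: "eventually (\<lambda>w. D w = 1 + (\<Sum>k\<in>UNIV. d2 k w * G2 k w)) (nhds 0)"
    using d(2) t(2) jac g'_r
  proof eventually_elim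
    case (elim w)
    note dw = elim(1) and tw = elim(2) and jw = elim(3) and g'r = elim(4)
    have "yF (\<psi>y w) = yF w" unfolding yF_def parts ..
    then have "D (\<psi>y w) = \<Lambda> (yF w) * \<Theta> w" by (simp add: D_def \<Lambda>_def \<Theta>_def)
    also have "\<Lambda> (yF w) = \<Lambda> (yy w) + (\<Sum>i\<in>UNIV. t (Inr i) w * (F (rpart w) $ i - rpart w $ i))"
      unfolding tw by (simp add: sum_UNIV_sum yF_def yy_def)
    also have "(\<Sum>i\<in>UNIV. t (Inr i) w * (F (rpart w) $ i - rpart w $ i)) = (\<Sum>i\<in>UNIV. - t (Inr i) w * G2 (Inr i) w)"
      by (intro sum.cong refl) (simp add: G2_def g'r[rule_format] algebra_simps)
    also have "(\<Lambda> (yy w) + (\<Sum>i\<in>UNIV. - t (Inr i) w * G2 (Inr i) w)) * \<Theta> w =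
        1 + (\<Sum>i\<in>UNIV. d2 (Inr i) w * G2 (Inr i) w)"
      unfolding distrib_right sum_distrib_right using jw by (simp add: d2_def mult_ac)
    finally show ?case
      unfolding dw by (simp add: sum_UNIV_sum d2_def G2_def \<psi>y_def)
  qed
  have G20: "G2 k 0 = 0" for k
    using eventually_nhds_x_imp_x[OF g'_r] hol_map0_eq_0[OF F] hol_map0_eq_0[OF \<psi>]
    by (cases k) (auto simp: G2_def)
  have D0: "D 0 = 1" using eventually_nhds_x_imp_x[OF D1] by (simp add: G20)
  have hD': "hol0 (\<lambda>w. inverse (D w))" by (rule hol0_inverse[OF hD]) (simp add: D0)
  have Dnz: "eventually (\<lambda>w. D w \<noteq> 0) (nhds 0)"
  proof -
    have "(D \<longlongrightarrow> D 0) (nhds 0)"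
      using hol0_isCont[OF hD] by (simp add: isCont_def tendsto_at_iff_tendsto_nhds)
    from tendsto_imp_eventually_ne[OF this, of 0] show ?thesis by (simp add: D0)
  qed
  have hul: "hol0 (\<lambda>w. u (lpart w))" by (rule hol0_compose[OF u l])
  \<comment> \<open>Near 0 the numerator is rewritten as (u / D) det M, the form demanded by the
    transformation law.\<close>
  have "is_residue UNIV (\<lambda>w. (u (lpart w) * inverse (D w)) * minor_det UNIV (\<lambda>k l. M w $ k $ l)) G1 c"
  proof (rule is_residue_congruent[OF hul _ _ res1, where e="\<lambda>_ _. 0"])
    show "eventually (\<lambda>w. w \<in> coord_space UNIV \<longrightarrow>
        (u (lpart w) * inverse (D w)) * minor_det UNIV (\<lambda>k l. M w $ k $ l) =
        u (lpart w) + (\<Sum>k\<in>UNIV. 0 * G1 k w)) (nhds 0)"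
      using Dnz by eventually_elim (simp add: minor_det_eq det_pad_UNIV vec_lambda_eta detM)
  qed simp
  then have res2: "is_residue UNIV (\<lambda>w. u (lpart w) * inverse (D w)) G2 c"
    by (rule is_residue_transform[rotated 2]) (use hM G12 in \<open>auto elim: eventually_mono\<close>)
  obtain a where a: "\<And>k. hol0 (a k)"
      "eventually (\<lambda>w. u (\<psi> (rpart w)) = u (lpart w) + (\<Sum>i\<in>UNIV. a i w * (\<psi> (rpart w) $ i - lpart w $ i))) (nhds 0)"
    by (rule Hadamard[OF u \<psi>r l], rule that)
  \<comment> \<open>Two congruences modulo \<open>G2\<close> are added: u (\<psi> y) - u z lies in
    the ideal of z - \<psi> y, and u - u / D equals (u / D)(D - 1) with D - 1 in the ideal.\<close>
  define b where "b k w = (case k of Inl i \<Rightarrow> - a i w | Inr i \<Rightarrow> 0) + u (lpart w) * inverse (D w) * d2 k w"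
    for k and w
  have hb: "hol0 (b k)" for k
    unfolding b_def using a(1) by (cases k) (auto intro!: hol0_add hol0_mult hul hD' hd2)
  have res3: "is_residue UNIV (\<lambda>w. u (\<psi> (rpart w))) G2 c"
  proof (rule is_residue_congruent[OF hol0_mult[OF hul hD'] _ _ res2, where e=b])
    show "eventually (\<lambda>w. w \<in> coord_space UNIV \<longrightarrow> u (\<psi> (rpart w)) =
        u (lpart w) * inverse (D w) + (\<Sum>k\<in>UNIV. b k w * G2 k w)) (nhds 0)"
      using a(2) D1 Dnz
    proof (eventually_elim, intro impI)
      fix w
      assume aw: "u (\<psi> (rpart w)) = u (lpart w) + (\<Sum>i\<in>UNIV. a i w * (\<psi> (rpart w) $ i - lpart w $ i))"
        and Dw: "D w = 1 + (\<Sum>k\<in>UNIV. d2 k w * G2 k w)" and nz: "D w \<noteq> 0"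
      have "(\<Sum>k\<in>UNIV. b k w * G2 k w) = (\<Sum>k\<in>UNIV. (case k of Inl i \<Rightarrow> - a i w | Inr i \<Rightarrow> 0) * G2 k w) +
          u (lpart w) * inverse (D w) * (\<Sum>k\<in>UNIV. d2 k w * G2 k w)"
        unfolding b_def distrib_right sum.distrib sum_distrib_left mult.assoc ..
      also have "(\<Sum>k\<in>UNIV. d2 k w * G2 k w) = D w - 1" using Dw by simp
      also have "(\<Sum>k\<in>UNIV. (case k of Inl i \<Rightarrow> - a i w | Inr i \<Rightarrow> 0) * G2 k w) =
          (\<Sum>i\<in>UNIV. a i w * (\<psi> (rpart w) $ i - lpart w $ i))"
        by (simp add: sum_UNIV_sum G2_def, intro sum.cong) (auto simp: algebra_simps)
      finally show "u (\<psi> (rpart w)) = u (lpart w) * inverse (D w) + (\<Sum>k\<in>UNIV. b k w * G2 k w)"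
        using nz by (simp add: aw field_simps)
    qed
  qed (rule hb)

  \<comment> \<open>Restriction to the graph z = \<psi> y provides some value of the target symbol.
    Its extension to \<open>G2\<close> has to coincide with \<open>c\<close>.\<close>
  obtain c' where c': "is_residue UNIV (\<lambda>y. u (\<psi> y)) g' c'"
  proof (rule is_residue_restrict_exists[OF hol_map0_pair[OF \<psi> hol_map0_id] _ _ res3])
    show "inj Inr" by simp
    show "eventually (\<lambda>y. y \<in> coord_space UNIV \<longrightarrow>
      (\<forall>l\<in>UNIV. G2 (Inr l) (\<chi> k. case k of Inl i \<Rightarrow> \<psi> y $ i | Inr i \<Rightarrow> y $ i) = g' l y \<and>
        (\<chi> k. case k of Inl i \<Rightarrow> \<psi> y $ i | Inr i \<Rightarrow> y $ i) $ Inr l = y $ l) \<and>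
      (\<forall>k\<in>- range Inr. G2 k (\<chi> k. case k of Inl i \<Rightarrow> \<psi> y $ i | Inr i \<Rightarrow> y $ i) = 0)) (nhds 0)"
    proof (rule always_eventually, intro allI impI conjI ballI)
      fix y :: "complex^'n" and k :: "'n + 'n" and l
      let ?y = "\<chi> k. case k of Inl i \<Rightarrow> \<psi> y $ i | Inr i \<Rightarrow> y $ i"
      have rp: "rpart ?y = y" by (simp add: vec_eq_iff)
      show "G2 (Inr l) ?y = g' l y" by (simp add: G2_def rp)
      assume "k \<in> - range Inr"
      then show "G2 k ?y = 0" by (cases k) (auto simp: G2_def rp)
    qed simp
  qed
  have hu\<psi>: "hol0 (\<lambda>y. u (\<psi> y))" by (rule hol0_compose[OF u \<psi>])
  have "is_residue UNIV (\<lambda>w. u (\<psi> (rpart w))) G2 c'"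
  proof (rule is_residue_graph[of Inr UNIV "\<lambda>y. u (\<psi> y)" "\<lambda>k y. case k of Inl i \<Rightarrow> \<psi> y $ i | Inr i \<Rightarrow> 0" G2 g' c', unfolded pull_UNIV_Inr])
    show "inj Inr" by simp
    show "hol0 (\<lambda>z. case k of Inl i \<Rightarrow> \<psi> z $ i | Inr i \<Rightarrow> 0)" for k :: "'n + 'n"
      using \<psi> by (cases k) auto
    show "(case k of Inl i \<Rightarrow> \<psi> 0 $ i | Inr i \<Rightarrow> 0) = 0" for k :: "'n + 'n"
      by (cases k) (auto simp: hol_map0_eq_0[OF \<psi>])
    show "eventually (\<lambda>w. (\<forall>i\<in>UNIV. G2 (Inr i) w = g' i (rpart w)) \<and>
      (\<forall>k\<in>- range Inr. G2 k w = w $ k - (case k of Inl i \<Rightarrow> \<psi> (rpart w) $ i | Inr i \<Rightarrow> 0))) (nhds 0)"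
    proof (rule always_eventually, intro allI conjI ballI)
      fix w and k :: "'n + 'n" assume "k \<in> - range Inr"
      then show "G2 k w = w $ k - (case k of Inl i \<Rightarrow> \<psi> (rpart w) $ i | Inr i \<Rightarrow> 0)"
        by (cases k) (auto simp: G2_def)
    qed (simp add: G2_def)
  qed (rule hu\<psi> c')+
  with res3 have "c = c'"
    by (intro is_residue_unique[OF hol0_compose[OF hu\<psi> r]])
  with c' show ?thesis by simp
qed

section \<open>Non-resonant normal directions\<close>

text \<open>The factor from the normal directions is the determinant of \<open>M\<close>. Since z_i
  is the i-th generator divided by 1 - a_i, and a tangential generator changes under the projection
  to S_p by a combination of the z_i, \<open>M\<close> expresses \<open>G\<close> by the generators
  of z - F z. The numerator at the projected point is congruent to the numerator at z modulo the
  z_i.\<close>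

lemma is_residue_normal_lift:
  fixes F :: "complex^'n::finite \<Rightarrow> complex^'n" and a :: "'n \<Rightarrow> complex^'n \<Rightarrow> complex"
  assumes F: "hol_map0 F" and u: "hol0 u"
    and a: "\<And>i. i \<in> I \<Longrightarrow> hol0 (a i)" "\<And>i. i \<in> I \<Longrightarrow> a i 0 \<noteq> 1"
    and Fa: "eventually (\<lambda>z. \<forall>i\<in>I. F z $ i = z $ i * a i z) (nhds 0)"
    and res: "is_residue (- I) (\<lambda>w. u w * inverse (\<Prod>i\<in>I. 1 - a i w)) (\<lambda>k z. z $ k - F z $ k) c"
  shows "is_residue UNIV u (\<lambda>k z. z $ k - F z $ k) c"
proof -
  let ?P = "pull (- I) (\<lambda>i. i)" and ?g = "\<lambda>k z. z $ k - F z $ k"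
  define v where "v w = u w * inverse (\<Prod>i\<in>I. 1 - a i w)" for w
  have inv: "hol0 (\<lambda>w. inverse (1 - a i w))" if "i \<in> I" for i
    using a that by (intro hol0_inverse hol0_diff hol0_const) auto
  have v_eq: "v = (\<lambda>w. u w * (\<Prod>i\<in>I. inverse (1 - a i w)))"
    by (rule ext) (simp add: v_def prod_inversef[symmetric] comp_def)
  have hv: "hol0 v" unfolding v_eq by (intro hol0_mult u hol0_prod inv)
  have hg: "hol0 (?g k)" for k using F by (intro hol0_diff hol0_nth hol_map0_nth)
  \<comment> \<open>The extension of the system on S_p by the graph of the zero map in the normal
    directions.\<close>
  define G where "G k z = (if k \<in> I then z $ k else ?g k (?P z))" for k and z :: "complex^'n"
  have res1: "is_residue UNIV (\<lambda>z. v (?P z)) G c"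
    by (rule is_residue_graph[of "\<lambda>i. i" "- I" v "\<lambda>_ _. 0" G ?g c])
      (use hv res in \<open>auto simp: G_def v_def[abs_def]\<close>)
  have dP: "z $ i - ?P z $ i = (if i \<in> I then z $ i else 0)" for z :: "complex^'n" and i by simp
  obtain b where b: "\<And>i. hol0 (b i)"
      "eventually (\<lambda>z. v z = v (?P z) + (\<Sum>i\<in>UNIV. b i z * (z $ i - ?P z $ i))) (nhds 0)"
    by (rule Hadamard[OF hv hol_map0_id hol_map0_pull], rule that)
  let ?Q = "\<lambda>k e. (\<forall>i. hol0 (e i)) \<and>
      eventually (\<lambda>z. ?g k z = ?g k (?P z) + (\<Sum>i\<in>UNIV. e i z * (z $ i - ?P z $ i))) (nhds 0)"
  have "\<exists>e. ?Q k e" for k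
    by (rule Hadamard[OF hg[of k] hol_map0_id hol_map0_pull], rule exI, intro conjI allI, assumption, assumption)
  then have "\<exists>e. \<forall>k. ?Q k (e k)" by (intro choice allI)
  then obtain e where e0: "\<forall>k. ?Q k (e k)" ..
  note e = e0[THEN spec, THEN conjunct1, THEN spec] e0[THEN spec, THEN conjunct2]
  have e_all: "eventually (\<lambda>z. \<forall>k. ?g k z = ?g k (?P z) + (\<Sum>i\<in>UNIV. e k i z * (z $ i - ?P z $ i))) (nhds 0)"
    by (rule eventually_all_finite) (rule e(2))
  have sumI: "(\<Sum>i\<in>UNIV. h i * (z $ i - ?P z $ i)) = (\<Sum>i\<in>I. h i * z $ i)" for h and z :: "complex^'n"
    unfolding dP by (rule sum.mono_neutral_cong_right) auto
  \<comment> \<open>A row in \<open>I\<close> divides by 1 - a_k. A row outside \<open>I\<close>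
    subtracts from the generator its Hadamard correction in the z_j, each written as a generator
    divided by 1 - a_j.\<close>
  define M where "M k j z = (if k \<in> I then if j = k then inverse (1 - a k z) else 0
    else if j \<in> I then - e k j z * inverse (1 - a j z) else if j = k then 1 else 0)" for k j z
  have hM: "hol0 (M k j)" for k j
  proof -
    have 1: "hol0 (\<lambda>z. - e k j z * inverse (1 - a j z))" if "j \<in> I"
      by (intro hol0_mult hol0_minus e(1) inv that)
    show ?thesis
      by (cases "k \<in> I"; cases "j \<in> I"; cases "j = k") (use 1 inv in \<open>auto simp: M_def[abs_def]\<close>)
  qed
  have detM: "minor_det UNIV (\<lambda>k j. M k j z) = (\<Prod>i\<in>I. inverse (1 - a i z))" for z
  proof -
    have "minor_det UNIV (\<lambda>k j. M k j z) = det (\<chi> k j. M k j z)"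
      by (simp add: minor_det_eq det_pad_UNIV)
    also have "\<dots> = det (pad I (\<lambda>k j. (\<chi> k j. M k j z) $ k $ j)) * (\<Prod>k\<in>- I. (\<chi> k j. M k j z) $ k $ k)"
      by (rule det_block_diagonal) (auto simp: M_def)
    also have "(\<Prod>k\<in>- I. (\<chi> k j. M k j z) $ k $ k) = 1" by (rule prod.neutral) (simp add: M_def)
    also have "det (pad I (\<lambda>k j. (\<chi> k j. M k j z) $ k $ j)) =
        (\<Prod>k\<in>UNIV. pad I (\<lambda>k j. (\<chi> k j. M k j z) $ k $ j) $ k $ k)"
      by (rule det_diagonal) (auto simp: M_def)
    also have "\<dots> = (\<Prod>i\<in>I. inverse (1 - a i z))"
      by (rule prod.mono_neutral_cong_right) (auto simp: M_def)
    finally show ?thesis by simp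
  qed
  have res2: "is_residue UNIV (\<lambda>z. u z * minor_det UNIV (\<lambda>k j. M k j z)) G c"
  proof (rule is_residue_congruent[OF hol0_compose[OF hv hol_map0_pull] _ _ res1,
        where e="\<lambda>i z. if i \<in> I then b i z else 0"])
    show "hol0 (\<lambda>z. if j \<in> I then b j z else 0)" for j using b(1) by (cases "j \<in> I") auto
    show "eventually (\<lambda>z. z \<in> coord_space UNIV \<longrightarrow> u z * minor_det UNIV (\<lambda>k j. M k j z) =
        v (?P z) + (\<Sum>j\<in>UNIV. (if j \<in> I then b j z else 0) * G j z)) (nhds 0)"
      using b(2)
    proof (eventually_elim, intro impI)
      fix z assume bz: "v z = v (?P z) + (\<Sum>i\<in>UNIV. b i z * (z $ i - ?P z $ i))"
      have "(\<Sum>j\<in>UNIV. (if j \<in> I then b j z else 0) * G j z) = (\<Sum>i\<in>I. b i z * z $ i)"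
        by (rule sum.mono_neutral_cong_right) (auto simp: G_def)
      with bz show "u z * minor_det UNIV (\<lambda>k j. M k j z) =
        v (?P z) + (\<Sum>j\<in>UNIV. (if j \<in> I then b j z else 0) * G j z)"
        unfolding sumI detM v_eq by simp
    qed
  qed
  have nz: "eventually (\<lambda>z. \<forall>i\<in>I. 1 - a i z \<noteq> 0) (nhds 0)"
  proof (rule eventually_ball_finite[OF finite], rule ballI)
    fix i assume i: "i \<in> I"
    have "((\<lambda>z. 1 - a i z) \<longlongrightarrow> 1 - a i 0) (nhds 0)"
      using hol0_isCont[of "\<lambda>z. 1 - a i z", OF hol0_diff[OF hol0_const a(1)[OF i]]]
      unfolding isCont_def tendsto_at_iff_tendsto_nhds[of "\<lambda>z. 1 - a i z" 0] .
    then show "eventually (\<lambda>z. 1 - a i z \<noteq> 0) (nhds 0)"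
      by (rule tendsto_imp_eventually_ne) (use a(2)[OF i] in simp)
  qed
  show ?thesis
  proof (rule is_residue_transform[OF hM _ res2])
    show "eventually (\<lambda>z. z \<in> coord_space UNIV \<longrightarrow> (\<forall>k\<in>UNIV. G k z = (\<Sum>j\<in>UNIV. M k j z * ?g j z))) (nhds 0)"
      using Fa nz e_all
    proof (eventually_elim, intro impI ballI)
      fix z k
      assume Fz: "\<forall>i\<in>I. F z $ i = z $ i * a i z" and nz: "\<forall>i\<in>I. 1 - a i z \<noteq> 0"
        and ez: "\<forall>k. ?g k z = ?g k (?P z) + (\<Sum>i\<in>UNIV. e k i z * (z $ i - ?P z $ i))"
      have gI: "inverse (1 - a i z) * ?g i z = z $ i" if "i \<in> I" for i
      proof -
        have "?g i z = (1 - a i z) * z $ i" using Fz that by (simp add: algebra_simps)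
        then show ?thesis using nz that by simp
      qed
      show "G k z = (\<Sum>j\<in>UNIV. M k j z * ?g j z)"
      proof (cases "k \<in> I")
        case True
        have "(\<Sum>j\<in>UNIV. M k j z * ?g j z) = (\<Sum>j\<in>UNIV. if j = k then inverse (1 - a k z) * ?g k z else 0)"
          using True by (intro sum.cong) (auto simp: M_def)
        then show ?thesis using True gI[OF True] by (simp add: G_def)
      next
        case False
        have "(\<Sum>j\<in>UNIV. M k j z * ?g j z) =
            (\<Sum>j\<in>UNIV. (if j = k then ?g k z else 0) - (if j \<in> I then e k j z * z $ j else 0))"
        proof (rule sum.cong[OF refl])
          fix j
          show "M k j z * ?g j z = (if j = k then ?g k z else 0) - (if j \<in> I then e k j z * z $ j else 0)"
          proof (cases "j \<in> I")
            case True
            then have "M k j z * ?g j z = - e k j z * (inverse (1 - a j z) * ?g j z)"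
              using False by (simp add: M_def)
            then show ?thesis unfolding gI[OF True] using True False by auto
          qed (use False in \<open>auto simp: M_def\<close>)
        qed
        also have "\<dots> = ?g k z - (\<Sum>j\<in>UNIV. if j \<in> I then e k j z * z $ j else 0)"
          by (simp add: sum_subtractf)
        also have "(\<Sum>j\<in>UNIV. if j \<in> I then e k j z * z $ j else 0) = (\<Sum>j\<in>I. e k j z * z $ j)"
          by (rule sum.mono_neutral_cong_right) auto
        also have "?g k z - (\<Sum>j\<in>I. e k j z * z $ j) = ?g k (?P z)"
          using ez[rule_format, of k] unfolding sumI by (metis add_diff_cancel_right')
        finally show ?thesis using False by (simp add: G_def)
      qed
    qed
  qed
qed

text \<open>For the converse, restriction to S_p, where the normal generators vanish, gives a value
  of the symbol on S_p. Its lift equals the given value by uniqueness.\<close>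

lemma is_residue_normal_iff:
  fixes F :: "complex^'n::finite \<Rightarrow> complex^'n" and a :: "'n \<Rightarrow> complex^'n \<Rightarrow> complex"
  assumes F: "hol_map0 F" and u: "hol0 u"
    and a: "\<And>i. i \<in> I \<Longrightarrow> hol0 (a i)" "\<And>i. i \<in> I \<Longrightarrow> a i 0 \<noteq> 1"
    and Fa: "eventually (\<lambda>z. \<forall>i\<in>I. F z $ i = z $ i * a i z) (nhds 0)"
  shows "is_residue UNIV u (\<lambda>k z. z $ k - F z $ k) c \<longleftrightarrow>
    is_residue (- I) (\<lambda>w. u w * inverse (\<Prod>i\<in>I. 1 - a i w)) (\<lambda>k z. z $ k - F z $ k) c"
proof
  let ?P = "pull (- I) (\<lambda>i. i) :: complex^'n \<Rightarrow> complex^'n" and ?g = "\<lambda>k z. z $ k - F z $ k"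
  assume res: "is_residue UNIV u ?g c"
  have P: "?P z = z" if "z \<in> coord_space (- I)" for z
    using that by (auto simp: coord_space_def vec_eq_iff)
  obtain c' where c': "is_residue (- I) (\<lambda>w. u w * inverse (\<Prod>i\<in>I. 1 - a i w)) ?g c'"
  proof (rule is_residue_restrict_exists[OF hol_map0_pull[of "- I" "\<lambda>i. i"] _ _ res])
    show "inj_on (\<lambda>i. i) (- I)" by simp
    show "eventually (\<lambda>y. y \<in> coord_space (- I) \<longrightarrow>
        (\<forall>l\<in>- I. ?P y $ l - F (?P y) $ l = y $ l - F y $ l \<and> ?P y $ l = y $ l) \<and>
        (\<forall>k\<in>- (\<lambda>i. i) ` (- I). ?P y $ k - F (?P y) $ k = 0)) (nhds 0)"
      using Fa
    proof (eventually_elim, intro impI)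
      fix y assume "\<forall>i\<in>I. F y $ i = y $ i * a i y" "y \<in> coord_space (- I)"
      then show "(\<forall>l\<in>- I. ?P y $ l - F (?P y) $ l = y $ l - F y $ l \<and> ?P y $ l = y $ l) \<and>
        (\<forall>k\<in>- (\<lambda>i. i) ` (- I). ?P y $ k - F (?P y) $ k = 0)"
        unfolding P[OF \<open>y \<in> coord_space (- I)\<close>] by (auto simp: coord_space_def)
    qed
  qed
  have "is_residue UNIV u ?g c'"
    by (rule is_residue_normal_lift[OF F u a Fa c'])
  with res have "c = c'" by (rule is_residue_unique[OF u])
  with c' show "is_residue (- I) (\<lambda>w. u w * inverse (\<Prod>i\<in>I. 1 - a i w)) ?g c" by simp
qed (rule is_residue_normal_lift[OF F u a Fa])

section \<open>Charts\<close>

lemma chart_inv_left: "is_chart c \<Longrightarrow> q \<in> fst c \<Longrightarrow> chart_inv c (snd c q) = q"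
  unfolding is_chart_def homeomorphism_def by blast

lemma open_chart_image:
  assumes c: "is_chart c" and W: "open W" "W \<subseteq> fst c"
  shows "open (snd c ` W)"
proof -
  have h: "homeomorphism (fst c) (snd c ` fst c) (snd c) (chart_inv c)" and o: "open (fst c)" "open (snd c ` fst c)"
    using c by (auto simp: is_chart_def)
  have "openin (top_of_set (snd c ` fst c)) (snd c ` W)"
    by (rule homeomorphism_imp_open_map[OF h]) (use W o(1) in \<open>simp add: openin_open_eq\<close>)
  then show ?thesis using o(2) by (simp add: openin_open_eq)
qed

text \<open>The chart \<open>c\<close> may lie outside the atlas. Local coordinates are only known
  to be compatible with the charts of the atlas, so two systems of local coordinates are compared
  through an atlas chart around the point.\<close>

definition hol_at :: "('a::topological_space, 'n::finite) chart \<Rightarrow> 'a \<Rightarrow> ('a \<Rightarrow> complex) \<Rightarrow> bool" where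
  "hol_at c p u \<longleftrightarrow> (\<exists>W. open W \<and> p \<in> W \<and> W \<subseteq> fst c \<and>
     cn_holomorphic_on (\<lambda>z. u (chart_inv c z)) (snd c ` W))"

lemma chart_compatible_sym: "chart_compatible c d \<Longrightarrow> chart_compatible d c"
  by (auto simp: chart_compatible_def Int_commute)

lemma hol_at_change:
  assumes u: "hol_at c p u" and c: "is_chart c" and d: "is_chart d" "p \<in> fst d" and cd: "chart_compatible c d"
  shows "hol_at d p u"
proof -
  obtain W where W: "open W" "p \<in> W" "W \<subseteq> fst c" "cn_holomorphic_on (\<lambda>z. u (chart_inv c z)) (snd c ` W)"
    using u unfolding hol_at_def by blast
  let ?W = "W \<inter> fst d"
  have oW: "open ?W" using W d by (auto simp: is_chart_def)
  have "cn_holomorphic_on (\<lambda>y. u (chart_inv c (snd c (chart_inv d y)))) (snd d ` ?W)"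
  proof (rule cn_holomorphic_on_compose[OF W(4)])
    fix i show "cn_holomorphic_on (\<lambda>y. snd c (chart_inv d y) $ i) (snd d ` ?W)"
      using cd W(3) unfolding chart_compatible_def by (auto elim!: cn_holomorphic_on_subset allE[of _ i])
  qed (auto simp: chart_inv_left[OF d(1)])
  then have "cn_holomorphic_on (\<lambda>y. u (chart_inv d y)) (snd d ` ?W)"
  proof (rule cn_holomorphic_on_cong_open)
    show "open (snd d ` ?W)" by (rule open_chart_image[OF d(1) oW]) simp
    fix y assume "y \<in> snd d ` ?W"
    then show "u (chart_inv d y) = u (chart_inv c (snd c (chart_inv d y)))"
      using W(3) by (auto simp: chart_inv_left[OF d(1)] chart_inv_left[OF c])
  qed
  with oW W d show ?thesis unfolding hol_at_def by (intro exI[of _ ?W]) auto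
qed

lemma hol_at_nth:
  assumes c: "is_chart c" "p \<in> fst c"
  shows "hol_at c p (\<lambda>q. snd c q $ i)"
  unfolding hol_at_def
proof (intro exI[of _ "fst c"] conjI)
  show o: "open (fst c)" using c by (simp add: is_chart_def)
  have "cn_holomorphic_on (\<lambda>z. z $ i) (snd c ` fst c)" by simp
  then show "cn_holomorphic_on (\<lambda>z. snd c (chart_inv c z) $ i) (snd c ` fst c)"
    by (rule cn_holomorphic_on_cong_open[OF _ open_chart_image[OF c(1) o]])
      (auto simp: chart_inv_left[OF c(1)])
qed (use c in auto)

lemma hol_at_compose:
  assumes u: "hol_at d p u" and d: "is_chart d" "d \<in> A" and f: "holomorphic_self_map A f" "f p = p"
  shows "hol_at d p (\<lambda>q. u (f q))"
proof -
  obtain W where W: "open W" "p \<in> W" "W \<subseteq> fst d" "cn_holomorphic_on (\<lambda>z. u (chart_inv d z)) (snd d ` W)"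
    using u unfolding hol_at_def by blast
  let ?W = "fst d \<inter> f -` W"
  have "open (f -` W)" using f(1) W(1) open_vimage unfolding holomorphic_self_map_def by blast
  then have oW: "open ?W" using d by (auto simp: is_chart_def)
  have "cn_holomorphic_on (\<lambda>y. u (chart_inv d (snd d (f (chart_inv d y))))) (snd d ` ?W)"
  proof (rule cn_holomorphic_on_compose[OF W(4)])
    fix i
    have "cn_holomorphic_on (\<lambda>z. snd d (f (chart_inv d z)) $ i) (snd d ` (fst d \<inter> f -` fst d))"
      using f(1) d(2) unfolding holomorphic_self_map_def by blast
    then show "cn_holomorphic_on (\<lambda>z. snd d (f (chart_inv d z)) $ i) (snd d ` ?W)"
      by (rule cn_holomorphic_on_subset) (use W(3) in auto)
  qed (auto simp: chart_inv_left[OF d(1)])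
  then have "cn_holomorphic_on (\<lambda>y. u (f (chart_inv d y))) (snd d ` ?W)"
  proof (rule cn_holomorphic_on_cong_open)
    show "open (snd d ` ?W)" by (rule open_chart_image[OF d(1) oW]) simp
    fix y assume "y \<in> snd d ` ?W"
    then show "u (f (chart_inv d y)) = u (chart_inv d (snd d (f (chart_inv d y))))"
      using W(3) by (auto simp: chart_inv_left[OF d(1)])
  qed
  with oW W d f show ?thesis unfolding hol_at_def by (intro exI[of _ ?W]) auto
qed

lemma local_coordinates_eventually:
  assumes x: "local_coordinates A p x" and W: "open W" "p \<in> W"
  shows "eventually (\<lambda>z. chart_inv x z \<in> W \<and> chart_inv x z \<in> fst x \<and> snd x (chart_inv x z) = z) (nhds 0)"
proof -
  have c: "is_chart x" "p \<in> fst x" "snd x p = 0" using x by (auto simp: local_coordinates_def)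
  have "open (snd x ` (fst x \<inter> W))"
    by (rule open_chart_image[OF c(1)]) (use c W in \<open>auto simp: is_chart_def\<close>)
  moreover have "0 \<in> snd x ` (fst x \<inter> W)" using c W by (auto intro!: image_eqI[of _ _ p])
  ultimately have "eventually (\<lambda>z. z \<in> snd x ` (fst x \<inter> W)) (nhds 0)" by (rule eventually_nhds_in_open)
  then show ?thesis by eventually_elim (auto simp: chart_inv_left[OF c(1)])
qed

lemma hol_at_imp_hol0:
  assumes x: "local_coordinates A p x" and u: "hol_at x p u"
  shows "hol0 (\<lambda>z. u (chart_inv x z))"
proof -
  have c: "is_chart x" "snd x p = 0" using x by (auto simp: local_coordinates_def)
  obtain W where W: "open W" "p \<in> W" "W \<subseteq> fst x" "cn_holomorphic_on (\<lambda>z. u (chart_inv x z)) (snd x ` W)"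
    using u unfolding hol_at_def by blast
  then show ?thesis unfolding hol0_def
    using open_chart_image[OF c(1) W(1,3)] c(2)
    by (intro exI[of _ "snd x ` W"]) (auto intro!: image_eqI[of _ _ p])
qed

locale fixed_point =
  fixes A :: "('a::t2_space, 'n::finite) chart set" and f :: "'a \<Rightarrow> 'a" and p :: 'a
  assumes mfd: "complex_manifold A" and f: "holomorphic_self_map A f" and fp: "f p = p"
begin

lemma atlas_chart:
  obtains d where "d \<in> A" "is_chart d" "p \<in> fst d"
proof -
  have "p \<in> (\<Union>c\<in>A. fst c)" using mfd by (simp add: complex_manifold_def)
  then show ?thesis using that mfd by (auto simp: complex_manifold_def)
qed

lemma open_vimage_f: "open W \<Longrightarrow> open (f -` W)"
  using f open_vimage unfolding holomorphic_self_map_def by blast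

lemma hol_at_coordinates:
  assumes x: "local_coordinates A p x" and d: "d \<in> A" "is_chart d" "p \<in> fst d"
  shows "hol_at d p u \<longleftrightarrow> hol_at x p u"
proof -
  have c: "is_chart x" "p \<in> fst x" "chart_compatible x d" using x d by (auto simp: local_coordinates_def)
  show ?thesis
    using hol_at_change[OF _ c(1) d(2,3) c(3)] hol_at_change[OF _ d(2) c(1,2) chart_compatible_sym[OF c(3)]]
    by blast
qed

lemma hol0_mfd:
  assumes x: "local_coordinates A p x" and u: "mfd_holomorphic_on A u W" and W: "open W" "p \<in> W"
  shows "hol0 (\<lambda>z. u (chart_inv x z))"
proof -
  obtain d where d: "d \<in> A" "is_chart d" "p \<in> fst d" by (rule atlas_chart)
  have "hol_at d p u" unfolding hol_at_def
    using u d W by (intro exI[of _ "fst d \<inter> W"]) (auto simp: mfd_holomorphic_on_def is_chart_def)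
  then show ?thesis using hol_at_imp_hol0[OF x] hol_at_coordinates[OF x d] by blast
qed

lemma hol_map0_transition:
  assumes x: "local_coordinates A p x" and c: "local_coordinates A p c"
  shows "hol_map0 (\<lambda>z. snd c (chart_inv x z))"
proof -
  obtain d where d: "d \<in> A" "is_chart d" "p \<in> fst d" by (rule atlas_chart)
  have "hol_at c p (\<lambda>q. snd c q $ i)" for i
    by (rule hol_at_nth) (use c in \<open>auto simp: local_coordinates_def\<close>)
  then have "hol_at x p (\<lambda>q. snd c q $ i)" for i
    using hol_at_coordinates[OF c d] hol_at_coordinates[OF x d] by blast
  then have "hol0 (\<lambda>z. snd c (chart_inv x z) $ i)" for i by (rule hol_at_imp_hol0[OF x])
  moreover have "snd c (chart_inv x 0) = 0"
    using x c chart_inv_left[of x p] by (auto simp: local_coordinates_def)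
  ultimately show ?thesis by (simp add: hol_map0_def)
qed

lemma hol_map0_coord_rep:
  assumes x: "local_coordinates A p x"
  shows "hol_map0 (coord_rep x f)"
proof -
  obtain d where d: "d \<in> A" "is_chart d" "p \<in> fst d" by (rule atlas_chart)
  have "hol_at x p (\<lambda>q. snd x q $ i)" for i
    by (rule hol_at_nth) (use x in \<open>auto simp: local_coordinates_def\<close>)
  then have "hol_at x p (\<lambda>q. snd x (f q) $ i)" for i
    using hol_at_coordinates[OF x d] hol_at_compose[OF _ d(2,1) f fp] by blast
  then have "hol0 (\<lambda>z. snd x (f (chart_inv x z)) $ i)" for i by (rule hol_at_imp_hol0[OF x])
  moreover have "snd x (f (chart_inv x 0)) = 0"
    using x chart_inv_left[of x p] fp by (auto simp: local_coordinates_def)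
  ultimately show ?thesis by (simp add: hol_map0_def coord_rep_def)
qed

text \<open>Near 0 the map in the coordinates \<open>x\<close> is the conjugate \<psi> F \<phi> of
  its expression F in the coordinates \<open>c\<close>, with the transition maps \<phi> and
  \<psi>.\<close>

lemma is_residue_chart_change:
  assumes x: "local_coordinates A p x" and c: "local_coordinates A p c"
    and u: "hol0 (\<lambda>z. u (chart_inv x z))"
    and res: "is_residue UNIV (\<lambda>z. u (chart_inv x z)) (\<lambda>i z. z $ i - coord_rep x f z $ i) v"
  shows "is_residue UNIV (\<lambda>z. u (chart_inv c z)) (\<lambda>i z. z $ i - coord_rep c f z $ i) v"
proof -
  let ?\<phi> = "\<lambda>z. snd c (chart_inv x z)" and ?\<psi> = "\<lambda>z. snd x (chart_inv c z)"
  have ox: "open (fst x)" "p \<in> fst x" "is_chart x" and oc: "open (fst c)" "p \<in> fst c" "is_chart c"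
    using x c by (auto simp: local_coordinates_def is_chart_def)
  have inv: "eventually (\<lambda>y. chart_inv x (?\<psi> y) = chart_inv c y \<and> ?\<phi> (?\<psi> y) = y) (nhds 0)"
    using local_coordinates_eventually[OF c ox(1,2)]
    by eventually_elim (auto simp: chart_inv_left[OF ox(3)])
  \<comment> \<open>The conjugation formula needs both a point and its image in the domain of
    \<open>c\<close>. These points form a neighbourhood of \<open>p\<close> because \<open>p\<close>
    is fixed.\<close>
  have "open (fst c \<inter> f -` fst c)" "p \<in> fst c \<inter> f -` fst c"
    using oc open_vimage_f fp by auto
  from local_coordinates_eventually[OF x this]
  have rep: "eventually (\<lambda>z. \<forall>i. z $ i - coord_rep x f z $ i = z $ i - ?\<psi> (coord_rep c f (?\<phi> z)) $ i) (nhds 0)"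
    by eventually_elim (auto simp: coord_rep_def chart_inv_left[OF oc(3)])
  have res': "is_residue UNIV (\<lambda>y. u (chart_inv x (?\<psi> y))) (\<lambda>i z. z $ i - coord_rep c f z $ i) v"
    by (rule is_residue_coordinate_change[OF hol_map0_transition[OF x c] hol_map0_transition[OF c x]
          hol_map0_coord_rep[OF c] u _ rep _ res]) (use inv in \<open>auto elim: eventually_mono\<close>)
  show ?thesis
    by (rule is_residue_congruent[OF hol0_compose[OF u hol_map0_transition[OF c x]] _ _ res', where e="\<lambda>_ _. 0"])
      (use inv in \<open>auto elim!: eventually_mono\<close>)
qed

end

section \<open>Traces in local frames\<close>

text \<open>The fibres are linear only through \<open>vadd\<close> and \<open>vscale\<close>, so a
  functional is expanded by induction on the number \<open>n\<close> of leading coordinates that may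
  be nonzero.\<close>

lemma fibre_linear_expand:
  assumes S: "is_triv E S" and q: "q \<in> tdom S"
    and add: "\<And>u v. u \<in> fibre E q \<Longrightarrow> v \<in> fibre E q \<Longrightarrow> L (vadd E u v) = L u + L v"
    and scale: "\<And>k u. u \<in> fibre E q \<Longrightarrow> L (vscale E k u) = (k * L u :: complex)"
    and v: "v \<in> fibre E q"
  shows "L v = (\<Sum>k<trank S. tcoord S v k * L (frame E S k q))"
proof -
  let ?X = "{x :: nat \<Rightarrow> complex. \<forall>i\<ge>trank S. x i = 0}"
  have bij: "bij_betw (tcoord S) (fibre E q) ?X"
    and addS: "\<And>u v. u \<in> fibre E q \<Longrightarrow> v \<in> fibre E q \<Longrightarrow> vadd E u v \<in> fibre E q \<and>
           tcoord S (vadd E u v) = (\<lambda>i. tcoord S u i + tcoord S v i)"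
    and scaleS: "\<And>k u. u \<in> fibre E q \<Longrightarrow> vscale E k u \<in> fibre E q \<and>
           tcoord S (vscale E k u) = (\<lambda>i. k * tcoord S u i)"
    using S q by (simp_all add: is_triv_def)
  define g where "g = inv_into (fibre E q) (tcoord S)"
  have g: "g x \<in> fibre E q" "tcoord S (g x) = x" if "x \<in> ?X" for x
  proof -
    have im: "tcoord S ` fibre E q = ?X" using bij by (simp add: bij_betw_def)
    show "g x \<in> fibre E q" unfolding g_def by (rule inv_into_into) (use that im in simp)
    show "tcoord S (g x) = x" unfolding g_def by (rule f_inv_into_f) (use that im in simp)
  qed
  have inj: "u = u'" if "u \<in> fibre E q" "u' \<in> fibre E q" "tcoord S u = tcoord S u'" for u u'
    using bij that unfolding bij_betw_def inj_on_def by blast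
  have "\<forall>x. (\<forall>i\<ge>n. x i = 0) \<longrightarrow> L (g x) = (\<Sum>k<n. x k * L (frame E S k q))" if "n \<le> trank S" for n
    using that
  proof (induction n)
    case 0
    have "(\<lambda>i. 0) \<in> ?X" by simp
    note z = g[OF this]
    \<comment> \<open>The bundle record has no zero section; the zero vector is recognised as the
      multiple by 0 of itself.\<close>
    have "vscale E 0 (g (\<lambda>i. 0)) = g (\<lambda>i. 0)"
      by (rule inj) (use scaleS[OF z(1)] z in auto)
    then have "L (g (\<lambda>i. 0)) = 0" using scale[OF z(1), of 0] by simp
    moreover have "x = (\<lambda>i. 0)" if "\<forall>i\<ge>0. x i = 0" for x :: "nat \<Rightarrow> complex"
      using that by (simp add: fun_eq_iff)
    ultimately show ?case by (metis lessThan_0 sum.empty)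
  next
    case (Suc n)
    show ?case
    proof (intro allI impI)
      fix x :: "nat \<Rightarrow> complex" assume x: "\<forall>i\<ge>Suc n. x i = 0"
      let ?x' = "x(n := 0)" and ?e = "\<lambda>i. if i = n then 1 else 0 :: complex"
      have X: "x \<in> ?X" "?x' \<in> ?X" "?e \<in> ?X" using x Suc.prems by auto
      have s: "vscale E (x n) (g ?e) \<in> fibre E q" "tcoord S (vscale E (x n) (g ?e)) = (\<lambda>i. x n * ?e i)"
        using scaleS[OF g(1)[OF X(3)], of "x n"] g(2)[OF X(3)] by simp_all
      have a: "vadd E (g ?x') (vscale E (x n) (g ?e)) \<in> fibre E q"
        "tcoord S (vadd E (g ?x') (vscale E (x n) (g ?e))) = (\<lambda>i. ?x' i + x n * ?e i)"
        using addS[OF g(1)[OF X(2)] s(1)] g(2)[OF X(2)] s(2) by simp_all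
      have "g x = vadd E (g ?x') (vscale E (x n) (g ?e))"
      proof (rule inj[OF g(1)[OF X(1)] a(1)])
        show "tcoord S (g x) = tcoord S (vadd E (g ?x') (vscale E (x n) (g ?e)))"
          unfolding a(2) g(2)[OF X(1)] by (simp add: fun_eq_iff)
      qed
      then have "L (g x) = L (g ?x') + x n * L (g ?e)"
        using add[OF g(1)[OF X(2)] s(1)] scale[OF g(1)[OF X(3)]] by simp
      also have "g ?e = frame E S n q" by (simp add: frame_def g_def)
      also have "L (g ?x') = (\<Sum>k<n. ?x' k * L (frame E S k q))"
      proof -
        have "\<forall>i\<ge>n. ?x' i = 0"
        proof (intro allI impI)
          fix i assume "n \<le> i"
          then have "i = n \<or> Suc n \<le> i" by auto
          then show "?x' i = 0" using x by auto
        qed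
        then show ?thesis using Suc.IH[OF Suc_leD[OF Suc.prems]] by blast
      qed
      finally show "L (g x) = (\<Sum>k<Suc n. x k * L (frame E S k q))" by simp
    qed
  qed
  moreover have "tcoord S v \<in> ?X" using bij v by (auto simp: bij_betw_def)
  ultimately have "L (g (tcoord S v)) = (\<Sum>k<trank S. tcoord S v k * L (frame E S k q))" by simp
  moreover have "g (tcoord S v) = v"
    using bij v by (simp add: g_def bij_betw_inv_into_left)
  ultimately show ?thesis by simp
qed

lemma frame_in_fibre:
  assumes S: "is_triv E S" and q: "q \<in> tdom S" and k: "k < trank S"
  shows "frame E S k q \<in> fibre E q" and "tcoord S (frame E S k q) = (\<lambda>i. if i = k then 1 else 0)"
proof -
  have "tcoord S ` fibre E q = {x. \<forall>i\<ge>trank S. x i = 0}"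
    using S q by (auto simp: is_triv_def bij_betw_def)
  then have e: "(\<lambda>i. if i = k then 1 else 0) \<in> tcoord S ` fibre E q" using k by auto
  show "frame E S k q \<in> fibre E q" unfolding frame_def using e by (rule inv_into_into)
  show "tcoord S (frame E S k q) = (\<lambda>i. if i = k then 1 else 0)" unfolding frame_def using e by (rule f_inv_into_f)
qed

lemma tcoord_expand:
  assumes S: "is_triv E S" "q \<in> tdom S" and T: "is_triv E T" "q \<in> tdom T" and v: "v \<in> fibre E q"
  shows "tcoord T v i = (\<Sum>j<trank S. tcoord S v j * tcoord T (frame E S j q) i)"
proof (rule fibre_linear_expand[OF S _ _ v, where L="\<lambda>v. tcoord T v i"])
  fix u v assume "u \<in> fibre E q" "v \<in> fibre E q"
  then show "tcoord T (vadd E u v) i = tcoord T u i + tcoord T v i"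
    using T by (simp add: is_triv_def)
next
  fix k u assume "u \<in> fibre E q"
  then show "tcoord T (vscale E k u) i = k * tcoord T u i"
    using T by (simp add: is_triv_def)
qed

context fixed_point
begin

text \<open>The matrix in the frame \<open>T\<close> is P M Q, with one transition matrix P at q but
  the other, Q, at f q. If Q were taken at q, the trace would be invariant under the change of
  frame. By Hadamard's lemma Q at f q and Q at q differ by an element of the ideal of the z_l - f_l.
  The frame \<open>S\<close> is one of the given trivialisations because holomorphy of \<Phi> is
  stated for these.\<close>

lemma frame_trace_congruent:
  assumes E: "holomorphic_vector_bundle A E" and \<Phi>: "linearisation A f E \<Phi>"
    and T: "local_frame_at A E p T" and S: "S \<in> trivs E" "p \<in> tdom S" and c: "local_coordinates A p c"
  obtains e where "hol0 (\<lambda>z. frame_trace f E \<Phi> S (chart_inv c z))" "\<And>l. hol0 (e l)"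
    "eventually (\<lambda>z. frame_trace f E \<Phi> T (chart_inv c z) = frame_trace f E \<Phi> S (chart_inv c z) +
      (\<Sum>l\<in>UNIV. e l z * (z $ l - coord_rep c f z $ l))) (nhds 0)"
proof -
  let ?F = "coord_rep c f" and ?q = "chart_inv c"
  have tS: "is_triv E S" using E S(1) by (simp add: holomorphic_vector_bundle_def)
  have tT: "is_triv E T" "p \<in> tdom T" using T by (auto simp: local_frame_at_def)
  have oST: "open (tdom S)" "open (tdom T)" using tS tT by (auto simp: is_triv_def)
  define P where "P i j q = tcoord T (frame E S j q) i" for i j q
  define Q where "Q k i q = tcoord S (frame E T i q) k" for k i q
  define M where "M j k q = tcoord S (\<Phi> q (frame E S k (f q))) j" for j k q
  have hP: "hol0 (\<lambda>z. P i j (?q z))" if "i < trank T" "j < trank S" for i j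
    unfolding P_def by (rule hol0_mfd[OF c, where W="tdom S \<inter> tdom T"])
      (use T S tT oST that in \<open>auto simp: local_frame_at_def triv_compatible_def\<close>)
  have hQ: "hol0 (\<lambda>z. Q k i (?q z))" if "i < trank T" "k < trank S" for i k
    unfolding Q_def by (rule hol0_mfd[OF c, where W="tdom S \<inter> tdom T"])
      (use T S tT oST that in \<open>auto simp: local_frame_at_def triv_compatible_def\<close>)
  have hM: "hol0 (\<lambda>z. M j k (?q z))" if "j < trank S" "k < trank S" for j k
    unfolding M_def by (rule hol0_mfd[OF c, where W="tdom S \<inter> f -` tdom S"])
      (use \<Phi> S oST that fp open_vimage_f in \<open>auto simp: linearisation_def\<close>)
  have trS: "frame_trace f E \<Phi> S q = (\<Sum>k<trank S. M k k q)" for q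
    by (simp add: frame_trace_def M_def)
  have \<Phi>_fibre: "\<Phi> q u \<in> fibre E q" if "u \<in> fibre E (f q)" for q u
    using \<Phi> that by (auto simp: linearisation_def)
  have \<Phi>_add: "\<Phi> q (vadd E u v) = vadd E (\<Phi> q u) (\<Phi> q v)" if "u \<in> fibre E (f q)" "v \<in> fibre E (f q)" for q u v
    using \<Phi> that by (auto simp: linearisation_def)
  have \<Phi>_scale: "\<Phi> q (vscale E k u) = vscale E k (\<Phi> q u)" if "u \<in> fibre E (f q)" for q k u
    using \<Phi> that by (auto simp: linearisation_def)
  have trT: "frame_trace f E \<Phi> T q = (\<Sum>i<trank T. \<Sum>k<trank S. \<Sum>j<trank S. Q k i (f q) * (M j k q * P i j q))"
    if q: "q \<in> tdom S" "q \<in> tdom T" "f q \<in> tdom S" "f q \<in> tdom T" for q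
    unfolding frame_trace_def
  proof (rule sum.cong[OF refl])
    fix i assume "i \<in> {..<trank T}"
    then have fr: "frame E T i (f q) \<in> fibre E (f q)" by (intro frame_in_fibre(1)[OF tT(1) q(4)]) simp
    have "tcoord T (\<Phi> q (frame E T i (f q))) i =
        (\<Sum>k<trank S. tcoord S (frame E T i (f q)) k * tcoord T (\<Phi> q (frame E S k (f q))) i)"
    proof (rule fibre_linear_expand[OF tS q(3) _ _ fr, where L="\<lambda>v. tcoord T (\<Phi> q v) i"])
      fix u v assume "u \<in> fibre E (f q)" "v \<in> fibre E (f q)"
      then show "tcoord T (\<Phi> q (vadd E u v)) i = tcoord T (\<Phi> q u) i + tcoord T (\<Phi> q v) i"
        using tT(1) q(2) \<Phi>_fibre by (simp add: \<Phi>_add is_triv_def)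
    next
      fix k u assume "u \<in> fibre E (f q)"
      then show "tcoord T (\<Phi> q (vscale E k u)) i = k * tcoord T (\<Phi> q u) i"
        using tT(1) q(2) \<Phi>_fibre by (simp add: \<Phi>_scale is_triv_def)
    qed
    also have "\<dots> = (\<Sum>k<trank S. \<Sum>j<trank S. Q k i (f q) * (M j k q * P i j q))"
    proof (rule sum.cong[OF refl])
      fix k assume "k \<in> {..<trank S}"
      then have "frame E S k (f q) \<in> fibre E (f q)" by (intro frame_in_fibre(1)[OF tS q(3)]) simp
      from tcoord_expand[OF tS q(1) tT(1) q(2) \<Phi>_fibre[OF this], of i]
      show "tcoord S (frame E T i (f q)) k * tcoord T (\<Phi> q (frame E S k (f q))) i =
          (\<Sum>j<trank S. Q k i (f q) * (M j k q * P i j q))"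
        by (simp add: Q_def M_def P_def sum_distrib_left)
    qed
    finally show "tcoord T (\<Phi> q (frame E T i (f q))) i =
        (\<Sum>k<trank S. \<Sum>j<trank S. Q k i (f q) * (M j k q * P i j q))" .
  qed
  \<comment> \<open>At the same point the two transition matrices are inverse to each other, which
    collapses the sum over the frame \<open>T\<close>.\<close>
  have QP: "(\<Sum>i<trank T. Q k i q * P i j q) = (if k = j then 1 else 0)"
    if q: "q \<in> tdom S" "q \<in> tdom T" and j: "j < trank S" for q k j
    using tcoord_expand[OF tT(1) q(2) tS q(1) frame_in_fibre(1)[OF tS q(1) j], of k]
    by (simp add: frame_in_fibre(2)[OF tS q(1) j] Q_def P_def mult.commute)
  let ?Q = "\<lambda>(k, i) d. (\<forall>l. hol0 (d l)) \<and> eventually (\<lambda>z. Q k i (?q (?F z)) = Q k i (?q z) +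
      (\<Sum>l\<in>UNIV. d l z * (?F z $ l - z $ l))) (nhds 0)"
  have Hk: "\<exists>d. ?Q (k, i) d" if "k < trank S" "i < trank T" for k i
    unfolding prod.case
    by (rule Hadamard[OF hQ[OF that(2,1)] hol_map0_coord_rep[OF c] hol_map0_id],
        rule exI, intro conjI allI, assumption, assumption)
  have "\<exists>d. \<forall>ki\<in>{..<trank S} \<times> {..<trank T}. ?Q ki (d ki)"
  proof (rule bchoice, rule ballI)
    fix ki assume "ki \<in> {..<trank S} \<times> {..<trank T}"
    then show "\<exists>d. ?Q ki d" using Hk by (elim SigmaE) simp
  qed
  then obtain d where d: "\<forall>ki\<in>{..<trank S} \<times> {..<trank T}. ?Q ki (d ki)" ..
  have hd: "hol0 (d (k, i) l)" if "k < trank S" "i < trank T" for k i l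
    using d that by auto
  have "eventually (\<lambda>z. \<forall>ki\<in>{..<trank S} \<times> {..<trank T}.
      Q (fst ki) (snd ki) (?q (?F z)) = Q (fst ki) (snd ki) (?q z) +
      (\<Sum>l\<in>UNIV. d ki l z * (?F z $ l - z $ l))) (nhds 0)"
    by (rule eventually_ball_finite) (use d in auto)
  then have ev: "eventually (\<lambda>z. \<forall>k<trank S. \<forall>i<trank T.
      Q k i (?q (?F z)) = Q k i (?q z) + (\<Sum>l\<in>UNIV. d (k, i) l z * (?F z $ l - z $ l))) (nhds 0)"
    by eventually_elim auto
  define e where "e l z = (\<Sum>i<trank T. \<Sum>k<trank S. \<Sum>j<trank S.
      - d (k, i) l z * (M j k (?q z) * P i j (?q z)))" for l z
  have he: "hol0 (e l)" for l
    unfolding e_def by (intro hol0_sum hol0_mult hol0_minus hd hM hP) auto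
  have hS: "hol0 (\<lambda>z. frame_trace f E \<Phi> S (?q z))"
    unfolding trS by (intro hol0_sum hM) auto
  have oc: "open (fst c)" "p \<in> fst c" "is_chart c" using c by (auto simp: local_coordinates_def is_chart_def)
  let ?W = "(tdom S \<inter> tdom T) \<inter> f -` (tdom S \<inter> tdom T \<inter> fst c)"
  have "open ?W" "p \<in> ?W" using oST oc S tT fp by (auto intro!: open_Int open_vimage_f)
  from local_coordinates_eventually[OF c this] ev
  have "eventually (\<lambda>z. frame_trace f E \<Phi> T (?q z) = frame_trace f E \<Phi> S (?q z) +
      (\<Sum>l\<in>UNIV. e l z * (z $ l - ?F z $ l))) (nhds 0)"
  proof eventually_elim
    fix z
    let ?y = "?q z"
    assume "?y \<in> ?W \<and> ?y \<in> fst c \<and> snd c ?y = z"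
    then have y: "?y \<in> tdom S" "?y \<in> tdom T" "f ?y \<in> tdom S" "f ?y \<in> tdom T" "f ?y \<in> fst c" by auto
    assume Qz: "\<forall>k<trank S. \<forall>i<trank T.
      Q k i (?q (?F z)) = Q k i (?q z) + (\<Sum>l\<in>UNIV. d (k, i) l z * (?F z $ l - z $ l))"
    have qF: "?q (?F z) = f ?y" by (simp add: coord_rep_def chart_inv_left[OF oc(3) y(5)])
    let ?D = "\<lambda>k i. \<Sum>l\<in>UNIV. d (k, i) l z * (?F z $ l - z $ l)"
    have "frame_trace f E \<Phi> T ?y =
        (\<Sum>i<trank T. \<Sum>k<trank S. \<Sum>j<trank S. (Q k i ?y + ?D k i) * (M j k ?y * P i j ?y))"
      unfolding trT[OF y(1-4)] using Qz by (intro sum.cong refl) (simp add: qF)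
    also have "\<dots> = (\<Sum>i<trank T. \<Sum>k<trank S. \<Sum>j<trank S. M j k ?y * (Q k i ?y * P i j ?y)) +
        (\<Sum>i<trank T. \<Sum>k<trank S. \<Sum>j<trank S. ?D k i * (M j k ?y * P i j ?y))"
      unfolding sum.distrib[symmetric] by (intro sum.cong refl) (simp add: algebra_simps)
    also have "(\<Sum>i<trank T. \<Sum>k<trank S. \<Sum>j<trank S. M j k ?y * (Q k i ?y * P i j ?y)) =
        (\<Sum>k<trank S. \<Sum>j<trank S. M j k ?y * (\<Sum>i<trank T. Q k i ?y * P i j ?y))"
      by (subst sum.swap, rule sum.cong[OF refl], subst sum.swap) (simp add: sum_distrib_left)
    also have "\<dots> = (\<Sum>k<trank S. \<Sum>j<trank S. if j = k then M k k ?y else 0)"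
      by (intro sum.cong refl) (auto simp: QP[OF y(1,2)])
    also have "\<dots> = frame_trace f E \<Phi> S ?y" by (simp add: trS)
    also have "(\<Sum>i<trank T. \<Sum>k<trank S. \<Sum>j<trank S. ?D k i * (M j k ?y * P i j ?y)) =
        (\<Sum>i<trank T. \<Sum>k<trank S. \<Sum>j<trank S. \<Sum>l\<in>UNIV.
          - d (k, i) l z * (M j k ?y * P i j ?y) * (z $ l - ?F z $ l))"
      by (intro sum.cong refl) (simp add: sum_distrib_right, intro sum.cong refl, simp add: algebra_simps)
    also have "\<dots> = (\<Sum>l\<in>UNIV. e l z * (z $ l - ?F z $ l))"
      unfolding e_def sum_distrib_right
      by (simp only: sum.swap[where B="UNIV :: 'n set"])
    finally show "frame_trace f E \<Phi> T ?y = frame_trace f E \<Phi> S ?y +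
      (\<Sum>l\<in>UNIV. e l z * (z $ l - ?F z $ l))" .
  qed
  with hS he show ?thesis by (rule that)
qed

end

section \<open>The residue formula at a non-resonant fixed point\<close>

theorem corollary6p3:
  fixes A :: "('a::t2_space, 'n::finite) chart set"
    and \<D> :: "'a set set"
    and f :: "'a \<Rightarrow> 'a"
    and E :: "('a, 'e) vbundle"
    and \<Phi> :: "'a \<Rightarrow> 'e \<Rightarrow> 'e"
    and p :: 'a
    and x c :: "('a, 'n) chart"
    and I :: "'n set"
    and a :: "'n \<Rightarrow> complex^'n \<Rightarrow> complex"
    and T T' :: "('a, 'e) triv"
  assumes "complex_manifold A"
    and "snc_divisor A \<D>"
    and "strict_log_self_map A \<D> f"
    and "holomorphic_vector_bundle A E"
    and "linearisation A f E \<Phi>"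
    and "p \<in> \<Union>\<D>"
    and "p isolated_in {q. f q = q}"
    and "adapted_coordinates A \<D> p c I"
    and "normal_units c I f a"
    and "normally_nonresonant I a"
    and "local_coordinates A p x"
    and "local_frame_at A E p T"
    and "local_frame_at A E p T'"
  shows "lefschetz_term f E \<Phi> x T =
    grothendieck_residue (- I)
      (\<lambda>w. frame_trace f E \<Phi> T' (chart_inv c w) * inverse (det_normal I a w))
      (\<lambda>\<alpha> w. w $ \<alpha> - coord_rep c f w $ \<alpha>)"
proof -
  have "f p = p" using \<open>p isolated_in {q. f q = q}\<close> by (auto simp: isolated_in_def)
  then interpret fixed_point A f p
    by unfold_locales (use assms in \<open>auto simp: strict_log_self_map_def\<close>)
  have c: "local_coordinates A p c" using assms(8) by (simp add: adapted_coordinates_def)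
  note x = assms(11)
  let ?gx = "\<lambda>i z. z $ i - coord_rep x f z $ i" and ?gc = "\<lambda>i z. z $ i - coord_rep c f z $ i"
  let ?\<tau> = "\<lambda>T c z. frame_trace f E \<Phi> T (chart_inv c z)"
  have "p \<in> (\<Union>T\<in>trivs E. tdom T)" using assms(4) by (simp add: holomorphic_vector_bundle_def)
  \<comment> \<open>A frame among the given trivialisations serves as reference: the traces in
    \<open>T\<close> and in \<open>T'\<close> are each compared with the trace in
    \<open>S\<close>.\<close>
  then obtain S where S: "S \<in> trivs E" "p \<in> tdom S" by blast
  let ?e = "\<lambda>U y e. (\<forall>l. hol0 (e l)) \<and> eventually (\<lambda>z. ?\<tau> U y z = ?\<tau> S y z +
      (\<Sum>l\<in>UNIV. e l z * (z $ l - coord_rep y f z $ l))) (nhds 0)"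
  have trace: "hol0 (?\<tau> U y)" "\<exists>e. ?e U y e"
    if U: "local_frame_at A E p U" and y: "local_coordinates A p y" for U y
  proof -
    obtain e where e: "hol0 (?\<tau> S y)" "\<And>l. hol0 (e l)"
      "eventually (\<lambda>z. ?\<tau> U y z = ?\<tau> S y z + (\<Sum>l\<in>UNIV. e l z * (z $ l - coord_rep y f z $ l))) (nhds 0)"
      by (rule frame_trace_congruent[OF assms(4,5) U S y], rule that)
    have "hol0 (\<lambda>z. ?\<tau> S y z + (\<Sum>l\<in>UNIV. e l z * (z $ l - coord_rep y f z $ l)))"
      by (intro hol0_add e(1) hol0_sum hol0_mult e(2) hol0_diff hol0_nth hol_map0_nth[OF hol_map0_coord_rep[OF y]])
    then show "hol0 (?\<tau> U y)" using e(3) by (rule hol0_cong)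
    show "\<exists>e. ?e U y e" using e(2,3) by (intro exI[of _ e] conjI allI)
  qed
  have frames: "is_residue UNIV (?\<tau> U c) ?gc v" if U: "local_frame_at A E p U" and U': "local_frame_at A E p U'"
    and res: "is_residue UNIV (?\<tau> U' c) ?gc v" for U U' v
  proof -
    obtain e where e0: "?e U c e" using trace(2)[OF U c] ..
    obtain e' where e0': "?e U' c e'" using trace(2)[OF U' c] ..
    note e = e0[THEN conjunct1, rule_format] e0[THEN conjunct2]
    note e' = e0'[THEN conjunct1, rule_format] e0'[THEN conjunct2]
    have "eventually (\<lambda>z. z \<in> coord_space UNIV \<longrightarrow> ?\<tau> U c z =
        ?\<tau> U' c z + (\<Sum>l\<in>UNIV. (e l z - e' l z) * ?gc l z)) (nhds 0)"
      using e(2) e'(2)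
    proof (eventually_elim, intro impI)
      fix z assume e: "?\<tau> U c z = ?\<tau> S c z + (\<Sum>l\<in>UNIV. e l z * ?gc l z)"
        and e': "?\<tau> U' c z = ?\<tau> S c z + (\<Sum>l\<in>UNIV. e' l z * ?gc l z)"
      have "(\<Sum>l\<in>UNIV. (e l z - e' l z) * ?gc l z) = (\<Sum>l\<in>UNIV. e l z * ?gc l z) - (\<Sum>l\<in>UNIV. e' l z * ?gc l z)"
        unfolding left_diff_distrib sum_subtractf ..
      with e e' show "?\<tau> U c z = ?\<tau> U' c z + (\<Sum>l\<in>UNIV. (e l z - e' l z) * ?gc l z)" by simp
    qed
    from is_residue_congruent[OF trace(1)[OF U' c] hol0_diff[OF e(1) e'(1)] this res] show ?thesis .
  qed
  obtain V where V: "open V" "0 \<in> V" "\<And>i. i \<in> I \<Longrightarrow> cn_holomorphic_on (a i) V"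
    "\<And>i z. i \<in> I \<Longrightarrow> z \<in> V \<Longrightarrow> coord_rep c f z $ i = z $ i * a i z"
    using assms(9) unfolding normal_units_def by blast
  have Fa: "eventually (\<lambda>z. \<forall>i\<in>I. coord_rep c f z $ i = z $ i * a i z) (nhds 0)"
    using eventually_nhds_in_open[OF V(1,2)] by eventually_elim (auto simp: V(4))
  have ha: "hol0 (a i)" if "i \<in> I" for i using V that unfolding hol0_def by blast
  \<comment> \<open>A finite product is nonzero only if every factor is, so that no
    \<open>a i 0\<close> equals 1.\<close>
  have a0: "a i 0 \<noteq> 1" if "i \<in> I" for i
    using assms(10) that by (auto simp: normally_nonresonant_def det_normal_def)
  have "is_residue UNIV (?\<tau> T x) ?gx v \<longleftrightarrow>
      is_residue (- I) (\<lambda>w. ?\<tau> T' c w * inverse (det_normal I a w)) ?gc v" for v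
  proof -
    have "is_residue UNIV (?\<tau> T x) ?gx v \<longleftrightarrow> is_residue UNIV (?\<tau> T c) ?gc v"
    proof
      show "is_residue UNIV (?\<tau> T c) ?gc v" if "is_residue UNIV (?\<tau> T x) ?gx v"
        by (rule is_residue_chart_change[OF x c trace(1)[OF assms(12) x] that])
      show "is_residue UNIV (?\<tau> T x) ?gx v" if "is_residue UNIV (?\<tau> T c) ?gc v"
        by (rule is_residue_chart_change[OF c x trace(1)[OF assms(12) c] that])
    qed
    also have "\<dots> \<longleftrightarrow> is_residue UNIV (?\<tau> T' c) ?gc v"
      by (rule iffI) (rule frames[OF assms(13,12)], assumption, rule frames[OF assms(12,13)], assumption)
    also have "\<dots> \<longleftrightarrow> is_residue (- I) (\<lambda>w. ?\<tau> T' c w * inverse (\<Prod>i\<in>I. 1 - a i w)) ?gc v"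
      by (rule is_residue_normal_iff[OF hol_map0_coord_rep[OF c] trace(1)[OF assms(13) c] ha a0 Fa])
    finally show ?thesis by (simp add: det_normal_def)
  qed
  \<comment> \<open>Two equal predicates have the same definite description.\<close>
  then have "is_residue UNIV (?\<tau> T x) ?gx =
      is_residue (- I) (\<lambda>w. ?\<tau> T' c w * inverse (det_normal I a w)) ?gc" by (rule ext)
  then show ?thesis unfolding lefschetz_term_def grothendieck_residue_eq by (rule arg_cong)
qed

end
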